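(* Let $H$ be a Hamiltonian on $(\mathbb{C}^d)^{\otimes n}$ with non-degenerate spectrum and non-degenerate spectral gaps, and let $A$ be an observable evolving in time governed by $H$. Let $|\psi\rangle$ be a random matrix product state drawn from $\mu_{d,n,D}$ and $|\psi'\rangle:=|\psi\rangle/\sqrt{\langle\psi|\psi\rangle}$. Then there are constants $c_1,c_2>0$, independent of the system parameters, such that for $n$ sufficiently large the infinite-time fluctuation $\Delta A^{\infty}_{\psi'}$ fulfills $$\mathrm{Pr}\left(\Delta A^{\infty}_{\psi'}\leq e^{-c_1\alpha(d,D)n}\right)\geq 1-e^{-c_2\alpha(d,D)n},$$ with $$\alpha(d,D)=\log\left(\frac{d-\frac{1}{dD^2}}{(1+\frac{1}{D})(1+\frac{1}{dD})}\right).$$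
   Context: Random matrix product state (RMPS) of local dimension $d$, system size $n$ and bond dimension $D$: draw $U^{(1)},\dots,U^{(n)}$ independently from the Haar measure on the unitary group $U(dD)$ acting on $\mathbb{C}^d\otimes\mathbb{C}^D$. Fix an orthonormal basis $|0\rangle,\dots,|d-1\rangle$ of $\mathbb{C}^d$ and define the $D\times D$ matrices $A^{(k)}_i:=(\langle i|\otimes \mathbb{1}_D)\,U^{(k)}\,(|0\rangle\otimes \mathbb{1}_D)$ for $0\le i\le d-1$. The RMPS is the (in general unnormalized) vector $$|\psi\rangle=\sum_{i_1,\dots,i_n=0}^{d-1}\mathrm{Tr}\left[A^{(1)}_{i_1}A^{(2)}_{i_2}\cdots A^{(n)}_{i_n}\right]|i_1,\dots,i_n\rangle\in(\mathbb{C}^d)^{\otimes n}$$ (periodic boundary conditions). Its distribution is denoted $\mu_{d,n,D}$. A Hamiltonian and an observable are Hermitian operators on $(\mathbb{C}^d)^{\otimes n}$. $H$ has non-degenerate spectrum if its eigenvalues $E_1,E_2,\dots$ are pairwise distinct, and non-degenerate spectral gaps if, for $a\neq b$, $E_a-E_b=E_j-E_k$ holds if and only if $a=j$ and $b=k$. With $A(t)=e^{iHt}Ae^{-iHt}$, for a vector $|\psi\rangle$ define $$A^{\infty}_{\psi}:=\lim_{t\to\infty}\frac{1}{t}\int_{0}^{t}\langle\psi|A(t')|\psi\rangle\,\mathrm{d}t',\qquad \Delta A^{\infty}_{\psi}:=\lim_{t\to\infty}\frac{1}{t}\int_{0}^t\left|\langle\psi|A(t')|\psi\rangle-A^{\i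nfty}_{\psi}\right|^2\mathrm{d}t'.$$
   Formalization: The observable A is required to have operator norm at most L(n) for some subexponential L, with "n sufficiently large" depending on L; for arbitrary A the claim fails, since rescaling A by a huge factor multiplies the fluctuation by its square. *)

theory Defs
  imports
    "HOL-Probability.Probability"
    "Jordan_Normal_Form.Char_Poly"
    "Jordan_Normal_Form.Schur_Decomposition"
begin

unbundle no vec_syntax
unbundle no inner_syntax

hide_const (open) Finite_Cartesian_Product.vec Finite_Cartesian_Product.mat

section \<open>Linear algebra on finite-dimensional complex spaces\<close>

definition hermitian_mat :: "nat \<Rightarrow> complex mat \<Rightarrow> bool" where
  "hermitian_mat N H \<longleftrightarrow> H \<in> carrier_mat N N \<and> mat_adjoint H = H"

definition unitary_group :: "nat \<Rightarrow> complex mat set" where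
  "unitary_group N =
     {U \<in> carrier_mat N N. U * mat_adjoint U = 1\<^sub>m N \<and> mat_adjoint U * U = 1\<^sub>m N}"

definition mat_trace :: "complex mat \<Rightarrow> complex" where
  "mat_trace X = (\<Sum>i<dim_row X. X $$ (i, i))"

definition mat_exp :: "complex mat \<Rightarrow> complex mat" where
  "mat_exp X = mat (dim_row X) (dim_row X) (\<lambda>(i, j). \<Sum>k. (X ^\<^sub>m k) $$ (i, j) / fact k)"

definition vec_nrm :: "complex vec \<Rightarrow> real" where
  "vec_nrm v = sqrt (Re (v \<bullet>c v))"

definition normalized :: "complex vec \<Rightarrow> complex vec" where
  "normalized v = complex_of_real (1 / vec_nrm v) \<cdot>\<^sub>v v"

definition op_norm :: "complex mat \<Rightarrow> real" where
  "op_norm X = (SUP v \<in> {v \<in> carrier_vec (dim_col X). vec_nrm v = 1}. vec_nrm (X *\<^sub>v v))"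

text \<open>\<open>es\<close> lists the eigenvalues of \<open>H\<close> with algebraic multiplicity; the list is
  unique up to reordering.\<close>

definition eigenvalue_list :: "complex mat \<Rightarrow> complex list \<Rightarrow> bool" where
  "eigenvalue_list H es \<longleftrightarrow> char_poly H = (\<Prod>e\<leftarrow>es. [:- e, 1:])"

definition nondegenerate_spectrum :: "complex mat \<Rightarrow> bool" where
  "nondegenerate_spectrum H \<longleftrightarrow> (\<exists>es. eigenvalue_list H es \<and> distinct es)"

definition nondegenerate_gaps :: "complex mat \<Rightarrow> bool" where
  "nondegenerate_gaps H \<longleftrightarrow> (\<exists>es. eigenvalue_list H es \<and>
     (\<forall>a < length es. \<forall>b < length es. \<forall>j < length es. \<forall>k < length es.
        a \<noteq> b \<longrightarrow> (es ! a - es ! b = es ! j - es ! k \<longleftrightarrow> a = j \<and> b = k)))"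

section \<open>Time evolution and infinite-time fluctuations\<close>

definition heisenberg :: "complex mat \<Rightarrow> complex mat \<Rightarrow> real \<Rightarrow> complex mat" where
  "heisenberg H A t =
     mat_exp ((\<i> * complex_of_real t) \<cdot>\<^sub>m H) * A * mat_exp ((- \<i> * complex_of_real t) \<cdot>\<^sub>m H)"

text \<open>\<open>v \<bullet>c w\<close> is conjugate-linear in \<open>w\<close>, so this is the bracket of \<open>X\<close> in the state \<open>\<psi>\<close>.\<close>

definition expect :: "complex vec \<Rightarrow> complex mat \<Rightarrow> complex" where
  "expect \<psi> X = (X *\<^sub>v \<psi>) \<bullet>c \<psi>"

definition time_average :: "(real \<Rightarrow> 'a :: euclidean_space) \<Rightarrow> 'a" where
  "time_average f = Lim at_top (\<lambda>t. (1 / t) *\<^sub>R integral {0..t} f)"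

definition equilibrium_value :: "complex mat \<Rightarrow> complex mat \<Rightarrow> complex vec \<Rightarrow> complex" where
  "equilibrium_value H A \<psi> = time_average (\<lambda>s. expect \<psi> (heisenberg H A s))"

definition fluctuation :: "complex mat \<Rightarrow> complex mat \<Rightarrow> complex vec \<Rightarrow> real" where
  "fluctuation H A \<psi> =
     time_average (\<lambda>s. (cmod (expect \<psi> (heisenberg H A s) - equilibrium_value H A \<psi>))\<^sup>2)"

section \<open>Haar measure on the unitary group\<close>

text \<open>The Borel \<open>\<sigma>\<close>-algebras of the unitary group and of the space of vectors, as subspaces
  of products of copies of the complex numbers.\<close>

definition unitary_borel :: "nat \<Rightarrow> complex mat measure" where
  "unitary_borel N = vimage_algebra (unitary_group N)
     (\<lambda>U. \<lambda>ij \<in> {..<N} \<times> {..<N}. U $$ ij) (\<Pi>\<^sub>M ij \<in> {..<N} \<times> {..<N}. borel)"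

definition vec_borel :: "nat \<Rightarrow> complex vec measure" where
  "vec_borel N = vimage_algebra (carrier_vec N)
     (\<lambda>v. \<lambda>i \<in> {..<N}. v $ i) (\<Pi>\<^sub>M i \<in> {..<N}. borel)"

text \<open>The group being compact, there is exactly one such measure, and it is also
  right-invariant.\<close>

definition is_haar :: "nat \<Rightarrow> complex mat measure \<Rightarrow> bool" where
  "is_haar N \<mu> \<longleftrightarrow> prob_space \<mu> \<and> sets \<mu> = sets (unitary_borel N) \<and>
     (\<forall>V \<in> unitary_group N. distr \<mu> \<mu> (\<lambda>U. V * U) = \<mu>)"

section \<open>Random matrix product states\<close>

text \<open>The tensor product of the spaces of dimensions \<open>d\<close> and \<open>D\<close> is indexed in Kronecker order:
  the product of the basis vectors \<open>i < d\<close> and \<open>a < D\<close> has index \<open>i * D + a\<close>. Hence the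
  columns belonging to the basis vector \<open>0\<close> of the first factor are those with index
  \<open>0 * D + b = b\<close>.\<close>

definition site_mat :: "nat \<Rightarrow> complex mat \<Rightarrow> nat \<Rightarrow> complex mat" where
  "site_mat D U i = mat D D (\<lambda>(a, b). U $$ (i * D + a, b))"

text \<open>In the same order, the product basis vector with labels \<open>i\<^sub>0, \<dots>, i\<^sub>n\<^sub>-\<^sub>1\<close> has as
  index the number whose \<open>n\<close> base-\<open>d\<close> digits, most significant first, are these labels.\<close>

definition digit :: "nat \<Rightarrow> nat \<Rightarrow> nat \<Rightarrow> nat \<Rightarrow> nat" where
  "digit d n x k = x div d ^ (n - 1 - k) mod d"

definition rmps :: "nat \<Rightarrow> nat \<Rightarrow> nat \<Rightarrow> (nat \<Rightarrow> complex mat) \<Rightarrow> complex vec" where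
  "rmps d n D U = vec (d ^ n) (\<lambda>x.
     mat_trace (foldr (*) (map (\<lambda>k. site_mat D (U k) (digit d n x k)) [0..<n]) (1\<^sub>m D)))"

definition rmps_distr :: "complex mat measure \<Rightarrow> nat \<Rightarrow> nat \<Rightarrow> nat \<Rightarrow> complex vec measure" where
  "rmps_distr \<mu> d n D = distr (\<Pi>\<^sub>M k \<in> {..<n}. \<mu>) (vec_borel (d ^ n)) (rmps d n D)"

definition rmps_rate :: "nat \<Rightarrow> nat \<Rightarrow> real" where
  "rmps_rate d D = ln ((real d - 1 / (real d * (real D)\<^sup>2)) /
     ((1 + 1 / real D) * (1 + 1 / (real d * real D))))"

text \<open>A bound \<open>\<Lambda> n\<close> on the norm of an observable on \<open>n\<close> sites that grows more slowly than
  every exponential. Without some such bound no decay estimate that holds uniformly over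
  observables is possible, since the fluctuation scales with the square of the observable.\<close>

definition subexponential :: "(nat \<Rightarrow> real) \<Rightarrow> bool" where
  "subexponential \<Lambda> \<longleftrightarrow> (\<forall>\<epsilon>>0. \<forall>\<^sub>F n in sequentially. \<Lambda> n \<le> exp (\<epsilon> * real n))"

end

theory Submission
  imports Defs
begin

text \<open>Expanding the state in the eigenbasis of the Hamiltonian, non-degenerate gaps leave only the
  off-diagonal terms in the time average, so that the fluctuation is at most the squared norm of the
  observable times the inverse participation ratio \<open>\<Sum>\<^sub>j |\<langle>j|\<psi>\<rangle>|\<^sup>4 / \<langle>\<psi>|\<psi>\<rangle>\<^sup>2\<close>. Numerator and denominator
  are controlled by second moments of the Haar measure. For fixed columns these moments are
  combinations of the identity and the swap, so averages of quartic expressions in \<open>\<psi>\<close> become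
  partition functions of a cyclic Ising-type chain with two states per site and a transfer matrix
  that can be diagonalised by hand: the numerator has mean at most \<open>2 ((D + 1) / (d D + 1))\<^sup>n\<close>, and
  \<open>\<langle>\<psi>|\<psi>\<rangle>\<close> has mean \<open>1\<close> and variance \<open>(d (D\<^sup>2 - 1) / (d\<^sup>2 D\<^sup>2 - 1))\<^sup>n\<close>. As \<open>\<alpha>(d, D) = ln ((d D - 1) / (D + 1))\<close>,
  both are at most \<open>2 e\<^sup>-\<^sup>\<alpha>\<^sup>n\<close>, and the inequalities of Markov and Chebyshev conclude.\<close>

section \<open>Spectral resolution of a Hamiltonian\<close>

text \<open>The eigenvectors of \<open>H\<close> are arbitrary, in general entangled, so the fourth
  moment of an amplitude does not factor over the sites. It is expanded instead into the
  \<open>2 ^ n\<close> patterns that choose identity or swap at each site. A pattern merely permutes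
  the product basis of two copies of the state space, so its form at \<open>v \<otimes> v\<close>
  has modulus at most 1 for every unit vector \<open>v\<close>. The weights of the patterns are
  nonnegative, and only their sum, the partition function, is left to compute. Two families of
  unitaries determine the second Haar moments: monomial matrices (phases and permutations) fix them
  up to the entries with all rows equal, and one rotation fixes those. Uniformity in
  \<open>d\<close> and \<open>D\<close> rests on a dichotomy. A rate at most 0 makes the asserted
  probability bound trivial; a positive rate is at least \<open>ln (5 / 4)\<close>, so constant
  factors and the growth of the observable are absorbed by a threshold on \<open>n\<close> alone.
  The cutoff for the participation sum is \<open>exp (- \<alpha> n / 2)\<close>: half of the decay
  is spent on the size of the fluctuation, half on the probability, and half of each again on the
  constants. Hence both constants are 1/4.\<close>

lemma mat_adjoint_index:
  "i < dim_col A \<Longrightarrow> j < dim_row A \<Longrightarrow> mat_adjoint A $$ (i, j) = cnj (A $$ (j, i))"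
  by (simp add: mat_adjoint_def mat_of_rows_index)

lemma mat_adjoint_dims [simp]:
  "dim_row (mat_adjoint A) = dim_col A" "dim_col (mat_adjoint A) = dim_row A"
  by (simp_all add: mat_adjoint_def)

lemma cscalar_prod_sum: "v \<bullet>c w = (\<Sum>i<dim_vec w. v $ i * cnj (w $ i))"
  by (simp add: scalar_prod_def lessThan_atLeast0)

lemma cscalar_prod_self: "v \<bullet>c v = complex_of_real (\<Sum>i<dim_vec v. (cmod (v $ i))\<^sup>2)"
  by (simp add: cscalar_prod_sum complex_norm_square del: of_real_power)

lemma vec_nrm_square: "(vec_nrm v)\<^sup>2 = (\<Sum>i<dim_vec v. (cmod (v $ i))\<^sup>2)"
  by (simp add: vec_nrm_def cscalar_prod_self sum_nonneg)

lemma mult_mat_vec_sum: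
  "i < dim_row A \<Longrightarrow> dim_vec v = dim_col A \<Longrightarrow>
    (A *\<^sub>v v) $ i = (\<Sum>k<dim_col A. A $$ (i, k) * v $ k)"
  by (simp add: scalar_prod_def lessThan_atLeast0)

lemma mult_mat_sum:
  "i < dim_row A \<Longrightarrow> j < dim_col B \<Longrightarrow> dim_col A = dim_row B \<Longrightarrow>
    (A * B) $$ (i, j) = (\<Sum>k<dim_row B. A $$ (i, k) * B $$ (k, j))"
  by (simp add: scalar_prod_def lessThan_atLeast0)

lemma hermitian_mat_index:
  assumes "hermitian_mat N H" "i < N" "j < N"
  shows "H $$ (j, i) = cnj (H $$ (i, j))"
proof -
  have "mat_adjoint H = H" "dim_row H = N" "dim_col H = N"
    using assms(1) by (auto simp: hermitian_mat_def)
  then show ?thesis using assms(2,3) mat_adjoint_index[of j H i] by metis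
qed

text \<open>Adjointness is stated for two matrices, entry by entry, because it serves twice: for a
  Hermitian matrix paired with itself, and for the exponentials of \<open>\<i> t H\<close> and
  \<open>- \<i> t H\<close> paired with each other.\<close>

lemma cscalar_adjoint:
  assumes "H \<in> carrier_mat N N" "G \<in> carrier_mat N N" "v \<in> carrier_vec N" "w \<in> carrier_vec N"
    and adj: "\<And>i k. i < N \<Longrightarrow> k < N \<Longrightarrow> cnj (G $$ (k, i)) = H $$ (i, k)"
  shows "(H *\<^sub>v v) \<bullet>c w = v \<bullet>c (G *\<^sub>v w)"
proof -
  have H: "dim_row H = N" "dim_col H = N" "dim_row G = N" "dim_col G = N"
    and d: "dim_vec v = N" "dim_vec w = N"
    using assms by auto
  have Hv: "(H *\<^sub>v u) $ i = (\<Sum>k<N. H $$ (i, k) * u $ k)"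
    "(G *\<^sub>v u) $ i = (\<Sum>k<N. G $$ (i, k) * u $ k)" if "dim_vec u = N" "i < N" for u i
    using mult_mat_vec_sum[of i H u] mult_mat_vec_sum[of i G u] that H by simp_all
  have "(H *\<^sub>v v) \<bullet>c w = (\<Sum>i<N. (\<Sum>k<N. H $$ (i, k) * v $ k) * cnj (w $ i))"
    unfolding cscalar_prod_sum d by (intro sum.cong refl) (simp add: Hv d del: index_mult_mat_vec)
  also have "\<dots> = (\<Sum>i<N. \<Sum>k<N. H $$ (i, k) * v $ k * cnj (w $ i))"
    by (simp only: sum_distrib_right)
  also have "\<dots> = (\<Sum>k<N. \<Sum>i<N. H $$ (i, k) * v $ k * cnj (w $ i))"
    by (rule sum.swap)
  also have "\<dots> = (\<Sum>k<N. \<Sum>i<N. v $ k * cnj (G $$ (k, i) * w $ i))"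
  proof (intro sum.cong refl)
    fix k i assume "k \<in> {..<N}" "i \<in> {..<N}"
    then have "cnj (G $$ (k, i)) = H $$ (i, k)" using adj by simp
    then show "H $$ (i, k) * v $ k * cnj (w $ i) = v $ k * cnj (G $$ (k, i) * w $ i)"
      by (simp only: complex_cnj_mult mult_ac)
  qed
  also have "\<dots> = (\<Sum>k<N. v $ k * cnj (\<Sum>i<N. G $$ (k, i) * w $ i))"
    by (simp only: cnj_sum sum_distrib_left)
  also have "\<dots> = v \<bullet>c (G *\<^sub>v w)"
    unfolding cscalar_prod_sum using H by (intro sum.cong) (simp_all add: Hv d del: index_mult_mat_vec)
  finally show ?thesis .
qed

lemma hermitian_mat_cscalar:
  assumes H: "hermitian_mat N H" and vw: "v \<in> carrier_vec N" "w \<in> carrier_vec N"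
  shows "(H *\<^sub>v v) \<bullet>c w = v \<bullet>c (H *\<^sub>v w)"
proof (rule cscalar_adjoint[of _ N])
  fix i k assume "i < N" "k < N"
  then show "cnj (H $$ (k, i)) = H $$ (i, k)" using hermitian_mat_index[OF H, of k i] by simp
qed (use assms in \<open>auto simp: hermitian_mat_def\<close>)

lemma eigenvalue_list_eigenvectors:
  assumes "H \<in> carrier_mat N N" "eigenvalue_list H es"
  shows "length es = N" "j < N \<Longrightarrow> \<exists>v. eigenvector H v (es ! j)"
proof -
  have "degree (char_poly H) = length es"
    using assms degree_linear_factors[of uminus es] by (simp add: eigenvalue_list_def)
  then show len: "length es = N" using degree_monic_char_poly[OF assms(1)] by simp
  assume "j < N"
  then have "es ! j \<in> set es" using len by simp
  then have "poly (char_poly H) (es ! j) = 0"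
    using assms(2) by (auto simp: eigenvalue_list_def poly_prod_list prod_list_zero_iff)
  then show "\<exists>v. eigenvector H v (es ! j)"
    using eigenvalue_root_char_poly[OF assms(1)] by (simp add: eigenvalue_def)
qed

lemma hermitian_eigenvalue_real:
  assumes H: "hermitian_mat N H" and v: "eigenvector H v e"
  shows "cnj e = e"
proof -
  have vc: "v \<in> carrier_vec N" "v \<noteq> 0\<^sub>v N" "H *\<^sub>v v = e \<cdot>\<^sub>v v"
    using H v by (auto simp: eigenvector_def hermitian_mat_def)
  have "e * (v \<bullet>c v) = (H *\<^sub>v v) \<bullet>c v" using vc by simp
  also have "\<dots> = v \<bullet>c (H *\<^sub>v v)" using hermitian_mat_cscalar[OF H] vc(1) by blast
  also have "\<dots> = cnj e * (v \<bullet>c v)" using vc by (simp add: conjugate_smult_vec)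
  finally show ?thesis using vc conjugate_square_eq_0_vec[of v N] by auto
qed

lemma hermitian_eigenvectors_orthogonal:
  assumes H: "hermitian_mat N H" and v: "eigenvector H v e" "eigenvector H w f" and "e \<noteq> f"
  shows "v \<bullet>c w = 0"
proof -
  have vc: "v \<in> carrier_vec N" "H *\<^sub>v v = e \<cdot>\<^sub>v v" "w \<in> carrier_vec N" "H *\<^sub>v w = f \<cdot>\<^sub>v w"
    using H v by (auto simp: eigenvector_def hermitian_mat_def)
  have "e * (v \<bullet>c w) = (H *\<^sub>v v) \<bullet>c w" using vc by simp
  also have "\<dots> = v \<bullet>c (H *\<^sub>v w)" using hermitian_mat_cscalar[OF H] vc(1,3) by blast
  also have "\<dots> = f * (v \<bullet>c w)"
    using vc hermitian_eigenvalue_real[OF H v(2)] by (simp add: conjugate_smult_vec)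
  finally show ?thesis using \<open>e \<noteq> f\<close> by auto
qed

definition kdelta :: "'a \<Rightarrow> 'a \<Rightarrow> complex" where
  "kdelta x y = of_bool (x = y)"

lemma kdelta_self [simp]: "kdelta x x = 1"
  by (simp add: kdelta_def)

lemma cnj_kdelta [simp]: "cnj (kdelta x y) = kdelta x y"
  by (simp add: kdelta_def)

lemma kdelta_idem [simp]: "kdelta x y * kdelta x y = kdelta x y"
  by (simp add: kdelta_def)

lemma kdelta_swap [simp]: "kdelta x y * kdelta y x = kdelta x y"
  by (simp add: kdelta_def)

lemma sum_kdelta:
  assumes "finite A" "k \<in> A"
  shows "(\<Sum>j\<in>A. kdelta k j) = 1" "(\<Sum>j\<in>A. kdelta k j * f j) = f k" "(\<Sum>j\<in>A. f j * kdelta k j) = f k"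
  using assms by (simp_all add: kdelta_def of_bool_def if_distrib if_distribR cong: if_cong)

text \<open>\<open>\<phi> j i\<close> is component \<open>i\<close> of basis vector
  \<open>j\<close>.\<close>

locale onb =
  fixes N :: nat and \<phi> :: "nat \<Rightarrow> nat \<Rightarrow> complex"
  assumes orth: "j < N \<Longrightarrow> k < N \<Longrightarrow> (\<Sum>i<N. \<phi> j i * cnj (\<phi> k i)) = kdelta j k"
    and complete: "i < N \<Longrightarrow> k < N \<Longrightarrow> (\<Sum>j<N. \<phi> j i * cnj (\<phi> j k)) = kdelta i k"

text \<open>Completeness follows from orthonormality because a right inverse of a square matrix is
  also a left inverse.\<close>

lemma onbI:
  assumes orth: "\<And>j k. j < N \<Longrightarrow> k < N \<Longrightarrow> (\<Sum>i<N. \<phi> j i * cnj (\<phi> k i)) = kdelta j k"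
  shows "onb N \<phi>"
proof
  fix i k assume ik: "i < N" "k < N"
  define P where "P = mat N N (\<lambda>(j, i). \<phi> j i)"
  define Q where "Q = mat N N (\<lambda>(i, k). cnj (\<phi> k i))"
  have PQ: "P \<in> carrier_mat N N" "Q \<in> carrier_mat N N" by (auto simp: P_def Q_def)
  have "P * Q = 1\<^sub>m N"
    by (rule eq_matI)
      (auto simp: P_def Q_def mult_mat_sum orth kdelta_def simp del: index_mult_mat(1))
  then have "Q * P = 1\<^sub>m N" using mat_mult_left_right_inverse PQ by blast
  then have "(Q * P) $$ (k, i) = (1\<^sub>m N) $$ (k, i)" by simp
  then show "(\<Sum>j<N. \<phi> j i * cnj (\<phi> j k)) = kdelta i k"
    using ik by (auto simp: P_def Q_def mult_mat_sum kdelta_def mult.commute simp del: index_mult_mat(1))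
qed (rule orth)

locale spectral_resolution = onb N \<phi> for N \<phi> +
  fixes H :: "complex mat" and E :: "nat \<Rightarrow> real"
  assumes carrier: "H \<in> carrier_mat N N"
    and entry: "i < N \<Longrightarrow> k < N \<Longrightarrow> H $$ (i, k) = (\<Sum>j<N. of_real (E j) * \<phi> j i * cnj (\<phi> j k))"

text \<open>With \<open>N\<close> distinct eigenvalues, one normalised eigenvector for each already
  forms an orthonormal basis: eigenvectors to different eigenvalues are orthogonal, and
  \<open>onbI\<close> supplies completeness.\<close>

lemma hermitian_spectral_resolution:
  assumes H: "hermitian_mat N H" and g: "nondegenerate_gaps H"
  obtains \<phi> E where "spectral_resolution N \<phi> H E"
    "\<And>a b j k. a < N \<Longrightarrow> b < N \<Longrightarrow> j < N \<Longrightarrow> k < N \<Longrightarrow> a \<noteq> b \<Longrightarrow> E a - E b = E j - E k \<Longrightarrow> a = j \<and> b = k"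
proof -
  have Hc: "H \<in> carrier_mat N N" using H by (simp add: hermitian_mat_def)
  obtain es where es: "eigenvalue_list H es" and
    gap: "\<And>a b j k. a < length es \<Longrightarrow> b < length es \<Longrightarrow> j < length es \<Longrightarrow> k < length es \<Longrightarrow>
       a \<noteq> b \<Longrightarrow> es ! a - es ! b = es ! j - es ! k \<Longrightarrow> a = j \<and> b = k"
    using g unfolding nondegenerate_gaps_def by blast
  have len: "length es = N" using eigenvalue_list_eigenvectors[OF Hc es] by simp
  obtain v where v: "\<And>j. j < N \<Longrightarrow> eigenvector H (v j) (es ! j)"
    using eigenvalue_list_eigenvectors(2)[OF Hc es] by metis
  define E where "E j = Re (es ! j)" for j
  have E: "es ! j = of_real (E j)" if "j < N" for j
    using hermitian_eigenvalue_real[OF H v[OF that]] by (simp add: E_def complex_eq_iff)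
  \<comment> \<open>Equal eigenvalues would make the gap between \<open>a\<close> and
    \<open>b\<close> equal to its own reverse, which \<open>gap\<close> excludes.\<close>
  have inj: "es ! a \<noteq> es ! b" if "a < N" "b < N" "a \<noteq> b" for a b
    using gap[of a b b a] that by (auto simp: len)
  have vc: "v j \<in> carrier_vec N" "v j \<noteq> 0\<^sub>v N" "H *\<^sub>v v j = (es ! j) \<cdot>\<^sub>v v j" if "j < N" for j
    using v[OF that] Hc by (auto simp: eigenvector_def)
  define r where "r j = vec_nrm (v j)" for j
  have r: "(r j)\<^sup>2 = (\<Sum>i<N. (cmod (v j $ i))\<^sup>2)" "r j \<noteq> 0" if "j < N" for j
  proof -
    show *: "(r j)\<^sup>2 = (\<Sum>i<N. (cmod (v j $ i))\<^sup>2)" using vc[OF that] by (simp add: r_def vec_nrm_square)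
    have "v j \<bullet>c v j \<noteq> 0" using vc[OF that] by auto
    then show "r j \<noteq> 0" using vc[OF that] * by (auto simp: cscalar_prod_self simp del: of_real_sum of_real_power)
  qed
  define \<phi> where "\<phi> j i = v j $ i / of_real (r j)" for j i
  have orth: "(\<Sum>i<N. \<phi> j i * cnj (\<phi> k i)) = kdelta j k" if jk: "j < N" "k < N" for j k
  proof -
    have "(\<Sum>i<N. \<phi> j i * cnj (\<phi> k i)) = (v j \<bullet>c v k) / of_real (r j * r k)"
      using vc[OF jk(2)] by (simp add: cscalar_prod_sum \<phi>_def sum_divide_distrib)
    also have "\<dots> = kdelta j k"
    proof (cases "j = k")
      case True
      then show ?thesis using r[OF jk(1)] vc[OF jk(1)]
        by (auto simp: kdelta_def cscalar_prod_self power2_eq_square simp del: of_real_sum of_real_mult)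
    next
      case False
      then show ?thesis
        using hermitian_eigenvectors_orthogonal[OF H v[OF jk(1)] v[OF jk(2)]] inj[OF jk]
        by (simp add: kdelta_def)
    qed
    finally show ?thesis .
  qed
  interpret onb N \<phi> by (rule onbI) (rule orth)
  have eig: "(\<Sum>k<N. H $$ (i, k) * \<phi> j k) = of_real (E j) * \<phi> j i" if "i < N" "j < N" for i j
  proof -
    have "(\<Sum>k<N. H $$ (i, k) * \<phi> j k) = (H *\<^sub>v v j) $ i / of_real (r j)"
      unfolding \<phi>_def times_divide_eq_right sum_divide_distrib[symmetric]
      using that vc(1)[OF that(2)] Hc mult_mat_vec_sum[of i H "v j"] by simp
    also have "\<dots> = of_real (E j) * \<phi> j i" using that vc[OF that(2)] E by (simp add: \<phi>_def)
    finally show ?thesis .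
  qed
  have entry: "H $$ (i, k) = (\<Sum>j<N. of_real (E j) * \<phi> j i * cnj (\<phi> j k))" if ik: "i < N" "k < N" for i k
  proof -
    have "H $$ (i, k) = (\<Sum>l<N. H $$ (i, l) * kdelta l k)"
      using ik by (simp add: kdelta_def of_bool_def if_distrib cong: if_cong)
    also have "\<dots> = (\<Sum>l<N. \<Sum>j<N. H $$ (i, l) * \<phi> j l * cnj (\<phi> j k))"
      using ik by (intro sum.cong refl) (simp add: complete[symmetric] sum_distrib_left mult.assoc)
    also have "\<dots> = (\<Sum>j<N. \<Sum>l<N. H $$ (i, l) * \<phi> j l * cnj (\<phi> j k))" by (rule sum.swap)
    also have "\<dots> = (\<Sum>j<N. of_real (E j) * \<phi> j i * cnj (\<phi> j k))"
      using ik by (intro sum.cong refl) (simp add: sum_distrib_right[symmetric] eig)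
    finally show ?thesis .
  qed
  have "spectral_resolution N \<phi> H E"
    by unfold_locales (use Hc entry in auto)
  moreover have "a = j \<and> b = k"
    if "a < N" "b < N" "j < N" "k < N" "a \<noteq> b" "E a - E b = E j - E k" for a b j k
    using gap[of a b j k] that by (simp add: len E flip: of_real_diff)
  ultimately show thesis by (rule that)
qed

section \<open>Infinite-time averages\<close>

lemma integral_cis:
  assumes "\<omega> \<noteq> 0" "t \<ge> 0"
  shows "((\<lambda>s. cis (\<omega> * s)) has_integral (cis (\<omega> * t) - 1) / (\<i> * of_real \<omega>)) {0..t}"
proof -
  have "((\<lambda>s. cis (\<omega> * s)) has_integral
      (cis (\<omega> * t) / (\<i> * of_real \<omega>) - cis (\<omega> * 0) / (\<i> * of_real \<omega>))) {0..t}"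
  proof (rule fundamental_theorem_of_calculus[OF \<open>t \<ge> 0\<close>])
    fix s assume "s \<in> {0..t}"
    have "((\<lambda>s. exp (\<i> * of_real \<omega> * of_real s) / (\<i> * of_real \<omega>)) has_vector_derivative
        exp (\<i> * of_real \<omega> * of_real s)) (at s within {0..t})"
      using \<open>\<omega> \<noteq> 0\<close> by (auto intro!: derivative_eq_intros has_vector_derivative_real_field)
    then show "((\<lambda>s. cis (\<omega> * s) / (\<i> * of_real \<omega>)) has_vector_derivative cis (\<omega> * s))
        (at s within {0..t})"
      by (simp add: cis_conv_exp mult.assoc)
  qed
  then show ?thesis by (simp add: diff_divide_distrib)
qed

lemma cis_average_tendsto:
  "((\<lambda>t. (1 / t) *\<^sub>R integral {0..t} (\<lambda>s. cis (\<omega> * s))) \<longlongrightarrow> of_bool (\<omega> = 0)) at_top"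
proof (cases "\<omega> = 0")
  case True
  have "(1 / t) *\<^sub>R integral {0..t} (\<lambda>s. cis (\<omega> * s)) = 1" if "t > 0" for t :: real
    using that True by (simp add: scaleR_conv_of_real)
  then have "\<forall>\<^sub>F t in at_top. (1 / t) *\<^sub>R integral {0..t} (\<lambda>s. cis (\<omega> * s)) = 1"
    using eventually_gt_at_top[of 0] by (rule eventually_mono[rotated])
  then show ?thesis using True by (simp add: tendsto_eventually)
next
  case False
  have "norm ((1 / t) *\<^sub>R integral {0..t} (\<lambda>s. cis (\<omega> * s))) \<le> (2 / \<bar>\<omega>\<bar>) / t" if "t > 0" for t
  proof -
    have "norm (cis (\<omega> * t) - 1) \<le> 2"
      using norm_triangle_ineq4[of "cis (\<omega> * t)" 1] by simp
    then have "norm ((cis (\<omega> * t) - 1) / (\<i> * of_real \<omega>)) \<le> 2 / \<bar>\<omega>\<bar>"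
      using False by (simp add: norm_divide norm_mult divide_right_mono)
    then show ?thesis
      using that integral_unique[OF integral_cis[OF False, of t]]
        divide_right_mono[of _ "2 / \<bar>\<omega>\<bar>" t] by simp
  qed
  then have "\<forall>\<^sub>F t in at_top. norm ((1 / t) *\<^sub>R integral {0..t} (\<lambda>s. cis (\<omega> * s))) \<le> (2 / \<bar>\<omega>\<bar>) / t"
    using eventually_gt_at_top[of 0] by (rule eventually_mono[rotated])
  moreover have "((\<lambda>t. (2 / \<bar>\<omega>\<bar>) / t) \<longlongrightarrow> 0) at_top"
    by (intro tendsto_divide_0[OF tendsto_const] filterlim_at_top_imp_at_infinity filterlim_ident)
  ultimately show ?thesis
    using False by (auto intro: Lim_null_comparison)
qed

text \<open>Evolved expectation values have this form, with the differences of energies as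
  frequencies. The index set is left arbitrary so that the squared modulus of such a sum is again
  one, over pairs of indices.\<close>

definition trig_sum :: "'k set \<Rightarrow> ('k \<Rightarrow> complex) \<Rightarrow> ('k \<Rightarrow> real) \<Rightarrow> real \<Rightarrow> complex" where
  "trig_sum K a \<omega> s = (\<Sum>k\<in>K. a k * cis (\<omega> k * s))"

lemma continuous_trig_sum: "continuous_on S (trig_sum K a \<omega>)"
  unfolding trig_sum_def cis_conv_exp by (intro continuous_intros)

lemma trig_sum_average_tendsto:
  assumes "finite K"
  shows "((\<lambda>t. (1 / t) *\<^sub>R integral {0..t} (trig_sum K a \<omega>)) \<longlongrightarrow> (\<Sum>k\<in>K. a k * of_bool (\<omega> k = 0))) at_top"
proof -
  have int: "(\<lambda>s. cis (r * s)) integrable_on {0..t}" for r t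
    unfolding cis_conv_exp by (intro integrable_continuous_interval continuous_intros)
  have "(1 / t) *\<^sub>R integral {0..t} (trig_sum K a \<omega>) =
      (\<Sum>k\<in>K. a k * ((1 / t) *\<^sub>R integral {0..t} (\<lambda>s. cis (\<omega> k * s))))" for t
    unfolding trig_sum_def using assms int
    by (subst integral_sum) (auto intro!: integrable_on_mult_right simp: scaleR_sum_right)
  then show ?thesis
    by (simp only:) (intro tendsto_sum tendsto_mult tendsto_const cis_average_tendsto)
qed

lemma time_average_trig_sum:
  "finite K \<Longrightarrow> time_average (trig_sum K a \<omega>) = (\<Sum>k\<in>K. a k * of_bool (\<omega> k = 0))"
  unfolding time_average_def by (intro tendsto_Lim trig_sum_average_tendsto) simp_all

lemma time_average_Re_trig_sum:
  assumes "finite K"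
  shows "time_average (\<lambda>s. Re (trig_sum K a \<omega> s)) = Re (\<Sum>k\<in>K. a k * of_bool (\<omega> k = 0))"
proof -
  have "integral {0..t} (\<lambda>s. Re (trig_sum K a \<omega> s)) = Re (integral {0..t} (trig_sum K a \<omega>))" for t
    using integral_linear[OF integrable_continuous_interval[OF continuous_trig_sum[of "{0..t}" K a \<omega>]] bounded_linear_Re]
    by (simp add: o_def)
  then have "((\<lambda>t. (1 / t) *\<^sub>R integral {0..t} (\<lambda>s. Re (trig_sum K a \<omega> s))) \<longlongrightarrow> Re (\<Sum>k\<in>K. a k * of_bool (\<omega> k = 0))) at_top"
    using tendsto_Re[OF trig_sum_average_tendsto[OF assms, of a \<omega>]] by simp
  then show ?thesis
    unfolding time_average_def by (intro tendsto_Lim) simp_all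
qed

text \<open>The time average consists of the terms of frequency 0, of which there may be many;
  subtracting it leaves pairwise distinct frequencies. In the square of the rest, a cross term
  oscillates with frequency \<open>\<omega> p - \<omega> q\<close> and averages to 0 unless
  \<open>p = q\<close>.\<close>

lemma trig_sum_fluctuation:
  assumes K: "finite K" and g: "\<And>p q. p \<in> K \<Longrightarrow> q \<in> K \<Longrightarrow> \<omega> p = \<omega> q \<Longrightarrow> \<omega> p \<noteq> 0 \<Longrightarrow> p = q"
  shows "time_average (\<lambda>s. (cmod (trig_sum K a \<omega> s - time_average (trig_sum K a \<omega>)))\<^sup>2) =
    (\<Sum>p\<in>{p \<in> K. \<omega> p \<noteq> 0}. (cmod (a p))\<^sup>2)"
proof -
  define L where "L = {p \<in> K. \<omega> p \<noteq> 0}"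
  have L: "finite L" using K by (simp add: L_def)
  have d: "trig_sum K a \<omega> s - time_average (trig_sum K a \<omega>) = trig_sum L a \<omega> s" for s
    unfolding time_average_trig_sum[OF K] unfolding trig_sum_def sum_subtractf[symmetric] L_def
    by (rule sum.mono_neutral_cong_right) (use K in auto)
  have "(cmod (trig_sum L a \<omega> s))\<^sup>2 =
      Re (trig_sum (L \<times> L) (\<lambda>(p, q). a p * cnj (a q)) (\<lambda>(p, q). \<omega> p - \<omega> q) s)" for s
  proof -
    have "of_real ((cmod (trig_sum L a \<omega> s))\<^sup>2) = trig_sum L a \<omega> s * cnj (trig_sum L a \<omega> s)"
      by (rule complex_norm_square)
    also have "\<dots> = (\<Sum>(p, q)\<in>L \<times> L. (a p * cis (\<omega> p * s)) * cnj (a q * cis (\<omega> q * s)))"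
      by (simp add: trig_sum_def sum_product sum.cartesian_product)
    also have "\<dots> = trig_sum (L \<times> L) (\<lambda>(p, q). a p * cnj (a q)) (\<lambda>(p, q). \<omega> p - \<omega> q) s"
      unfolding trig_sum_def
    proof (intro sum.cong refl, clarify)
      fix p q
      have "cis ((\<omega> p - \<omega> q) * s) = cis (\<omega> p * s) * cnj (cis (\<omega> q * s))"
        by (simp add: cis_cnj cis_mult left_diff_distrib)
      then show "a p * cis (\<omega> p * s) * cnj (a q * cis (\<omega> q * s)) =
          a p * cnj (a q) * cis ((\<omega> p - \<omega> q) * s)"
        by (simp only: complex_cnj_mult mult_ac)
    qed
    finally show ?thesis by (metis Re_complex_of_real)
  qed
  then have "time_average (\<lambda>s. (cmod (trig_sum L a \<omega> s))\<^sup>2) =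
      Re (\<Sum>(p, q)\<in>L \<times> L. a p * cnj (a q) * of_bool (\<omega> p - \<omega> q = 0))"
    using L by (simp add: time_average_Re_trig_sum case_prod_unfold)
  also have "(\<Sum>(p, q)\<in>L \<times> L. a p * cnj (a q) * of_bool (\<omega> p - \<omega> q = 0)) =
      (\<Sum>p\<in>L. \<Sum>q\<in>L. if p = q then a p * cnj (a q) else 0)"
    unfolding sum.cartesian_product[symmetric] using g by (intro sum.cong refl) (auto simp: L_def)
  also have "\<dots> = of_real (\<Sum>p\<in>L. (cmod (a p))\<^sup>2)"
    using L by (simp add: complex_norm_square del: of_real_power)
  finally show ?thesis by (simp add: d L_def)
qed

section \<open>Evolved expectation values in the energy eigenbasis\<close>

context onb
begin

lemma spectral_mult:
  assumes "i < N" "k < N"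
  shows "(\<Sum>l<N. (\<Sum>j<N. p j * \<phi> j i * cnj (\<phi> j l)) * (\<Sum>j<N. q j * \<phi> j l * cnj (\<phi> j k)))
    = (\<Sum>j<N. p j * q j * \<phi> j i * cnj (\<phi> j k))"
proof -
  have "(\<Sum>l<N. (\<Sum>j<N. p j * \<phi> j i * cnj (\<phi> j l)) * (\<Sum>j<N. q j * \<phi> j l * cnj (\<phi> j k))) =
     (\<Sum>l<N. \<Sum>j<N. \<Sum>j'<N. p j * \<phi> j i * q j' * cnj (\<phi> j' k) * (\<phi> j' l * cnj (\<phi> j l)))"
    unfolding sum_product by (intro sum.cong refl) (simp add: mult_ac)
  also have "\<dots> = (\<Sum>j<N. \<Sum>j'<N. \<Sum>l<N. p j * \<phi> j i * q j' * cnj (\<phi> j' k) * (\<phi> j' l * cnj (\<phi> j l)))"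
    by (subst sum.swap) (intro sum.cong refl sum.swap)
  also have "\<dots> = (\<Sum>j<N. \<Sum>j'<N. p j * \<phi> j i * q j' * cnj (\<phi> j' k) * kdelta j' j)"
    by (intro sum.cong refl) (simp add: sum_distrib_left[symmetric] orth)
  also have "\<dots> = (\<Sum>j<N. p j * q j * \<phi> j i * cnj (\<phi> j k))"
    by (simp add: kdelta_def of_bool_def if_distrib mult_ac cong: if_cong)
  finally show ?thesis .
qed

lemma parseval:
  "(\<Sum>j<N. (cmod (\<Sum>i<N. v i * cnj (\<phi> j i)))\<^sup>2) = (\<Sum>i<N. (cmod (v i))\<^sup>2)"
proof -
  have "complex_of_real (\<Sum>j<N. (cmod (\<Sum>i<N. v i * cnj (\<phi> j i)))\<^sup>2) =
      (\<Sum>j<N. \<Sum>i<N. \<Sum>l<N. v i * cnj (v l) * (\<phi> j l * cnj (\<phi> j i)))"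
    by (simp add: complex_norm_square sum_product mult_ac del: of_real_power)
  also have "\<dots> = (\<Sum>i<N. \<Sum>l<N. \<Sum>j<N. v i * cnj (v l) * (\<phi> j l * cnj (\<phi> j i)))"
    by (subst sum.swap) (intro sum.cong refl sum.swap)
  also have "\<dots> = (\<Sum>i<N. \<Sum>l<N. v i * cnj (v l) * kdelta l i)"
    by (intro sum.cong refl) (simp add: sum_distrib_left[symmetric] complete)
  also have "\<dots> = complex_of_real (\<Sum>i<N. (cmod (v i))\<^sup>2)"
    by (simp add: kdelta_def of_bool_def if_distrib complex_norm_square del: of_real_power cong: if_cong)
  finally show ?thesis using of_real_eq_iff by blast
qed

definition amplitude :: "complex vec \<Rightarrow> nat \<Rightarrow> complex" where
  "amplitude \<psi> j = (\<Sum>i<N. \<psi> $ i * cnj (\<phi> j i))"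

text \<open>This is \<open><j|A|k>\<close>. The action of \<open>A\<close> on vector
  \<open>k\<close> is kept as an inner sum so that \<open>parseval\<close> applies for fixed
  \<open>k\<close>.\<close>

definition matrix_element :: "complex mat \<Rightarrow> nat \<Rightarrow> nat \<Rightarrow> complex" where
  "matrix_element A j k = (\<Sum>i<N. (\<Sum>l<N. A $$ (i, l) * \<phi> k l) * cnj (\<phi> j i))"

lemma cscalar_expansion:
  assumes A: "A \<in> carrier_mat N N" and w: "w \<in> carrier_vec N"
    and u: "\<And>i. i < N \<Longrightarrow> w $ i = (\<Sum>k<N. u k * \<phi> k i)"
  shows "(A *\<^sub>v w) \<bullet>c w = (\<Sum>j<N. \<Sum>k<N. u k * cnj (u j) * matrix_element A j k)"
proof -
  have "(A *\<^sub>v w) $ i = (\<Sum>k<N. u k * (\<Sum>l<N. A $$ (i, l) * \<phi> k l))" if "i < N" for i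
  proof -
    have "(A *\<^sub>v w) $ i = (\<Sum>l<N. A $$ (i, l) * w $ l)"
      using mult_mat_vec_sum[of i A w] that A w by auto
    also have "\<dots> = (\<Sum>l<N. \<Sum>k<N. u k * (A $$ (i, l) * \<phi> k l))"
      by (simp add: u sum_distrib_left mult_ac)
    finally show ?thesis by (subst (asm) sum.swap) (simp add: sum_distrib_left)
  qed
  then have "(A *\<^sub>v w) \<bullet>c w =
      (\<Sum>i<N. (\<Sum>k<N. u k * (\<Sum>l<N. A $$ (i, l) * \<phi> k l)) * (\<Sum>j<N. cnj (u j) * cnj (\<phi> j i)))"
    unfolding cscalar_prod_sum using w by (intro sum.cong) (auto simp: u simp del: index_mult_mat_vec)
  also have "\<dots> = (\<Sum>i<N. \<Sum>j<N. \<Sum>k<N. u k * cnj (u j) * ((\<Sum>l<N. A $$ (i, l) * \<phi> k l) * cnj (\<phi> j i)))"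
    by (subst mult.commute, unfold sum_product) (intro sum.cong refl, simp only: mult_ac)
  also have "\<dots> = (\<Sum>j<N. \<Sum>k<N. \<Sum>i<N. u k * cnj (u j) * ((\<Sum>l<N. A $$ (i, l) * \<phi> k l) * cnj (\<phi> j i)))"
    by (subst sum.swap) (intro sum.cong refl sum.swap)
  also have "\<dots> = (\<Sum>j<N. \<Sum>k<N. u k * cnj (u j) * matrix_element A j k)"
    by (simp only: matrix_element_def sum_distrib_left[symmetric])
  finally show ?thesis .
qed

end

context spectral_resolution
begin

lemma power_entry:
  assumes "i < N" "k < N"
  shows "((z \<cdot>\<^sub>m H) ^\<^sub>m m) $$ (i, k) = (\<Sum>j<N. (z * of_real (E j)) ^ m * \<phi> j i * cnj (\<phi> j k))"
  using assms
proof (induction m arbitrary: i k)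
  case 0
  then show ?case using carrier by (auto simp: complete kdelta_def)
next
  case (Suc m)
  have c: "(z \<cdot>\<^sub>m H) ^\<^sub>m m \<in> carrier_mat N N" using carrier by (intro pow_carrier_mat) auto
  have "((z \<cdot>\<^sub>m H) ^\<^sub>m Suc m) $$ (i, k) =
      (\<Sum>l<N. ((z \<cdot>\<^sub>m H) ^\<^sub>m m) $$ (i, l) * (z \<cdot>\<^sub>m H) $$ (l, k))"
    using Suc.prems c carrier mult_mat_sum[of i "(z \<cdot>\<^sub>m H) ^\<^sub>m m" k "z \<cdot>\<^sub>m H"] by auto
  also have "\<dots> = (\<Sum>l<N. (\<Sum>j<N. (z * of_real (E j)) ^ m * \<phi> j i * cnj (\<phi> j l)) *
      (\<Sum>j<N. (z * of_real (E j)) * \<phi> j l * cnj (\<phi> j k)))"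
  proof (intro sum.cong refl arg_cong2[where f = "(*)"])
    fix l assume l: "l \<in> {..<N}"
    then show "((z \<cdot>\<^sub>m H) ^\<^sub>m m) $$ (i, l) = (\<Sum>j<N. (z * of_real (E j)) ^ m * \<phi> j i * cnj (\<phi> j l))"
      using Suc by simp
    show "(z \<cdot>\<^sub>m H) $$ (l, k) = (\<Sum>j<N. (z * of_real (E j)) * \<phi> j l * cnj (\<phi> j k))"
      using l carrier Suc.prems by (simp add: entry sum_distrib_left mult_ac)
  qed
  also have "\<dots> = (\<Sum>j<N. (z * of_real (E j)) ^ Suc m * \<phi> j i * cnj (\<phi> j k))"
    using Suc.prems by (subst spectral_mult) (simp_all add: mult_ac)
  finally show ?case .
qed

lemma mat_exp_carrier [simp]: "mat_exp (z \<cdot>\<^sub>m H) \<in> carrier_mat N N"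
  using carrier by (auto simp: mat_exp_def)

lemma mat_exp_entry:
  assumes "i < N" "k < N"
  shows "mat_exp (z \<cdot>\<^sub>m H) $$ (i, k) = (\<Sum>j<N. exp (z * of_real (E j)) * \<phi> j i * cnj (\<phi> j k))"
proof -
  have "(\<lambda>m. x ^ m / fact m) sums exp x" for x :: complex
    using exp_converges[of x] by (simp add: scaleR_conv_of_real divide_inverse mult.commute)
  then have "(\<lambda>m. \<Sum>j<N. (z * of_real (E j)) ^ m / fact m * \<phi> j i * cnj (\<phi> j k)) sums
      (\<Sum>j<N. exp (z * of_real (E j)) * \<phi> j i * cnj (\<phi> j k))"
    by (intro sums_sum sums_mult2) auto
  moreover have "mat_exp (z \<cdot>\<^sub>m H) $$ (i, k) = (\<Sum>m. ((z \<cdot>\<^sub>m H) ^\<^sub>m m) $$ (i, k) / fact m)"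
    using assms carrier by (auto simp: mat_exp_def)
  ultimately show ?thesis
    using assms by (simp add: power_entry sum_divide_distrib sums_iff)
qed

lemma mat_exp_mult_vec:
  assumes "\<psi> \<in> carrier_vec N" "i < N"
  shows "(mat_exp (z \<cdot>\<^sub>m H) *\<^sub>v \<psi>) $ i = (\<Sum>j<N. (exp (z * of_real (E j)) * amplitude \<psi> j) * \<phi> j i)"
proof -
  have "(mat_exp (z \<cdot>\<^sub>m H) *\<^sub>v \<psi>) $ i = (\<Sum>k<N. mat_exp (z \<cdot>\<^sub>m H) $$ (i, k) * \<psi> $ k)"
    using assms mult_mat_vec_sum[of i "mat_exp (z \<cdot>\<^sub>m H)" \<psi>] mat_exp_carrier[of z]
    by (auto simp del: index_mult_mat_vec)
  also have "\<dots> = (\<Sum>k<N. \<Sum>j<N. exp (z * of_real (E j)) * \<phi> j i * (\<psi> $ k * cnj (\<phi> j k)))"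
    using assms by (simp add: mat_exp_entry sum_distrib_right sum_distrib_left mult_ac)
  also have "\<dots> = (\<Sum>j<N. \<Sum>k<N. exp (z * of_real (E j)) * \<phi> j i * (\<psi> $ k * cnj (\<phi> j k)))"
    by (rule sum.swap)
  also have "\<dots> = (\<Sum>j<N. (exp (z * of_real (E j)) * amplitude \<psi> j) * \<phi> j i)"
    by (simp add: amplitude_def sum_distrib_left mult_ac)
  finally show ?thesis .
qed

lemma expect_heisenberg:
  assumes A: "A \<in> carrier_mat N N" and \<psi>: "\<psi> \<in> carrier_vec N"
  shows "expect \<psi> (heisenberg H A t) =
    trig_sum ({..<N} \<times> {..<N}) (\<lambda>(j, k). amplitude \<psi> k * cnj (amplitude \<psi> j) * matrix_element A j k)
      (\<lambda>(j, k). E j - E k) t"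
proof -
  let ?X = "mat_exp ((\<i> * complex_of_real t) \<cdot>\<^sub>m H)" and ?Y = "mat_exp ((- \<i> * complex_of_real t) \<cdot>\<^sub>m H)"
  \<comment> \<open>The evolution is moved from the observable to the state: \<open>?X\<close> is
    the adjoint of \<open>?Y\<close>, so the expectation becomes that of \<open>A\<close> in the
    evolved vector \<open>w\<close>.\<close>
  define w where "w = ?Y *\<^sub>v \<psi>"
  have w: "w \<in> carrier_vec N" unfolding w_def by (rule mult_mat_vec_carrier[OF mat_exp_carrier \<psi>])
  have "heisenberg H A t *\<^sub>v \<psi> = (?X * A) *\<^sub>v w"
    unfolding heisenberg_def w_def
    by (rule assoc_mult_mat_vec[of _ N N]) (rule mult_carrier_mat mat_exp_carrier A \<psi>)+
  also have "\<dots> = ?X *\<^sub>v (A *\<^sub>v w)"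
    by (rule assoc_mult_mat_vec[of _ N N]) (rule mat_exp_carrier A w)+
  finally have "expect \<psi> (heisenberg H A t) = (?X *\<^sub>v (A *\<^sub>v w)) \<bullet>c \<psi>"
    by (simp add: expect_def)
  also have "\<dots> = (A *\<^sub>v w) \<bullet>c w"
    unfolding w_def
  proof (rule cscalar_adjoint[of _ N])
    show "cnj (?Y $$ (k, i)) = ?X $$ (i, k)" if "i < N" "k < N" for i k
      using that by (simp add: mat_exp_entry exp_cnj mult_ac)
  qed (rule mult_mat_vec_carrier mat_exp_carrier A \<psi>)+
  also have "\<dots> = (\<Sum>j<N. \<Sum>k<N. (exp (- \<i> * of_real t * of_real (E k)) * amplitude \<psi> k) *
      cnj (exp (- \<i> * of_real t * of_real (E j)) * amplitude \<psi> j) * matrix_element A j k)"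
    by (rule cscalar_expansion[OF A w]) (simp add: w_def mat_exp_mult_vec[OF \<psi>] del: index_mult_mat_vec)
  also have "\<dots> = (\<Sum>j<N. \<Sum>k<N. amplitude \<psi> k * cnj (amplitude \<psi> j) * matrix_element A j k * cis ((E j - E k) * t))"
  proof (intro sum.cong refl)
    fix j k
    have "cis ((E j - E k) * t) = exp (- \<i> * of_real t * of_real (E k)) * cnj (exp (- \<i> * of_real t * of_real (E j)))"
      by (simp add: cis_conv_exp exp_cnj exp_add[symmetric] algebra_simps)
    then show "(exp (- \<i> * of_real t * of_real (E k)) * amplitude \<psi> k) *
      cnj (exp (- \<i> * of_real t * of_real (E j)) * amplitude \<psi> j) * matrix_element A j k =
      amplitude \<psi> k * cnj (amplitude \<psi> j) * matrix_element A j k * cis ((E j - E k) * t)"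
      by (simp only: complex_cnj_mult mult_ac)
  qed
  finally show ?thesis
    by (simp add: trig_sum_def sum.cartesian_product case_prod_unfold)
qed

lemma fluctuation_formula:
  assumes gap: "\<And>a b j k. a < N \<Longrightarrow> b < N \<Longrightarrow> j < N \<Longrightarrow> k < N \<Longrightarrow> a \<noteq> b \<Longrightarrow>
      E a - E b = E j - E k \<Longrightarrow> a = j \<and> b = k"
    and A: "A \<in> carrier_mat N N" and \<psi>: "\<psi> \<in> carrier_vec N"
  shows "fluctuation H A \<psi> = (\<Sum>j<N. \<Sum>k<N. of_bool (j \<noteq> k) *
    ((cmod (amplitude \<psi> j))\<^sup>2 * (cmod (amplitude \<psi> k))\<^sup>2 * (cmod (matrix_element A j k))\<^sup>2))"
proof -
  have inj: "j = k" if "j < N" "k < N" "E j = E k" for j k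
    using gap[of j k k j] that by auto
  have "fluctuation H A \<psi> = (\<Sum>p\<in>{p \<in> {..<N} \<times> {..<N}. (case p of (j, k) \<Rightarrow> E j - E k) \<noteq> 0}.
      (cmod (case p of (j, k) \<Rightarrow> amplitude \<psi> k * cnj (amplitude \<psi> j) * matrix_element A j k))\<^sup>2)"
    unfolding fluctuation_def equilibrium_value_def expect_heisenberg[OF A \<psi>]
  proof (rule trig_sum_fluctuation)
    fix p q assume pq: "p \<in> {..<N} \<times> {..<N}" "q \<in> {..<N} \<times> {..<N}"
      "(case p of (j, k) \<Rightarrow> E j - E k) = (case q of (j, k) \<Rightarrow> E j - E k)" "(case p of (j, k) \<Rightarrow> E j - E k) \<noteq> 0"
    obtain j k l m where "p = (j, k)" "q = (l, m)" by (cases p, cases q)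
    then show "p = q" using pq gap[of j k l m] by (cases "j = k") auto
  qed simp
  also have "\<dots> = (\<Sum>(j, k)\<in>{..<N} \<times> {..<N}. of_bool (j \<noteq> k) *
      ((cmod (amplitude \<psi> j))\<^sup>2 * (cmod (amplitude \<psi> k))\<^sup>2 * (cmod (matrix_element A j k))\<^sup>2))"
  proof (intro sum.mono_neutral_cong_left)
    show "\<forall>p\<in>{..<N} \<times> {..<N} - {p \<in> {..<N} \<times> {..<N}. (case p of (j, k) \<Rightarrow> E j - E k) \<noteq> 0}.
        (case p of (j, k) \<Rightarrow> of_bool (j \<noteq> k) * ((cmod (amplitude \<psi> j))\<^sup>2 *
          (cmod (amplitude \<psi> k))\<^sup>2 * (cmod (matrix_element A j k))\<^sup>2)) = 0"
      using inj by fastforce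
  qed (auto simp: norm_mult power_mult_distrib)
  finally show ?thesis by (simp only: sum.cartesian_product)
qed

end

section \<open>Operator norm and matrix elements of the observable\<close>

lemma vec_nrm_op_norm:
  assumes "A \<in> carrier_mat N N" "v \<in> carrier_vec N" "vec_nrm v = 1"
  shows "vec_nrm (A *\<^sub>v v) \<le> op_norm A"
  unfolding op_norm_def
proof (rule cSUP_upper)
  show "v \<in> {v \<in> carrier_vec (dim_col A). vec_nrm v = 1}" using assms by auto
  \<comment> \<open>A real supremum dominates its members only if the set is bounded. The components
    of a unit vector have modulus at most 1, so row sums of moduli give a sufficient crude
    bound.\<close>
  show "bdd_above ((\<lambda>v. vec_nrm (A *\<^sub>v v)) ` {v \<in> carrier_vec (dim_col A). vec_nrm v = 1})"
  proof (rule bdd_aboveI2)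
    fix w assume "w \<in> {v \<in> carrier_vec (dim_col A). vec_nrm v = 1}"
    then have w: "dim_vec w = N" "vec_nrm w = 1" using assms(1) by auto
    have w1: "cmod (w $ k) \<le> 1" if "k < N" for k
    proof -
      have "(cmod (w $ k))\<^sup>2 \<le> (\<Sum>i<N. (cmod (w $ i))\<^sup>2)"
        using that by (intro member_le_sum) auto
      then have "(cmod (w $ k))\<^sup>2 \<le> 1" using vec_nrm_square[of w] w by simp
      then show ?thesis by (simp add: power2_le_iff_abs_le abs_square_le_1)
    qed
    have "(vec_nrm (A *\<^sub>v w))\<^sup>2 \<le> (\<Sum>i<N. (\<Sum>k<N. cmod (A $$ (i, k)))\<^sup>2)"
      unfolding vec_nrm_square
    proof (rule order.trans[OF eq_refl sum_mono[OF power_mono]])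
      show "(\<Sum>i<dim_vec (A *\<^sub>v w). (cmod ((A *\<^sub>v w) $ i))\<^sup>2) = (\<Sum>i<N. (cmod ((A *\<^sub>v w) $ i))\<^sup>2)"
        using assms(1) by auto
      fix i assume "i \<in> {..<N}"
      then have "cmod ((A *\<^sub>v w) $ i) = cmod (\<Sum>k<N. A $$ (i, k) * w $ k)"
        using mult_mat_vec_sum[of i A w] assms(1) w by auto
      also have "\<dots> \<le> (\<Sum>k<N. cmod (A $$ (i, k)) * cmod (w $ k))"
        by (rule order.trans[OF norm_sum]) (simp add: norm_mult)
      also have "\<dots> \<le> (\<Sum>k<N. cmod (A $$ (i, k)))"
        using w1 by (intro sum_mono) (simp add: mult_left_le)
      finally show "cmod ((A *\<^sub>v w) $ i) \<le> (\<Sum>k<N. cmod (A $$ (i, k)))" .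
    qed simp
    then show "vec_nrm (A *\<^sub>v w) \<le> sqrt (\<Sum>i<N. (\<Sum>k<N. cmod (A $$ (i, k)))\<^sup>2)"
      by (rule real_le_rsqrt)
  qed
qed

context onb
begin

text \<open>By Parseval the sum is the squared norm of \<open>A\<close> applied to the unit vector
  \<open>\<phi> k\<close>.\<close>

lemma matrix_element_row_bound:
  assumes A: "A \<in> carrier_mat N N" and k: "k < N"
  shows "(\<Sum>j<N. (cmod (matrix_element A j k))\<^sup>2) \<le> (op_norm A)\<^sup>2"
proof -
  define v where "v = vec N (\<phi> k)"
  have v: "v \<in> carrier_vec N" by (simp add: v_def)
  have "complex_of_real ((vec_nrm v)\<^sup>2) = (\<Sum>i<N. \<phi> k i * cnj (\<phi> k i))"
    by (simp add: vec_nrm_square v_def complex_norm_square del: of_real_power)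
  then have "(vec_nrm v)\<^sup>2 = 1" using orth[OF k k] by (simp add: kdelta_def del: of_real_power)
  then have n1: "vec_nrm v = 1" by (simp add: vec_nrm_def cscalar_prod_self sum_nonneg)
  have Av: "(A *\<^sub>v v) $ i = (\<Sum>l<N. A $$ (i, l) * \<phi> k l)" if "i < N" for i
    using mult_mat_vec_sum[of i A v] that A by (auto simp: v_def)
  have "(\<Sum>j<N. (cmod (matrix_element A j k))\<^sup>2) = (\<Sum>i<N. (cmod (\<Sum>l<N. A $$ (i, l) * \<phi> k l))\<^sup>2)"
    unfolding matrix_element_def by (rule parseval)
  also have "\<dots> = (vec_nrm (A *\<^sub>v v))\<^sup>2"
    using A Av by (auto simp: vec_nrm_square simp del: index_mult_mat_vec)
  also have "\<dots> \<le> (op_norm A)\<^sup>2"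
    using vec_nrm_op_norm[OF A v n1] by (intro power_mono) (auto simp: vec_nrm_def cscalar_prod_self sum_nonneg)
  finally show ?thesis .
qed

lemma matrix_element_hermitian:
  assumes A: "hermitian_mat N A"
  shows "matrix_element A j k = cnj (matrix_element A k j)"
proof -
  have "matrix_element A j k = (\<Sum>i<N. \<Sum>l<N. A $$ (i, l) * \<phi> k l * cnj (\<phi> j i))"
    by (simp add: matrix_element_def sum_distrib_right)
  also have "\<dots> = (\<Sum>l<N. \<Sum>i<N. A $$ (i, l) * \<phi> k l * cnj (\<phi> j i))" by (rule sum.swap)
  also have "\<dots> = (\<Sum>l<N. \<Sum>i<N. cnj (A $$ (l, i) * \<phi> j i * cnj (\<phi> k l)))"
  proof (intro sum.cong refl)
    fix l i assume "l \<in> {..<N}" "i \<in> {..<N}"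
    then have "A $$ (i, l) = cnj (A $$ (l, i))" using hermitian_mat_index[OF A, of l i] by simp
    then show "A $$ (i, l) * \<phi> k l * cnj (\<phi> j i) = cnj (A $$ (l, i) * \<phi> j i * cnj (\<phi> k l))"
      by simp
  qed
  also have "\<dots> = cnj (matrix_element A k j)"
    by (simp add: matrix_element_def sum_distrib_right)
  finally show ?thesis .
qed

text \<open>The product of the two weights is replaced by the mean of their squares; by the
  symmetry of \<open>cmod (matrix_element A j k)\<close> both halves contribute equally.\<close>

lemma weighted_matrix_elements_bound:
  assumes A: "hermitian_mat N A"
  shows "(\<Sum>j<N. \<Sum>k<N. of_bool (j \<noteq> k) * ((p j)\<^sup>2 * (p k)\<^sup>2 * (cmod (matrix_element A j k))\<^sup>2))
    \<le> (op_norm A)\<^sup>2 * (\<Sum>k<N. (p k) ^ 4)"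
proof -
  have Ac: "A \<in> carrier_mat N N" using A by (simp add: hermitian_mat_def)
  let ?B = "\<lambda>j k. (cmod (matrix_element A j k))\<^sup>2"
  have sym: "?B j k = ?B k j" for j k
    using matrix_element_hermitian[OF A, of j k] by simp
  have "of_bool (j \<noteq> k) * ((p j)\<^sup>2 * (p k)\<^sup>2 * ?B j k) \<le> (p j ^ 4 * ?B k j + p k ^ 4 * ?B j k) / 2" for j k
  proof -
    have "(p j)\<^sup>2 * (p k)\<^sup>2 \<le> (p j ^ 4 + p k ^ 4) / 2"
      using sum_squares_bound[of "(p j)\<^sup>2" "(p k)\<^sup>2"] by (simp add: power_mult[symmetric])
    then have "(p j)\<^sup>2 * (p k)\<^sup>2 * ?B j k \<le> (p j ^ 4 + p k ^ 4) / 2 * ?B j k"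
      by (rule mult_right_mono) simp
    moreover have "of_bool (j \<noteq> k) * ((p j)\<^sup>2 * (p k)\<^sup>2 * ?B j k) \<le> (p j)\<^sup>2 * (p k)\<^sup>2 * ?B j k"
      by (auto simp: of_bool_def)
    ultimately show ?thesis using sym[of j k] by (simp add: algebra_simps add_divide_distrib)
  qed
  then have "(\<Sum>j<N. \<Sum>k<N. of_bool (j \<noteq> k) * ((p j)\<^sup>2 * (p k)\<^sup>2 * ?B j k))
      \<le> (\<Sum>j<N. \<Sum>k<N. (p j ^ 4 * ?B k j + p k ^ 4 * ?B j k) / 2)"
    by (intro sum_mono)
  also have "\<dots> = ((\<Sum>j<N. \<Sum>k<N. p j ^ 4 * ?B k j) + (\<Sum>j<N. \<Sum>k<N. p k ^ 4 * ?B j k)) / 2"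
    by (simp only: sum.distrib sum_divide_distrib[symmetric])
  also have "(\<Sum>j<N. \<Sum>k<N. p k ^ 4 * ?B j k) = (\<Sum>k<N. \<Sum>j<N. p k ^ 4 * ?B j k)"
    by (rule sum.swap)
  also have "((\<Sum>j<N. \<Sum>k<N. p j ^ 4 * ?B k j) + \<dots>) / 2 = (\<Sum>k<N. p k ^ 4 * (\<Sum>j<N. ?B j k))"
    by (simp only: sum_distrib_left) simp
  also have "\<dots> \<le> (\<Sum>k<N. p k ^ 4 * (op_norm A)\<^sup>2)"
    using matrix_element_row_bound[OF Ac] by (intro sum_mono mult_left_mono) auto
  also have "\<dots> = (op_norm A)\<^sup>2 * (\<Sum>k<N. p k ^ 4)"
    by (simp only: sum_distrib_left mult.commute)
  finally show ?thesis .
qed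

end

section \<open>Moments of the Haar measure\<close>

lemma unitary_groupD:
  assumes "U \<in> unitary_group N"
  shows "dim_row U = N" "dim_col U = N"
  using assms by (auto simp: unitary_group_def)

lemma unitary_group_columns:
  assumes U: "U \<in> unitary_group N" and "j < N" "k < N"
  shows "(\<Sum>i<N. U $$ (i, j) * cnj (U $$ (i, k))) = kdelta j k"
proof -
  have d: "dim_row U = N" "dim_col U = N" using unitary_groupD[OF U] by auto
  have "(mat_adjoint U * U) $$ (k, j) = (\<Sum>i<N. mat_adjoint U $$ (k, i) * U $$ (i, j))"
    using assms d mult_mat_sum[of k "mat_adjoint U" j U] by (simp del: index_mult_mat)
  also have "\<dots> = (\<Sum>i<N. U $$ (i, j) * cnj (U $$ (i, k)))"
    using assms d by (simp add: mat_adjoint_index mult.commute)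
  finally show ?thesis using assms by (auto simp: unitary_group_def kdelta_def)
qed

lemma unitary_group_entry_bound:
  assumes U: "U \<in> unitary_group N" and "i < N" "j < N"
  shows "cmod (U $$ (i, j)) \<le> 1"
proof -
  have "complex_of_real (\<Sum>i<N. (cmod (U $$ (i, j)))\<^sup>2) = 1"
    using unitary_group_columns[OF U, of j j] assms
    by (simp add: kdelta_def complex_norm_square del: of_real_power)
  then have "(\<Sum>i<N. (cmod (U $$ (i, j)))\<^sup>2) = 1" using of_real_eq_1_iff by blast
  moreover have "(cmod (U $$ (i, j)))\<^sup>2 \<le> (\<Sum>i<N. (cmod (U $$ (i, j)))\<^sup>2)"
    using assms by (intro member_le_sum) auto
  ultimately show ?thesis by (simp add: power2_le_iff_abs_le abs_square_le_1)
qed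

lemma unitary_groupI:
  assumes V: "V \<in> carrier_mat N N"
    and rows: "\<And>i k. i < N \<Longrightarrow> k < N \<Longrightarrow> (\<Sum>j<N. V $$ (i, j) * cnj (V $$ (k, j))) = kdelta i k"
  shows "V \<in> unitary_group N"
proof -
  have d: "dim_row V = N" "dim_col V = N" using V by auto
  have "V * mat_adjoint V = 1\<^sub>m N"
  proof (rule eq_matI)
    fix i k assume ik: "i < dim_row (1\<^sub>m N)" "k < dim_col (1\<^sub>m N)"
    have "(V * mat_adjoint V) $$ (i, k) = (\<Sum>j<N. V $$ (i, j) * mat_adjoint V $$ (j, k))"
      using ik d mult_mat_sum[of i V k "mat_adjoint V"] by (simp del: index_mult_mat)
    also have "\<dots> = (\<Sum>j<N. V $$ (i, j) * cnj (V $$ (k, j)))"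
      using ik d by (simp add: mat_adjoint_index)
    finally show "(V * mat_adjoint V) $$ (i, k) = 1\<^sub>m N $$ (i, k)"
      using ik rows by (simp add: kdelta_def)
  qed (use d in auto)
  moreover have "mat_adjoint V \<in> carrier_mat N N" using d by (intro carrier_matI) simp_all
  ultimately show ?thesis using V mat_mult_left_right_inverse by (auto simp: unitary_group_def)
qed

lemma unitary_group_mult:
  assumes "V \<in> unitary_group N" "U \<in> unitary_group N"
  shows "V * U \<in> unitary_group N"
proof (rule unitary_groupI)
  have d: "dim_row U = N" "dim_col U = N" "dim_row V = N" "dim_col V = N"
    using assms unitary_groupD by auto
  then show "V * U \<in> carrier_mat N N" by auto
  fix i k assume ik: "i < N" "k < N"
  have rows: "(\<Sum>j<N. W $$ (a, j) * cnj (W $$ (b, j))) = kdelta a b"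
    if "W \<in> unitary_group N" "a < N" "b < N" for W a b
  proof -
    have "dim_row W = N" "dim_col W = N" using that unitary_groupD by auto
    then have "(W * mat_adjoint W) $$ (a, b) = (\<Sum>j<N. W $$ (a, j) * cnj (W $$ (b, j)))"
      using that mult_mat_sum[of a W b "mat_adjoint W"] by (simp add: mat_adjoint_index del: index_mult_mat)
    then show ?thesis using that by (auto simp: unitary_group_def kdelta_def)
  qed
  have "(\<Sum>j<N. (V * U) $$ (i, j) * cnj ((V * U) $$ (k, j))) =
      (\<Sum>j<N. (\<Sum>a<N. V $$ (i, a) * U $$ (a, j)) * (\<Sum>b<N. cnj (V $$ (k, b) * U $$ (b, j))))"
    using ik d by (intro sum.cong refl) (simp add: mult_mat_sum del: index_mult_mat)
  also have "\<dots> = (\<Sum>j<N. \<Sum>a<N. \<Sum>b<N. V $$ (i, a) * cnj (V $$ (k, b)) * (U $$ (a, j) * cnj (U $$ (b, j))))"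
    by (simp add: sum_product mult_ac)
  also have "\<dots> = (\<Sum>a<N. \<Sum>b<N. \<Sum>j<N. V $$ (i, a) * cnj (V $$ (k, b)) * (U $$ (a, j) * cnj (U $$ (b, j))))"
    by (subst sum.swap) (intro sum.cong refl sum.swap)
  also have "\<dots> = (\<Sum>a<N. \<Sum>b<N. V $$ (i, a) * cnj (V $$ (k, b)) * kdelta a b)"
    by (intro sum.cong refl) (simp add: sum_distrib_left[symmetric] rows[OF assms(2)])
  also have "\<dots> = (\<Sum>a<N. V $$ (i, a) * cnj (V $$ (k, a)))"
    by (simp add: kdelta_def of_bool_def if_distrib cong: if_cong)
  also have "\<dots> = kdelta i k" by (rule rows[OF assms(1) ik])
  finally show "(\<Sum>j<N. (V * U) $$ (i, j) * cnj ((V * U) $$ (k, j))) = kdelta i k" .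
qed

lemma integral_double_sum:
  fixes f :: "'i \<Rightarrow> 'j \<Rightarrow> 'a \<Rightarrow> complex"
  assumes "\<And>i k. i \<in> I \<Longrightarrow> k \<in> K \<Longrightarrow> integrable M (f i k)"
  shows "(LINT x|M. (\<Sum>i\<in>I. \<Sum>k\<in>K. f i k x)) = (\<Sum>i\<in>I. \<Sum>k\<in>K. LINT x|M. f i k x)"
  using assms by (simp add: Bochner_Integration.integral_sum)

section \<open>Haar averages of products of matrix entries\<close>

locale haar =
  fixes N :: nat and \<mu> :: "complex mat measure"
  assumes haar: "is_haar N \<mu>"

sublocale haar \<subseteq> prob_space \<mu>
  using haar by (simp add: is_haar_def)

context haar
begin

lemma space_haar: "space \<mu> = unitary_group N"
  using haar sets_eq_imp_space_eq[of \<mu> "unitary_borel N"] by (simp add: is_haar_def unitary_borel_def)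

lemma entry_measurable [measurable]:
  assumes "i < N" "j < N"
  shows "(\<lambda>U. U $$ (i, j)) \<in> borel_measurable \<mu>"
proof -
  let ?P = "(\<Pi>\<^sub>M ij \<in> {..<N} \<times> {..<N}. borel) :: (nat \<times> nat \<Rightarrow> complex) measure"
  let ?r = "\<lambda>U. \<lambda>ij \<in> {..<N} \<times> {..<N}. U $$ ij"
  have "?r \<in> measurable (unitary_borel N) ?P"
    unfolding unitary_borel_def by (rule measurable_vimage_algebra1) (auto simp: space_PiM)
  then have "(\<lambda>U. ?r U (i, j)) \<in> borel_measurable (unitary_borel N)"
    by (rule measurable_component_singleton'[OF _ _ ]) (use assms in auto)
  then have "(\<lambda>U. U $$ (i, j)) \<in> borel_measurable (unitary_borel N)" using assms by simp
  moreover have "borel_measurable \<mu> = (borel_measurable (unitary_borel N) :: (complex mat \<Rightarrow> complex) set)"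
    using haar by (intro measurable_cong_sets) (simp_all add: is_haar_def)
  ultimately show ?thesis by simp
qed

lemma left_mult_measurable:
  assumes V: "V \<in> unitary_group N"
  shows "(\<lambda>U. V * U) \<in> measurable \<mu> \<mu>"
proof -
  have "(\<lambda>U. V * U) \<in> measurable \<mu> (unitary_borel N)"
    unfolding unitary_borel_def
  proof (rule measurable_vimage_algebra2)
    show "(\<lambda>U. V * U) \<in> space \<mu> \<rightarrow> unitary_group N"
      using unitary_group_mult[OF V] by (simp add: space_haar)
    show "(\<lambda>U. \<lambda>ij\<in>{..<N} \<times> {..<N}. (V * U) $$ ij) \<in> measurable \<mu> (\<Pi>\<^sub>M ij\<in>{..<N} \<times> {..<N}. borel)"
    proof (rule measurable_restrict)
      fix ij :: "nat \<times> nat" assume ij: "ij \<in> {..<N} \<times> {..<N}"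
      have "(\<lambda>U. \<Sum>a<N. V $$ (fst ij, a) * U $$ (a, snd ij)) \<in> borel_measurable \<mu>"
        using ij by (intro borel_measurable_sum borel_measurable_times borel_measurable_const entry_measurable) auto
      moreover have "(V * U) $$ ij = (\<Sum>a<N. V $$ (fst ij, a) * U $$ (a, snd ij))" if "U \<in> space \<mu>" for U
        using that ij unitary_groupD[OF V] unitary_groupD[of U N] mult_mat_sum[of "fst ij" V "snd ij" U]
        by (auto simp: space_haar)
      ultimately show "(\<lambda>U. (V * U) $$ ij) \<in> borel_measurable \<mu>"
        by (simp cong: measurable_cong)
    qed
  qed
  then show ?thesis using haar measurable_cong_sets[of \<mu> \<mu> \<mu> "unitary_borel N"] by (simp add: is_haar_def)
qed

lemma integral_left_mult:
  fixes f :: "complex mat \<Rightarrow> complex"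
  assumes V: "V \<in> unitary_group N" and f: "f \<in> borel_measurable \<mu>"
  shows "(LINT U|\<mu>. f (V * U)) = (LINT U|\<mu>. f U)"
proof -
  have "distr \<mu> \<mu> (\<lambda>U. V * U) = \<mu>" using haar V by (simp add: is_haar_def)
  then show ?thesis using integral_distr[OF left_mult_measurable[OF V] f] by simp
qed

definition moment :: "nat \<times> nat \<Rightarrow> nat \<times> nat \<Rightarrow> nat \<times> nat \<Rightarrow> nat \<times> nat \<Rightarrow> complex" where
  "moment x y x' y' = (LINT U|\<mu>. U $$ x * (U $$ y * (cnj (U $$ x') * cnj (U $$ y'))))"

lemma cnj_measurable [measurable]: "cnj \<in> borel_measurable borel"
  by (intro borel_measurable_continuous_onI continuous_intros)

lemma monomial_measurable [measurable]:
  assumes "x \<in> {..<N} \<times> {..<N}" "y \<in> {..<N} \<times> {..<N}" "x' \<in> {..<N} \<times> {..<N}" "y' \<in> {..<N} \<times> {..<N}"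
  shows "(\<lambda>U. U $$ x * (U $$ y * (cnj (U $$ x') * cnj (U $$ y')))) \<in> borel_measurable \<mu>"
proof -
  have [measurable]: "(\<lambda>U. U $$ z) \<in> borel_measurable \<mu>" if "z \<in> {..<N} \<times> {..<N}" for z
    using entry_measurable[of "fst z" "snd z"] that by auto
  show ?thesis using assms by measurable
qed

lemma monomial_bound:
  assumes "U \<in> space \<mu>"
    "x \<in> {..<N} \<times> {..<N}" "y \<in> {..<N} \<times> {..<N}" "x' \<in> {..<N} \<times> {..<N}" "y' \<in> {..<N} \<times> {..<N}"
  shows "cmod (U $$ x * (U $$ y * (cnj (U $$ x') * cnj (U $$ y')))) \<le> 1"
proof -
  have "cmod (U $$ z) \<le> 1" if "z \<in> {..<N} \<times> {..<N}" for z
    using unitary_group_entry_bound[of U N "fst z" "snd z"] that assms(1) by (auto simp: space_haar)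
  then show ?thesis using assms by (simp add: norm_mult mult_le_one)
qed

lemma monomial_integrable:
  assumes "x \<in> {..<N} \<times> {..<N}" "y \<in> {..<N} \<times> {..<N}" "x' \<in> {..<N} \<times> {..<N}" "y' \<in> {..<N} \<times> {..<N}"
  shows "integrable \<mu> (\<lambda>U. U $$ x * (U $$ y * (cnj (U $$ x') * cnj (U $$ y'))))"
  using assms monomial_bound monomial_measurable
  by (intro integrable_const_bound[where B = 1]) auto

lemma moment_invariant:
  assumes V: "V \<in> unitary_group N" and r: "i < N" "k < N" "i' < N" "k' < N"
    and c: "j1 < N" "j2 < N" "l1 < N" "l2 < N"
  shows "moment (i, j1) (k, j2) (i', l1) (k', l2) =
    (\<Sum>a<N. V $$ (i, a) * (\<Sum>b<N. V $$ (k, b) * (\<Sum>a'<N. cnj (V $$ (i', a')) *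
      (\<Sum>b'<N. cnj (V $$ (k', b')) * moment (a, j1) (b, j2) (a', l1) (b', l2)))))"
proof -
  \<comment> \<open>Turning the product of four sums into nested sums lets the integral pass through
    one summation at a time, using \<open>lin\<close> below.\<close>
  have pull: "(\<Sum>a<N. v a * (p a * z)) = (\<Sum>a<N. v a * p a) * z"
    "(\<Sum>a<N. v a * (w * p a)) = w * (\<Sum>a<N. v a * p a)" for v p :: "nat \<Rightarrow> complex" and w z
    by (simp_all add: sum_distrib_left sum_distrib_right mult_ac)
  have d: "dim_row V = N" "dim_col V = N" using unitary_groupD[OF V] by auto
  have e: "(V * U) $$ (x, y) = (\<Sum>a<N. V $$ (x, a) * U $$ (a, y))"
    if "U \<in> space \<mu>" "x < N" "y < N" for U x y
    using that d unitary_groupD[of U N] mult_mat_sum[of x V y U] by (auto simp: space_haar)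
  have "moment (i, j1) (k, j2) (i', l1) (k', l2) =
      (LINT U|\<mu>. (V * U) $$ (i, j1) * ((V * U) $$ (k, j2) *
        (cnj ((V * U) $$ (i', l1)) * cnj ((V * U) $$ (k', l2)))))"
    unfolding moment_def using r c by (intro integral_left_mult[OF V, symmetric] monomial_measurable) auto
  also have "\<dots> = (LINT U|\<mu>. (\<Sum>a<N. V $$ (i, a) * (\<Sum>b<N. V $$ (k, b) * (\<Sum>a'<N. cnj (V $$ (i', a')) *
      (\<Sum>b'<N. cnj (V $$ (k', b')) * (U $$ (a, j1) * (U $$ (b, j2) * (cnj (U $$ (a', l1)) * cnj (U $$ (b', l2))))))))))"
    unfolding pull using r c by (intro Bochner_Integration.integral_cong refl) (simp add: e del: index_mult_mat)
  also have "\<dots> = (\<Sum>a<N. V $$ (i, a) * (\<Sum>b<N. V $$ (k, b) * (\<Sum>a'<N. cnj (V $$ (i', a')) *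
      (\<Sum>b'<N. cnj (V $$ (k', b')) * moment (a, j1) (b, j2) (a', l1) (b', l2)))))"
  proof -
    have i0: "integrable \<mu> (\<lambda>U. U $$ (a, j1) * (U $$ (b, j2) * (cnj (U $$ (a', l1)) * cnj (U $$ (b', l2)))))"
      if "a \<in> {..<N}" "b \<in> {..<N}" "a' \<in> {..<N}" "b' \<in> {..<N}" for a b a' b'
      using that c by (intro monomial_integrable) auto
    have lin: "integrable \<mu> (\<lambda>U. \<Sum>a<N. v a * F a U)"
        "(LINT U|\<mu>. (\<Sum>a<N. v a * F a U)) = (\<Sum>a<N. v a * (LINT U|\<mu>. F a U))"
      if "\<And>a. a \<in> {..<N} \<Longrightarrow> integrable \<mu> (\<lambda>U. F a U)" for v and F :: "nat \<Rightarrow> complex mat \<Rightarrow> complex"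
      using that by (auto simp: Bochner_Integration.integral_sum)
    show ?thesis
      unfolding moment_def by (simp only: lin i0 cong: sum.cong)
  qed
  finally show ?thesis .
qed

text \<open>A monomial unitary has one nonzero entry in each row, so the fourfold sum of
  \<open>moment_invariant\<close> collapses to one term. Pure phases will give the support of the
  moments, pure permutations their independence of the labels.\<close>

lemma moment_monomial_unitary:
  assumes \<pi>: "bij_betw \<pi> {..<N} {..<N}" and z: "\<And>i. i < N \<Longrightarrow> cmod (z i) = 1"
    and r: "i < N" "k < N" "i' < N" "k' < N"
    and c: "j1 < N" "j2 < N" "l1 < N" "l2 < N"
  shows "moment (i, j1) (k, j2) (i', l1) (k', l2) =
    z i * z k * cnj (z i') * cnj (z k') * moment (\<pi> i, j1) (\<pi> k, j2) (\<pi> i', l1) (\<pi> k', l2)"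
proof -
  have p: "\<pi> x < N" if "x < N" for x using bij_betwE[OF \<pi>] that by auto
  define V where "V = mat N N (\<lambda>(x, y). z x * kdelta (\<pi> x) y)"
  have V: "(\<Sum>a<N. V $$ (x, a) * f a) = z x * f (\<pi> x)"
    "(\<Sum>a<N. cnj (V $$ (x, a)) * f a) = cnj (z x) * f (\<pi> x)" if "x < N" for x f
    using that p[OF that] by (simp_all add: V_def mult.assoc sum_kdelta sum_distrib_left[symmetric])
  have "V \<in> unitary_group N"
  proof (rule unitary_groupI)
    fix x y assume xy: "x < N" "y < N"
    have "(\<Sum>j<N. V $$ (x, j) * cnj (V $$ (y, j))) = z x * (cnj (z y) * kdelta (\<pi> y) (\<pi> x))"
      using V(1)[OF xy(1)] xy p by (simp add: V_def kdelta_def)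
    also have "\<dots> = kdelta x y"
      using xy bij_betw_imp_inj_on[OF \<pi>] z[OF xy(1)] complex_norm_square[of "z x"]
      by (auto simp: kdelta_def inj_on_def)
    finally show "(\<Sum>j<N. V $$ (x, j) * cnj (V $$ (y, j))) = kdelta x y" .
  qed (simp add: V_def)
  from moment_invariant[OF this r c] show ?thesis
    by (simp only: V r mult.assoc)
qed

text \<open>The phase \<open>\<i>\<close> on coordinate \<open>a\<close> multiplies the moment by
  \<open>\<i>\<close> to the power of the occurrences of \<open>a\<close> among \<open>i, k\<close>
  minus those among \<open>i', k'\<close>. This exponent lies between -2 and 2, so a fourth root of
  unity detects whether it is 0, whereas a sign would miss 2. Testing \<open>a = i\<close> and
  \<open>a = k\<close> is enough to force equal multisets.\<close>

lemma moment_support: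
  assumes r: "i < N" "k < N" "i' < N" "k' < N"
    and c: "j1 < N" "j2 < N" "l1 < N" "l2 < N"
    and ne: "\<not> (i = i' \<and> k = k')" "\<not> (i = k' \<and> k = i')"
  shows "moment (i, j1) (k, j2) (i', l1) (k', l2) = 0"
proof -
  define m where "m = moment (i, j1) (k, j2) (i', l1) (k', l2)"
  have "m = (if i = a then \<i> else 1) * (if k = a then \<i> else 1) * (if i' = a then - \<i> else 1) *
      (if k' = a then - \<i> else 1) * m" for a
    using moment_monomial_unitary[of id "\<lambda>x. if x = a then \<i> else 1", OF _ _ r c]
    by (simp add: m_def if_distrib[of cnj] cong: if_cong)
  from this[of i] this[of k] have "m = 0"
    using ne by (auto simp: complex_eq_iff split: if_splits)
  then show ?thesis by (simp add: m_def)
qed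

lemma moment_relabel:
  assumes \<pi>: "bij_betw \<pi> {..<N} {..<N}"
    and r: "i < N" "k < N" "i' < N" "k' < N"
    and c: "j1 < N" "j2 < N" "l1 < N" "l2 < N"
  shows "moment (\<pi> i, j1) (\<pi> k, j2) (\<pi> i', l1) (\<pi> k', l2) = moment (i, j1) (k, j2) (i', l1) (k', l2)"
  using moment_monomial_unitary[OF \<pi> _ r c, of "\<lambda>_. 1"] by simp

text \<open>Invariance under the rotation by 45 degrees in the plane of the first two coordinates.\<close>

lemma moment_rotation:
  assumes N: "2 \<le> N" and c: "j1 < N" "j2 < N" "l1 < N" "l2 < N"
  shows "4 * moment (0, j1) (0, j2) (0, l1) (0, l2) =
    (\<Sum>a<2. \<Sum>b<2. \<Sum>a'<2. \<Sum>b'<2. moment (a, j1) (b, j2) (a', l1) (b', l2))"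
proof -
  define h :: complex where "h = of_real (1 / sqrt 2)"
  have h: "h * h = 1 / 2" "cnj h = h"
    by (simp_all add: h_def flip: of_real_mult)
  define V where "V = mat N N (\<lambda>(x, y). if x < 2 \<and> y < 2 then (if x = 1 \<and> y = 1 then - h else h) else kdelta x y)"
  have split: "{..<N} = {0, 1} \<union> {2..<N}" using N by auto
  have s: "(\<Sum>j<N. f j) = f 0 + f 1 + (\<Sum>j\<in>{2..<N}. f j)" for f :: "nat \<Rightarrow> complex"
    unfolding split by (subst sum.union_disjoint) auto
  have "V \<in> unitary_group N"
  proof (rule unitary_groupI)
    fix x y assume xy: "x < N" "y < N"
    have x: "x = 0 \<or> x = 1 \<or> 2 \<le> x" and y: "y = 0 \<or> y = 1 \<or> 2 \<le> y" by auto
    have e: "V $$ (a, b) = (if a < 2 \<and> b < 2 then (if a = 1 \<and> b = 1 then - h else h) else kdelta a b)"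
      if "a < N" "b < N" for a b using that by (simp add: V_def)
    have "(\<Sum>j\<in>{2..<N}. V $$ (x, j) * cnj (V $$ (y, j))) = (\<Sum>j\<in>{2..<N}. if j = x then kdelta x y else 0)"
      using xy by (intro sum.cong refl) (auto simp: e kdelta_def)
    also have "\<dots> = (if 2 \<le> x then kdelta x y else 0)" using xy by simp
    finally show "(\<Sum>j<N. V $$ (x, j) * cnj (V $$ (y, j))) = kdelta x y"
      unfolding s using x y xy N by (auto simp: e h kdelta_def)
  qed (simp add: V_def)
  have V0: "(\<Sum>a<N. V $$ (0, a) * f a) = h * (\<Sum>a<2. f a)" "(\<Sum>a<N. cnj (V $$ (0, a)) * f a) = h * (\<Sum>a<2. f a)" for f
  proof -
    have "(\<Sum>a<N. (if a < 2 then h else 0) * f a) = (\<Sum>a<2. h * f a)"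
      using N by (intro sum.mono_neutral_cong_right) auto
    moreover have "V $$ (0, a) = (if a < 2 then h else 0)" if "a < N" for a
      using that N by (auto simp: V_def kdelta_def)
    ultimately show "(\<Sum>a<N. V $$ (0, a) * f a) = h * (\<Sum>a<2. f a)" "(\<Sum>a<N. cnj (V $$ (0, a)) * f a) = h * (\<Sum>a<2. f a)"
      by (simp_all add: sum_distrib_left h if_distrib[of cnj] cong: if_cong)
  qed
  have "moment (0, j1) (0, j2) (0, l1) (0, l2) =
      (h * h) * (h * h) * (\<Sum>a<2. \<Sum>b<2. \<Sum>a'<2. \<Sum>b'<2. moment (a, j1) (b, j2) (a', l1) (b', l2))"
    using moment_invariant[OF \<open>V \<in> unitary_group N\<close>, of 0 0 0 0, OF _ _ _ _ c] N
    by (simp only: V0) (simp add: sum_distrib_left mult_ac)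
  then show ?thesis by (simp add: h field_simps)
qed

text \<open>Summing over matched row indices contracts columns of \<open>U\<close>, which are
  orthonormal for every unitary, so the integrand is constant.\<close>

lemma moment_trace:
  assumes c: "j1 < N" "j2 < N" "l1 < N" "l2 < N"
  shows "(\<Sum>i<N. \<Sum>k<N. moment (i, j1) (k, j2) (i, l1) (k, l2)) = kdelta j1 l1 * kdelta j2 l2"
    "(\<Sum>i<N. \<Sum>k<N. moment (i, j1) (k, j2) (k, l1) (i, l2)) = kdelta j1 l2 * kdelta j2 l1"
proof -
  have i: "integrable \<mu> (\<lambda>U. U $$ (i, j1) * (U $$ (k, j2) * (cnj (U $$ (i', l1)) * cnj (U $$ (k', l2)))))"
    if "i < N" "k < N" "i' < N" "k' < N" for i k i' k'
    using that c by (intro monomial_integrable) auto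
  have "(\<Sum>i<N. \<Sum>k<N. moment (i, j1) (k, j2) (i, l1) (k, l2)) =
      (LINT U|\<mu>. (\<Sum>i<N. \<Sum>k<N. U $$ (i, j1) * (U $$ (k, j2) * (cnj (U $$ (i, l1)) * cnj (U $$ (k, l2))))))"
    unfolding moment_def by (rule integral_double_sum[symmetric]) (use i in auto)
  also have "\<dots> = (LINT U|\<mu>. kdelta j1 l1 * kdelta j2 l2)"
  proof (rule Bochner_Integration.integral_cong[OF refl])
    fix U assume "U \<in> space \<mu>"
    then have U: "U \<in> unitary_group N" by (simp add: space_haar)
    have "(\<Sum>i<N. \<Sum>k<N. U $$ (i, j1) * (U $$ (k, j2) * (cnj (U $$ (i, l1)) * cnj (U $$ (k, l2))))) =
        (\<Sum>i<N. U $$ (i, j1) * cnj (U $$ (i, l1))) * (\<Sum>k<N. U $$ (k, j2) * cnj (U $$ (k, l2)))"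
      unfolding sum_product by (intro sum.cong refl) (simp add: mult_ac)
    then show "(\<Sum>i<N. \<Sum>k<N. U $$ (i, j1) * (U $$ (k, j2) * (cnj (U $$ (i, l1)) * cnj (U $$ (k, l2))))) =
        kdelta j1 l1 * kdelta j2 l2"
      using c by (simp add: unitary_group_columns[OF U])
  qed
  finally show "(\<Sum>i<N. \<Sum>k<N. moment (i, j1) (k, j2) (i, l1) (k, l2)) = kdelta j1 l1 * kdelta j2 l2"
    by (simp add: prob_space)
  have "(\<Sum>i<N. \<Sum>k<N. moment (i, j1) (k, j2) (k, l1) (i, l2)) =
      (LINT U|\<mu>. (\<Sum>i<N. \<Sum>k<N. U $$ (i, j1) * (U $$ (k, j2) * (cnj (U $$ (k, l1)) * cnj (U $$ (i, l2))))))"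
    unfolding moment_def by (rule integral_double_sum[symmetric]) (use i in auto)
  also have "\<dots> = (LINT U|\<mu>. kdelta j1 l2 * kdelta j2 l1)"
  proof (rule Bochner_Integration.integral_cong[OF refl])
    fix U assume "U \<in> space \<mu>"
    then have U: "U \<in> unitary_group N" by (simp add: space_haar)
    have "(\<Sum>i<N. \<Sum>k<N. U $$ (i, j1) * (U $$ (k, j2) * (cnj (U $$ (k, l1)) * cnj (U $$ (i, l2))))) =
        (\<Sum>i<N. U $$ (i, j1) * cnj (U $$ (i, l2))) * (\<Sum>k<N. U $$ (k, j2) * cnj (U $$ (k, l1)))"
      unfolding sum_product by (intro sum.cong refl) (simp add: mult_ac)
    then show "(\<Sum>i<N. \<Sum>k<N. U $$ (i, j1) * (U $$ (k, j2) * (cnj (U $$ (k, l1)) * cnj (U $$ (i, l2))))) =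
        kdelta j1 l2 * kdelta j2 l1"
      using c by (simp add: unitary_group_columns[OF U])
  qed
  finally show "(\<Sum>i<N. \<Sum>k<N. moment (i, j1) (k, j2) (k, l1) (i, l2)) = kdelta j1 l2 * kdelta j2 l1"
    by (simp add: prob_space)
qed

text \<open>For fixed columns the moments form a tensor commuting with all \<open>V \<otimes> V\<close>; it is therefore a
  combination of the identity and the swap, and the two coefficients are read off from the two
  traces in \<open>moment_trace\<close>.\<close>

theorem second_moment:
  assumes N: "2 \<le> N" and r: "i < N" "k < N" "i' < N" "k' < N"
    and c: "j1 < N" "j2 < N" "l1 < N" "l2 < N"
  defines "A \<equiv> kdelta j1 l1 * kdelta j2 l2" and "B \<equiv> kdelta j1 l2 * kdelta j2 l1"
  shows "moment (i, j1) (k, j2) (i', l1) (k', l2) =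
    ((A - B / of_nat N) * (kdelta i i' * kdelta k k') + (B - A / of_nat N) * (kdelta i k' * kdelta k i')) /
      ((of_nat N)\<^sup>2 - 1)"
proof -
  define m where "m i k i' k' = moment (i, j1) (k, j2) (i', l1) (k', l2)" for i k i' k'
  define a b where "a = m 0 1 0 1" and "b = m 0 1 1 0"
  have rel: "m (\<pi> x) (\<pi> y) (\<pi> x') (\<pi> y') = m x y x' y'"
    if "bij_betw \<pi> {..<N} {..<N}" "x < N" "y < N" "x' < N" "y' < N" for \<pi> x y x' y'
    unfolding m_def by (rule moment_relabel[OF that c])
  have off: "m x y x y = a \<and> m x y y x = b" if "x < N" "y < N" "x \<noteq> y" for x y
  proof -
    \<comment> \<open>\<open>y0\<close> is the preimage of \<open>y\<close> under the exchange of 0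
      and \<open>x\<close>; this makes \<open>\<pi>\<close> a permutation taking 0 to
      \<open>x\<close> and 1 to \<open>y\<close>.\<close>
    define y0 where "y0 = Transposition.transpose 0 x y"
    define \<pi> where "\<pi> = Transposition.transpose 0 x \<circ> Transposition.transpose 1 y0"
    have y0: "y0 < N" "y0 \<noteq> 0" using that N by (auto simp: y0_def Transposition.transpose_def)
    have tr: "bij_betw (Transposition.transpose u v) {..<N} {..<N}" if "u < N" "v < N" for u v
      using that by (auto simp: bij_betw_transpose_iff)
    have "bij_betw \<pi> {..<N} {..<N}"
      unfolding \<pi>_def using that y0 N by (intro bij_betw_trans[of _ _ "{..<N}"] tr) auto
    moreover have "\<pi> 0 = x" "\<pi> 1 = y" using y0 by (auto simp: \<pi>_def y0_def)
    ultimately show ?thesis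
      using rel[of \<pi> 0 1 0 1] rel[of \<pi> 0 1 1 0] N by (simp add: a_def b_def)
  qed
  have zero: "m x y x' y' = 0" if "x < N" "y < N" "x' < N" "y' < N"
    "\<not> (x = x' \<and> y = y')" "\<not> (x = y' \<and> y = x')" for x y x' y'
    unfolding m_def by (rule moment_support[OF that(1-4) c that(5,6)])
  \<comment> \<open>Monomial matrices cannot relate the moments with four equal rows to
    \<open>a\<close> and \<open>b\<close>; the rotation does. Of its sixteen terms six survive, so
    four times the moment is twice the moment plus \<open>2 a + 2 b\<close>.\<close>
  have diag0: "m 0 0 0 0 = a + b"
  proof -
    have *: "4 * m 0 0 0 0 = (\<Sum>a<2. \<Sum>b<2. \<Sum>a'<2. \<Sum>b'<2. m a b a' b')"
      unfolding m_def by (rule moment_rotation[OF N c])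
    have "bij_betw (Transposition.transpose 0 1) {..<N} {..<N}" using N by (auto simp: bij_betw_transpose_iff)
    from rel[OF this, of 0 0 0 0] have "m 1 1 1 1 = m 0 0 0 0" using N by simp
    then have "2 * m 0 0 0 0 = 2 * (a + b)" using * N off[of 0 1] off[of 1 0]
      by (simp add: numeral_2_eq_2 zero)
    then show ?thesis by (simp only: mult_cancel_left) simp
  qed
  have diag: "m x x x x = a + b" if "x < N" for x
  proof -
    have "bij_betw (Transposition.transpose 0 x) {..<N} {..<N}" using N that by (auto simp: bij_betw_transpose_iff)
    from rel[OF this, of 0 0 0 0] show ?thesis using N diag0 by simp
  qed
  have form: "m x y x' y' = a * (kdelta x x' * kdelta y y') + b * (kdelta x y' * kdelta y x')"
    if "x < N" "y < N" "x' < N" "y' < N" for x y x' y'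
    using that off[of x y] zero[of x y x' y'] diag[of x] by (auto simp: kdelta_def)
  have "A = (\<Sum>x<N. \<Sum>y<N. m x y x y)" "B = (\<Sum>x<N. \<Sum>y<N. m x y y x)"
    using moment_trace[OF c] by (simp_all add: m_def A_def B_def)
  then have AB: "A = a * (of_nat N)\<^sup>2 + b * of_nat N" "B = a * of_nat N + b * (of_nat N)\<^sup>2"
    by (simp_all add: form sum.distrib sum_kdelta sum_distrib_left[symmetric] power2_eq_square)
      (simp_all add: algebra_simps)
  have "N\<^sup>2 \<noteq> 1" using N by (simp add: power2_eq_1_iff)
  then have n1: "(of_nat N)\<^sup>2 - 1 \<noteq> (0 :: complex)" by (metis eq_iff_diff_eq_0 of_nat_1 of_nat_eq_iff of_nat_power)
  have "a = (A - B / of_nat N) / ((of_nat N)\<^sup>2 - 1)" "b = (B - A / of_nat N) / ((of_nat N)\<^sup>2 - 1)"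
    unfolding AB using n1 N by (simp_all add: field_simps power2_eq_square)
  then show ?thesis
    using form[OF r] by (simp add: m_def add_divide_distrib)
qed

text \<open>Inserting 1 as the squared norm of column \<open>j\<close> turns the integrand into a
  sum of fourfold products, to which \<open>second_moment\<close> applies.\<close>

theorem first_moment:
  assumes N: "2 \<le> N" and r: "i < N" "i' < N" and c: "j < N" "l < N"
  shows "(LINT U|\<mu>. U $$ (i, j) * cnj (U $$ (i', l))) = kdelta i i' * kdelta j l / of_nat N"
proof -
  have int: "integrable \<mu> (\<lambda>U. U $$ (i, j) * (U $$ (k, j) * (cnj (U $$ (i', l)) * cnj (U $$ (k, j)))))"
    if "k < N" for k
    using that r c by (intro monomial_integrable) auto
  have "(LINT U|\<mu>. U $$ (i, j) * cnj (U $$ (i', l))) =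
      (LINT U|\<mu>. (\<Sum>k<N. U $$ (i, j) * (U $$ (k, j) * (cnj (U $$ (i', l)) * cnj (U $$ (k, j))))))"
  proof (rule Bochner_Integration.integral_cong[OF refl])
    fix U assume "U \<in> space \<mu>"
    then have U: "U \<in> unitary_group N" by (simp add: space_haar)
    have "(\<Sum>k<N. U $$ (i, j) * (U $$ (k, j) * (cnj (U $$ (i', l)) * cnj (U $$ (k, j))))) =
        U $$ (i, j) * cnj (U $$ (i', l)) * (\<Sum>k<N. U $$ (k, j) * cnj (U $$ (k, j)))"
      by (simp add: sum_distrib_left mult_ac)
    then show "U $$ (i, j) * cnj (U $$ (i', l)) =
        (\<Sum>k<N. U $$ (i, j) * (U $$ (k, j) * (cnj (U $$ (i', l)) * cnj (U $$ (k, j)))))"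
      using c by (simp add: unitary_group_columns[OF U] kdelta_def)
  qed
  also have "\<dots> = (\<Sum>k<N. moment (i, j) (k, j) (i', l) (k, j))"
    unfolding moment_def using int by (simp add: Bochner_Integration.integral_sum)
  also have "\<dots> = (\<Sum>k<N. kdelta j l * (1 - 1 / of_nat N) / ((of_nat N)\<^sup>2 - 1) *
      (kdelta i i' + kdelta i k * kdelta k i'))"
  proof (intro sum.cong refl)
    fix k assume "k \<in> {..<N}"
    then have "moment (i, j) (k, j) (i', l) (k, j) =
        ((kdelta j l - kdelta j l / of_nat N) * kdelta i i' +
         (kdelta j l - kdelta j l / of_nat N) * (kdelta i k * kdelta k i')) / ((of_nat N)\<^sup>2 - 1)"
      using r c by (subst second_moment[OF N]) simp_all
    also have "\<dots> = kdelta j l * (1 - 1 / of_nat N) / ((of_nat N)\<^sup>2 - 1) * (kdelta i i' + kdelta i k * kdelta k i')"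
      by (simp add: ring_distribs add_divide_distrib diff_divide_distrib)
    finally show "moment (i, j) (k, j) (i', l) (k, j) = \<dots>" .
  qed
  also have "\<dots> = kdelta j l * (1 - 1 / of_nat N) / ((of_nat N)\<^sup>2 - 1) * (of_nat N * kdelta i i' + kdelta i i')"
    using r by (simp only: sum_distrib_left[symmetric] sum.distrib sum_kdelta(2) finite_lessThan lessThan_iff) simp
  also have "\<dots> = kdelta i i' * kdelta j l * ((1 - 1 / of_nat N) * (of_nat N + 1) / ((of_nat N)\<^sup>2 - 1))"
  proof -
    have "x * P / Q * (n * y + y) = y * x * (P * (n + 1) / Q)" for x P Q n y :: complex
      by (simp add: divide_inverse algebra_simps)
    then show ?thesis .
  qed
  also have "(1 - 1 / of_nat N) * (of_nat N + 1) / ((of_nat N)\<^sup>2 - 1) = (1 / of_nat N :: complex)"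
  proof -
    have "N\<^sup>2 \<noteq> 1" using N by (simp add: power2_eq_1_iff)
    then have "(of_nat N)\<^sup>2 - 1 \<noteq> (0 :: complex)" by (metis eq_iff_diff_eq_0 of_nat_1 of_nat_eq_iff of_nat_power)
    then show ?thesis using N by (simp add: field_simps power2_eq_square)
  qed
  finally show ?thesis by simp
qed

end

section \<open>Cyclic products\<close>

text \<open>For \<open>n > 0\<close> this is the trace of the product of the matrices
  \<open>F k\<close>, as a sum over closed paths; equivalently, the partition function of a periodic
  chain with transfer matrices \<open>F k\<close>. For \<open>n = 0\<close> it is 1.\<close>

definition cyc :: "nat \<Rightarrow> 'i set \<Rightarrow> (nat \<Rightarrow> 'i \<Rightarrow> 'i \<Rightarrow> 'a) \<Rightarrow> 'a::comm_semiring_1" where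
  "cyc n I F = (\<Sum>a\<in>{..<n} \<rightarrow>\<^sub>E I. \<Prod>k<n. F k (a k) (a (Suc k mod n)))"

lemma bij_betw_rotate: "bij_betw (\<lambda>k. Suc k mod n) {..<n} {..<n}"
proof (cases "n = 0")
  case False
  have m: "Suc k mod n = (if Suc k = n then 0 else Suc k)" if "k < n" for k
    using that by (cases "Suc k = n") simp_all
  have inj: "inj_on (\<lambda>k. Suc k mod n) {..<n}"
    by (rule inj_onI) (simp add: m split: if_splits)
  have "(\<lambda>k. Suc k mod n) ` {..<n} \<subseteq> {..<n}" using False by auto
  then show ?thesis
    unfolding bij_betw_def using endo_inj_surj[OF finite_lessThan _ inj] inj by blast
qed simp

lemma prod_rotate: "(\<Prod>k<n. f (Suc k mod n)) = (\<Prod>k<n. f k)"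
  by (rule prod.reindex_bij_betw[OF bij_betw_rotate])

lemma cyc_cong:
  assumes "\<And>k u v. k < n \<Longrightarrow> u \<in> I \<Longrightarrow> v \<in> I \<Longrightarrow> F k u v = G k u v"
  shows "cyc n I F = cyc n I G"
  unfolding cyc_def
proof (intro sum.cong prod.cong refl)
  fix a k assume a: "a \<in> {..<n} \<rightarrow>\<^sub>E I" and k: "k \<in> {..<n}"
  then have "Suc k mod n \<in> {..<n}" by simp
  then have "a k \<in> I" "a (Suc k mod n) \<in> I" using PiE_mem[OF a] k by blast+
  then show "F k (a k) (a (Suc k mod n)) = G k (a k) (a (Suc k mod n))" using assms k by auto
qed

lemma sum_PiE_Times:
  "(\<Sum>u\<in>K \<rightarrow>\<^sub>E A \<times> B. h (restrict (fst \<circ> u) K) (restrict (snd \<circ> u) K)) = (\<Sum>a\<in>K \<rightarrow>\<^sub>E A. \<Sum>b\<in>K \<rightarrow>\<^sub>E B. h a b)"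
  unfolding sum.cartesian_product
proof (rule sum.reindex_bij_witness[where i = "\<lambda>(a, b). \<lambda>k\<in>K. (a k, b k)"
      and j = "\<lambda>u. (restrict (fst \<circ> u) K, restrict (snd \<circ> u) K)"])
  fix u assume u: "u \<in> K \<rightarrow>\<^sub>E A \<times> B"
  show "(case (restrict (fst \<circ> u) K, restrict (snd \<circ> u) K) of (a, b) \<Rightarrow> \<lambda>k\<in>K. (a k, b k)) = u"
  proof (rule ext)
    fix k show "(case (restrict (fst \<circ> u) K, restrict (snd \<circ> u) K) of (a, b) \<Rightarrow> \<lambda>k\<in>K. (a k, b k)) k = u k"
      using PiE_arb[OF u, of k] by (cases "k \<in> K") auto
  qed
  have "u k \<in> A \<times> B" if "k \<in> K" for k using PiE_mem[OF u that] .
  then show "(restrict (fst \<circ> u) K, restrict (snd \<circ> u) K) \<in> (K \<rightarrow>\<^sub>E A) \<times> (K \<rightarrow>\<^sub>E B)"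
    by (auto simp: mem_Times_iff)
  show "(case (restrict (fst \<circ> u) K, restrict (snd \<circ> u) K) of (a, b) \<Rightarrow> h a b) =
      h (restrict (fst \<circ> u) K) (restrict (snd \<circ> u) K)" by simp
next
  fix ab assume "ab \<in> (K \<rightarrow>\<^sub>E A) \<times> (K \<rightarrow>\<^sub>E B)"
  then obtain a b where ab: "ab = (a, b)" "a \<in> K \<rightarrow>\<^sub>E A" "b \<in> K \<rightarrow>\<^sub>E B" by auto
  have "restrict (fst \<circ> (\<lambda>k\<in>K. (a k, b k))) K = a" "restrict (snd \<circ> (\<lambda>k\<in>K. (a k, b k))) K = b"
    using PiE_arb[OF ab(2)] PiE_arb[OF ab(3)] by (auto simp: fun_eq_iff restrict_def)
  then show "(restrict (fst \<circ> (case ab of (a, b) \<Rightarrow> \<lambda>k\<in>K. (a k, b k))) K,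
      restrict (snd \<circ> (case ab of (a, b) \<Rightarrow> \<lambda>k\<in>K. (a k, b k))) K) = ab" by (simp add: ab)
  show "(case ab of (a, b) \<Rightarrow> \<lambda>k\<in>K. (a k, b k)) \<in> K \<rightarrow>\<^sub>E A \<times> B"
    using ab PiE_mem[OF ab(2)] PiE_mem[OF ab(3)] by auto
qed

text \<open>The product of two traces is the trace of the tensor products. This merges several
  copies of the state into one chain whose bonds carry tuples.\<close>

lemma cyc_mult:
  "cyc n A F * cyc n B G =
    cyc n (A \<times> B) (\<lambda>k u v. F k (fst u) (fst v) * G k (snd u) (snd v))"
proof -
  have "cyc n A F * cyc n B G = (\<Sum>a\<in>{..<n} \<rightarrow>\<^sub>E A. \<Sum>b\<in>{..<n} \<rightarrow>\<^sub>E B.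
      \<Prod>k<n. F k (a k) (a (Suc k mod n)) * G k (b k) (b (Suc k mod n)))"
    by (simp add: cyc_def sum_product prod.distrib)
  also have "\<dots> = (\<Sum>u\<in>{..<n} \<rightarrow>\<^sub>E A \<times> B. \<Prod>k<n.
      F k (restrict (fst \<circ> u) {..<n} k) (restrict (fst \<circ> u) {..<n} (Suc k mod n)) *
      G k (restrict (snd \<circ> u) {..<n} k) (restrict (snd \<circ> u) {..<n} (Suc k mod n)))"
    by (rule sum_PiE_Times[symmetric])
  also have "\<dots> = cyc n (A \<times> B) (\<lambda>k u v. F k (fst u) (fst v) * G k (snd u) (snd v))"
    unfolding cyc_def
  proof (intro sum.cong prod.cong refl)
    fix u :: "nat \<Rightarrow> 'b \<times> 'c" and k assume "k \<in> {..<n}"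
    then have "k < n" "Suc k mod n < n" by simp_all
    then show "F k (restrict (fst \<circ> u) {..<n} k) (restrict (fst \<circ> u) {..<n} (Suc k mod n)) *
        G k (restrict (snd \<circ> u) {..<n} k) (restrict (snd \<circ> u) {..<n} (Suc k mod n)) =
        F k (fst (u k)) (fst (u (Suc k mod n))) * G k (snd (u k)) (snd (u (Suc k mod n)))"
      by (simp only: restrict_apply' lessThan_iff o_apply)
  qed
  finally show ?thesis .
qed

lemma cnj_cyc: "cnj (cyc n A F) = cyc n A (\<lambda>k u v. cnj (F k u v))"
  by (simp add: cyc_def)

text \<open>Cyclicity of the trace: a cyclic product of factorised kernels \<open>\<Sum>\<^sub>s p s f\<^sub>s g\<^sub>s\<close> becomes a
  cyclic product over the labels \<open>s\<close> of the contractions of neighbouring factors.\<close>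

lemma cyc_factor:
  fixes f g :: "'s \<Rightarrow> 'i \<Rightarrow> 'a::comm_semiring_1"
  assumes fin: "finite I" "finite S"
  shows "cyc n I (\<lambda>k u v. \<Sum>s\<in>S. p k s * (f s u * g s v)) =
    cyc n S (\<lambda>k s s'. p k s * (\<Sum>v\<in>I. g s v * f s' v))"
proof -
  have "cyc n I (\<lambda>k u v. \<Sum>s\<in>S. p k s * (f s u * g s v)) =
      (\<Sum>u\<in>{..<n} \<rightarrow>\<^sub>E I. \<Sum>s\<in>{..<n} \<rightarrow>\<^sub>E S.
        \<Prod>k<n. p k (s k) * (f (s k) (u k) * g (s k) (u (Suc k mod n))))"
    unfolding cyc_def using fin by (intro sum.cong refl prod_sum_PiE) auto
  also have "\<dots> = (\<Sum>s\<in>{..<n} \<rightarrow>\<^sub>E S. \<Sum>u\<in>{..<n} \<rightarrow>\<^sub>E I.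
        \<Prod>k<n. p k (s k) * (f (s k) (u k) * g (s k) (u (Suc k mod n))))"
    by (rule sum.swap)
  also have "\<dots> = (\<Sum>s\<in>{..<n} \<rightarrow>\<^sub>E S. \<Prod>k<n. p k (s k) * (\<Sum>v\<in>I. g (s k) v * f (s (Suc k mod n)) v))"
  proof (rule sum.cong[OF refl])
    fix s
    \<comment> \<open>\<open>\<tau>\<close> sends a site to its predecessor. The index
      \<open>u k\<close> occurs in the factor \<open>f\<close> of site \<open>k\<close> and in the
      factor \<open>g\<close> of the preceding site; regrouping by \<open>u k\<close> makes the sum
      over all indices a product.\<close>
    define \<tau> where "\<tau> = inv_into {..<n} (\<lambda>k. Suc k mod n)"
    have \<tau>: "\<tau> (Suc k mod n) = k" if "k < n" for k
      using that bij_betw_inv_into_left[OF bij_betw_rotate[of n], of k] by (simp add: \<tau>_def)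
    have "(\<Prod>k<n. p k (s k) * (f (s k) (u k) * g (s k) (u (Suc k mod n)))) =
        (\<Prod>k<n. p k (s k)) * (\<Prod>k<n. g (s (\<tau> k)) (u k) * f (s k) (u k))" for u
    proof -
      have "(\<Prod>k<n. g (s k) (u (Suc k mod n))) = (\<Prod>k<n. g (s (\<tau> (Suc k mod n))) (u (Suc k mod n)))"
        using \<tau> by (intro prod.cong) auto
      also have "\<dots> = (\<Prod>k<n. g (s (\<tau> k)) (u k))" by (rule prod_rotate[where f = "\<lambda>k. g (s (\<tau> k)) (u k)"])
      finally show ?thesis by (simp add: prod.distrib mult_ac)
    qed
    then have "(\<Sum>u\<in>{..<n} \<rightarrow>\<^sub>E I. \<Prod>k<n. p k (s k) * (f (s k) (u k) * g (s k) (u (Suc k mod n)))) =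
        (\<Prod>k<n. p k (s k)) * (\<Sum>u\<in>{..<n} \<rightarrow>\<^sub>E I. \<Prod>k<n. g (s (\<tau> k)) (u k) * f (s k) (u k))"
      by (simp add: sum_distrib_left)
    also have "(\<Sum>u\<in>{..<n} \<rightarrow>\<^sub>E I. \<Prod>k<n. g (s (\<tau> k)) (u k) * f (s k) (u k)) =
        (\<Prod>k<n. \<Sum>v\<in>I. g (s (\<tau> k)) v * f (s k) v)"
      using fin by (intro prod_sum_PiE[symmetric]) auto
    also have "\<dots> = (\<Prod>k<n. \<Sum>v\<in>I. g (s (\<tau> (Suc k mod n))) v * f (s (Suc k mod n)) v)"
      by (rule prod_rotate[where f = "\<lambda>k. \<Sum>v\<in>I. g (s (\<tau> k)) v * f (s k) v", symmetric])
    also have "\<dots> = (\<Prod>k<n. \<Sum>v\<in>I. g (s k) v * f (s (Suc k mod n)) v)"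
      using \<tau> by (intro prod.cong refl) auto
    finally show "(\<Sum>u\<in>{..<n} \<rightarrow>\<^sub>E I. \<Prod>k<n. p k (s k) * (f (s k) (u k) * g (s k) (u (Suc k mod n)))) =
        (\<Prod>k<n. p k (s k) * (\<Sum>v\<in>I. g (s k) v * f (s (Suc k mod n)) v))"
      by (simp add: prod.distrib)
  qed
  finally show ?thesis by (simp add: cyc_def)
qed

text \<open>Only constant paths around the ring have nonzero weight.\<close>

lemma cyc_diagonal:
  assumes n: "n > 0" and S: "finite S"
  shows "cyc n S (\<lambda>k s s'. if s = s' then l s else 0) = (\<Sum>s\<in>S. l s ^ n)"
proof -
  let ?c = "\<lambda>s. \<lambda>k\<in>{..<n}. s"
  have inj: "inj_on ?c S"
  proof (rule inj_onI)
    fix s s' assume "?c s = ?c s'"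
    then have "?c s 0 = ?c s' 0" by (rule fun_cong)
    then show "s = s'" using n by simp
  qed
  have "cyc n S (\<lambda>k s s'. if s = s' then l s else 0) =
      (\<Sum>a\<in>?c ` S. \<Prod>k<n. if a k = a (Suc k mod n) then l (a k) else 0)"
    unfolding cyc_def
  proof (rule sum.mono_neutral_right)
    show "finite ({..<n} \<rightarrow>\<^sub>E S)" using S by (simp add: finite_PiE)
    show "?c ` S \<subseteq> {..<n} \<rightarrow>\<^sub>E S" by (auto split: if_splits)
    show "\<forall>a\<in>({..<n} \<rightarrow>\<^sub>E S) - ?c ` S. (\<Prod>k<n. if a k = a (Suc k mod n) then l (a k) else 0) = 0"
    proof (rule ballI, rule ccontr)
      fix a assume a: "a \<in> ({..<n} \<rightarrow>\<^sub>E S) - ?c ` S"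
        and nz: "(\<Prod>k<n. if a k = a (Suc k mod n) then l (a k) else 0) \<noteq> 0"
      have step: "a (Suc k mod n) = a k" if "k < n" for k
        using nz that prod_zero[of "{..<n}" "\<lambda>k. if a k = a (Suc k mod n) then l (a k) else 0"]
        by (metis finite_lessThan lessThan_iff)
      have const: "a k = a 0" if "k < n" for k
        using that
      proof (induction k)
        case (Suc k)
        then show ?case using step[of k] by simp
      qed simp
      have aP: "a \<in> {..<n} \<rightarrow>\<^sub>E S" using a by simp
      have "a = ?c (a 0)"
      proof (rule ext)
        fix k show "a k = ?c (a 0) k"
          using const[of k] PiE_arb[OF aP, of k] by (cases "k < n") simp_all
      qed
      moreover have "a 0 \<in> S" using PiE_mem[OF aP, of 0] n by simp
      ultimately show False using a by blast
    qed
  qed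
  also have "\<dots> = (\<Sum>s\<in>S. l s ^ n)"
    unfolding sum.reindex[OF inj] using n by (intro sum.cong refl) simp
  finally show ?thesis .
qed

section \<open>Traces of matrix products as sums over closed paths\<close>

lemma foldr_mat_mult:
  fixes Y :: "'a::comm_ring_1 mat"
  assumes "\<And>k. k \<in> set ks \<Longrightarrow> A k \<in> carrier_mat D D" "Y \<in> carrier_mat D D"
  shows "foldr (*) (map A ks) Y = foldr (*) (map A ks) (1\<^sub>m D) * Y \<and>
    foldr (*) (map A ks) (1\<^sub>m D) \<in> carrier_mat D D"
  using assms(1)
proof (induction ks)
  case (Cons k ks)
  then have "A k \<in> carrier_mat D D" "foldr (*) (map A ks) Y = foldr (*) (map A ks) (1\<^sub>m D) * Y"
    "foldr (*) (map A ks) (1\<^sub>m D) \<in> carrier_mat D D" by auto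
  then show ?case using assms(2) assoc_mult_mat[of "A k" D D "foldr (*) (map A ks) (1\<^sub>m D)" D Y D] by auto
qed (simp add: left_mult_one_mat[OF assms(2)])

text \<open>A sum over open paths: the update \<open>a(n := j)\<close> fixes the right end at
  position \<open>n\<close>, while the left end is imposed as a constraint at position 0. In this
  form the case \<open>n = 0\<close> is correct too: both conditions meet at position 0 and give the
  identity matrix.\<close>

lemma foldr_mat_mult_entry:
  fixes A :: "nat \<Rightarrow> 'a::comm_ring_1 mat"
  assumes A: "\<And>k. k < n \<Longrightarrow> A k \<in> carrier_mat D D" and ij: "i < D" "j < D"
  shows "foldr (*) (map A [0..<n]) (1\<^sub>m D) $$ (i, j) =
    (\<Sum>a\<in>{..<n} \<rightarrow>\<^sub>E {..<D}. of_bool ((a(n := j)) 0 = i) * (\<Prod>k<n. A k $$ (a k, (a(n := j)) (Suc k))))"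
  using A ij(2)
proof (induction n arbitrary: j)
  case 0
  then show ?case using ij by auto
next
  case (Suc n)
  let ?P = "foldr (*) (map A [0..<n]) (1\<^sub>m D)"
  have An: "A n \<in> carrier_mat D D" using Suc by auto
  have P: "?P \<in> carrier_mat D D" using foldr_mat_mult[of "[0..<n]" A D "1\<^sub>m D"] Suc.prems by auto
  have "foldr (*) (map A [0..<Suc n]) (1\<^sub>m D) = foldr (*) (map A [0..<n]) (A n)"
    using right_mult_one_mat[OF An] by simp
  also have "\<dots> = ?P * A n"
    using foldr_mat_mult[of "[0..<n]" A D "A n"] Suc.prems An by auto
  finally have "foldr (*) (map A [0..<Suc n]) (1\<^sub>m D) $$ (i, j) = (?P * A n) $$ (i, j)" by (rule arg_cong)
  also have "\<dots> = (\<Sum>l<D. ?P $$ (i, l) * A n $$ (l, j))"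
    using P An ij(1) Suc.prems(2) by (auto simp: scalar_prod_def lessThan_atLeast0)
  also have "\<dots> = (\<Sum>l<D. \<Sum>a\<in>{..<n} \<rightarrow>\<^sub>E {..<D}. of_bool ((a(n := l)) 0 = i) *
      (\<Prod>k<n. A k $$ (a k, (a(n := l)) (Suc k))) * A n $$ (l, j))"
    unfolding sum_distrib_right[symmetric] using Suc
    by (intro sum.cong refl arg_cong2[where f = "(*)"]) auto
  also have "\<dots> = (\<Sum>(l, a)\<in>{..<D} \<times> ({..<n} \<rightarrow>\<^sub>E {..<D}). of_bool ((a(n := l)) 0 = i) *
      (\<Prod>k<n. A k $$ (a k, (a(n := l)) (Suc k))) * A n $$ (l, j))"
    by (rule sum.cartesian_product)
  also have "\<dots> = (\<Sum>b\<in>{..<Suc n} \<rightarrow>\<^sub>E {..<D}. of_bool ((b(Suc n := j)) 0 = i) *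
      (\<Prod>k<Suc n. A k $$ (b k, (b(Suc n := j)) (Suc k))))"
  proof -
    let ?F = "\<lambda>b. of_bool ((b(Suc n := j)) 0 = i) * (\<Prod>k<Suc n. A k $$ (b k, (b(Suc n := j)) (Suc k)))"
    have "(\<Sum>b\<in>{..<Suc n} \<rightarrow>\<^sub>E {..<D}. ?F b) =
        (\<Sum>b\<in>(\<lambda>(l, a). a(n := l)) ` ({..<D} \<times> ({..<n} \<rightarrow>\<^sub>E {..<D})). ?F b)"
      by (simp only: lessThan_Suc PiE_insert_eq)
    also have "\<dots> = (\<Sum>x\<in>{..<D} \<times> ({..<n} \<rightarrow>\<^sub>E {..<D}). ?F (case x of (l, a) \<Rightarrow> a(n := l)))"
      using inj_combinator[of n "{..<n}" "\<lambda>_. {..<D}"] by (subst sum.reindex) simp_all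
    also have "\<dots> = (\<Sum>(l, a)\<in>{..<D} \<times> ({..<n} \<rightarrow>\<^sub>E {..<D}). of_bool ((a(n := l)) 0 = i) *
        (\<Prod>k<n. A k $$ (a k, (a(n := l)) (Suc k))) * A n $$ (l, j))"
    proof (intro sum.cong refl, clarify)
      fix l and a :: "nat \<Rightarrow> nat"
      have "(\<Prod>k<n. A k $$ ((a(n := l)) k, (a(n := l, Suc n := j)) (Suc k))) =
          (\<Prod>k<n. A k $$ (a k, (a(n := l)) (Suc k)))"
        by (intro prod.cong refl) simp
      then show "?F (a(n := l)) = of_bool ((a(n := l)) 0 = i) *
          (\<Prod>k<n. A k $$ (a k, (a(n := l)) (Suc k))) * A n $$ (l, j)"
        by (simp add: mult.assoc)
    qed
    finally show ?thesis by (rule sym)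
  qed
  finally show ?case .
qed

text \<open>Equating the two ends of an open path closes it. Length 0 must be excluded, since there
  the left side is \<open>D\<close> and the right side 1.\<close>

lemma mat_trace_foldr:
  fixes A :: "nat \<Rightarrow> complex mat"
  assumes A: "\<And>k. k < n \<Longrightarrow> A k \<in> carrier_mat D D" and n: "n > 0"
  shows "mat_trace (foldr (*) (map A [0..<n]) (1\<^sub>m D)) = cyc n {..<D} (\<lambda>k a b. A k $$ (a, b))"
proof -
  have "foldr (*) (map A [0..<n]) (1\<^sub>m D) \<in> carrier_mat D D"
    using foldr_mat_mult[of "[0..<n]" A D "1\<^sub>m D"] A by auto
  then have "mat_trace (foldr (*) (map A [0..<n]) (1\<^sub>m D)) =
      (\<Sum>i<D. \<Sum>a\<in>{..<n} \<rightarrow>\<^sub>E {..<D}. of_bool ((a(n := i)) 0 = i) * (\<Prod>k<n. A k $$ (a k, (a(n := i)) (Suc k))))"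
    unfolding mat_trace_def using foldr_mat_mult_entry[where A = A and n = n and D = D] A
    by (intro sum.cong) auto
  also have "\<dots> = (\<Sum>a\<in>{..<n} \<rightarrow>\<^sub>E {..<D}. \<Sum>i<D. of_bool ((a(n := i)) 0 = i) * (\<Prod>k<n. A k $$ (a k, (a(n := i)) (Suc k))))"
    by (rule sum.swap)
  also have "\<dots> = cyc n {..<D} (\<lambda>k a b. A k $$ (a, b))"
    unfolding cyc_def
  proof (rule sum.cong[OF refl])
    fix a assume a: "a \<in> {..<n} \<rightarrow>\<^sub>E {..<D}"
    have a0: "a 0 < D" using PiE_mem[OF a, of 0] n by simp
    have "(\<Sum>i<D. of_bool ((a(n := i)) 0 = i) * (\<Prod>k<n. A k $$ (a k, (a(n := i)) (Suc k)))) =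
        (\<Sum>i<D. kdelta (a 0) i * (\<Prod>k<n. A k $$ (a k, (a(n := i)) (Suc k))))"
      using n by (simp add: kdelta_def)
    also have "\<dots> = (\<Prod>k<n. A k $$ (a k, (a(n := a 0)) (Suc k)))"
      using a0 by (simp add: sum_kdelta)
    also have "\<dots> = (\<Prod>k<n. A k $$ (a k, a (Suc k mod n)))"
    proof (rule prod.cong[OF refl])
      fix k assume "k \<in> {..<n}"
      then show "A k $$ (a k, (a(n := a 0)) (Suc k)) = A k $$ (a k, a (Suc k mod n))"
        by (cases "Suc k = n") simp_all
    qed
    finally show "(\<Sum>i<D. of_bool ((a(n := i)) 0 = i) * (\<Prod>k<n. A k $$ (a k, (a(n := i)) (Suc k)))) =
        (\<Prod>k<n. A k $$ (a k, a (Suc k mod n)))" .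
  qed
  finally show ?thesis .
qed

section \<open>Base-\<open>d\<close> digits and sums over the product basis\<close>

lemma base_digits_inject:
  fixes d :: nat
  assumes "x < d ^ n" "y < d ^ n" "\<And>k. k < n \<Longrightarrow> x div d ^ k mod d = y div d ^ k mod d"
  shows "x = y"
  using assms
proof (induction n arbitrary: x y)
  case (Suc n)
  have "d > 0" using Suc.prems(1) by (cases d) auto
  have "x div d = y div d"
  proof (rule Suc.IH)
    show "x div d < d ^ n" "y div d < d ^ n"
      using Suc.prems \<open>d > 0\<close> by (simp_all add: less_mult_imp_div_less mult.commute)
    show "x div d div d ^ k mod d = y div d div d ^ k mod d" if "k < n" for k
      using Suc.prems(3)[of "Suc k"] that by (simp add: div_mult2_eq)
  qed
  moreover have "x mod d = y mod d" using Suc.prems(3)[of 0] by simp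
  ultimately show ?case by (metis div_mult_mod_eq)
qed simp

lemma digit_less: "x < d ^ n \<Longrightarrow> k < n \<Longrightarrow> digit d n x k < d"
  by (cases "d = 0") (auto simp: digit_def power_0_left)

lemma digit_inject:
  assumes "x < d ^ n" "y < d ^ n" "\<And>k. k < n \<Longrightarrow> digit d n x k = digit d n y k"
  shows "x = y"
proof (rule base_digits_inject[OF assms(1,2)])
  fix k assume "k < n"
  then show "x div d ^ k mod d = y div d ^ k mod d"
    using assms(3)[of "n - 1 - k"] by (simp add: digit_def)
qed

text \<open>Injectivity suffices, as both sides have \<open>d ^ n\<close> elements.\<close>

lemma bij_betw_digits:
  "bij_betw (\<lambda>x. \<lambda>k\<in>{..<n}. digit d n x k) {..<d ^ n} ({..<n} \<rightarrow>\<^sub>E {..<d})"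
proof -
  let ?f = "\<lambda>x. \<lambda>k\<in>{..<n}. digit d n x k"
  have inj: "inj_on ?f {..<d ^ n}"
  proof (rule inj_onI)
    fix x y assume xy: "x \<in> {..<d ^ n}" "y \<in> {..<d ^ n}" "?f x = ?f y"
    show "x = y"
    proof (rule digit_inject)
      fix k assume "k < n"
      moreover have "?f x k = ?f y k" by (simp only: xy(3))
      ultimately show "digit d n x k = digit d n y k" by simp
    qed (use xy in auto)
  qed
  moreover have "?f ` {..<d ^ n} \<subseteq> {..<n} \<rightarrow>\<^sub>E {..<d}" by (auto simp: digit_less split: if_splits)
  moreover have "card ({..<n} \<rightarrow>\<^sub>E {..<d}) = card (?f ` {..<d ^ n})"
    unfolding card_image[OF inj] by (simp add: card_PiE)
  ultimately show ?thesis
    unfolding bij_betw_def by (simp add: card_subset_eq finite_PiE)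
qed

lemma sum_digits_pair:
  fixes h :: "nat \<Rightarrow> nat \<Rightarrow> nat \<Rightarrow> 'a::comm_semiring_1"
  shows "(\<Sum>x<d ^ n. \<Sum>y<d ^ n. \<Prod>k<n. h k (digit d n x k) (digit d n y k)) = (\<Prod>k<n. \<Sum>i<d. \<Sum>j<d. h k i j)"
proof -
  let ?D = "\<lambda>x. \<lambda>k\<in>{..<n}. digit d n x k"
  have "(\<Sum>x<d ^ n. \<Sum>y<d ^ n. \<Prod>k<n. h k (digit d n x k) (digit d n y k)) =
      (\<Sum>x<d ^ n. \<Sum>y<d ^ n. \<Prod>k<n. h k (?D x k) (?D y k))"
    by (intro sum.cong prod.cong refl) auto
  also have "\<dots> = (\<Sum>x<d ^ n. \<Sum>y\<in>{..<n} \<rightarrow>\<^sub>E {..<d}. \<Prod>k<n. h k (?D x k) (y k))"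
    by (intro sum.cong refl sum.reindex_bij_betw[OF bij_betw_digits, where g = "\<lambda>y. \<Prod>k<n. h k (?D _ k) (y k)"])
  also have "\<dots> = (\<Sum>x\<in>{..<n} \<rightarrow>\<^sub>E {..<d}. \<Sum>y\<in>{..<n} \<rightarrow>\<^sub>E {..<d}. \<Prod>k<n. h k (x k) (y k))"
    by (rule sum.reindex_bij_betw[OF bij_betw_digits, where g = "\<lambda>x. \<Sum>y\<in>_. \<Prod>k<n. h k (x k) (y k)"])
  also have "\<dots> = (\<Sum>u\<in>{..<n} \<rightarrow>\<^sub>E {..<d} \<times> {..<d}.
      \<Prod>k<n. h k (restrict (fst \<circ> u) {..<n} k) (restrict (snd \<circ> u) {..<n} k))"
    by (rule sum_PiE_Times[symmetric])
  also have "\<dots> = (\<Sum>u\<in>{..<n} \<rightarrow>\<^sub>E {..<d} \<times> {..<d}. \<Prod>k<n. h k (fst (u k)) (snd (u k)))"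
    by (intro sum.cong prod.cong refl) auto
  also have "\<dots> = (\<Prod>k<n. \<Sum>u\<in>{..<d} \<times> {..<d}. h k (fst u) (snd u))"
    by (rule prod_sum_PiE[symmetric]) auto
  finally show ?thesis by (simp add: sum.cartesian_product case_prod_unfold)
qed

section \<open>Moments of random matrix product states\<close>

text \<open>\<open>pairing False\<close> and \<open>pairing True\<close> are the index patterns of the identity and of the swap
  on a twofold tensor product.\<close>

definition pairing :: "bool \<Rightarrow> 'a \<Rightarrow> 'a \<Rightarrow> 'a \<Rightarrow> 'a \<Rightarrow> complex" where
  "pairing s a b a' b' = (if s then kdelta a b' * kdelta b a' else kdelta a a' * kdelta b b')"

text \<open>Each closed loop of identified indices contributes a factor \<open>card I\<close>: two
  loops for equal patterns, one for different patterns.\<close>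

lemma pairing_gram:
  assumes I: "finite I"
  shows "(\<Sum>a\<in>I. \<Sum>b\<in>I. \<Sum>a'\<in>I. \<Sum>b'\<in>I. pairing s a b a' b' * pairing s' a b a' b') =
    (if s = s' then of_nat (card I) ^ 2 else of_nat (card I))"
proof -
  have two: "(\<Sum>a'\<in>I. \<Sum>b'\<in>I. kdelta a a' * kdelta b b' * f a' b') = f a b"
    "(\<Sum>a'\<in>I. \<Sum>b'\<in>I. kdelta a b' * kdelta b a' * f a' b') = f b a" if "a \<in> I" "b \<in> I" for a b and f :: "'a \<Rightarrow> 'a \<Rightarrow> complex"
  proof -
    have "(\<Sum>a'\<in>I. \<Sum>b'\<in>I. kdelta a a' * kdelta b b' * f a' b') = (\<Sum>a'\<in>I. kdelta a a' * (\<Sum>b'\<in>I. kdelta b b' * f a' b'))"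
      by (simp add: sum_distrib_left mult.assoc)
    then show "(\<Sum>a'\<in>I. \<Sum>b'\<in>I. kdelta a a' * kdelta b b' * f a' b') = f a b"
      using that I by (simp add: sum_kdelta)
    have "(\<Sum>a'\<in>I. \<Sum>b'\<in>I. kdelta a b' * kdelta b a' * f a' b') = (\<Sum>a'\<in>I. kdelta b a' * (\<Sum>b'\<in>I. kdelta a b' * f a' b'))"
      by (simp add: sum_distrib_left mult_ac)
    then show "(\<Sum>a'\<in>I. \<Sum>b'\<in>I. kdelta a b' * kdelta b a' * f a' b') = f b a"
      using that I by (simp add: sum_kdelta)
  qed
  have "(\<Sum>a\<in>I. \<Sum>b\<in>I. \<Sum>a'\<in>I. \<Sum>b'\<in>I. pairing s a b a' b' * pairing s' a b a' b') =
      (\<Sum>a\<in>I. \<Sum>b\<in>I. if s = s' then 1 else kdelta a b)"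
    by (intro sum.cong refl, cases s; cases s') (simp_all add: pairing_def two)
  then show ?thesis using I by (simp add: sum_kdelta power2_eq_square)
qed

text \<open>The weights of neighbouring labels: the Weingarten matrix of \<open>U(d D)\<close> times the Gram matrix
  of the pairings on the bond space.\<close>

definition bond_weight :: "nat \<Rightarrow> nat \<Rightarrow> bool \<Rightarrow> bool \<Rightarrow> real" where
  "bond_weight d D s s' = (if s = s' then (real D)\<^sup>2 - 1 / real d else real D - real D / real d) / ((real d * real D)\<^sup>2 - 1)"

locale random_mps = haar "d * D" \<mu> for d D \<mu> +
  fixes n :: nat
  assumes n: "0 < n" and dim: "2 \<le> d * D"
begin

lemma dD: "0 < d" "0 < D"
  using dim by (auto intro!: Nat.gr0I)

lemma dim_sq: "0 < (real d * real D)\<^sup>2 - 1"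
proof -
  have "2 \<le> real d * real D" using dim by (metis of_nat_le_iff of_nat_mult of_nat_numeral)
  then have "1 < (real d * real D)\<^sup>2" by (intro one_less_power) auto
  then show ?thesis by simp
qed

lemma site_index: "i < d \<Longrightarrow> a < D \<Longrightarrow> i * D + a < d * D"
  using mult_le_mono1[of "Suc i" d D] by simp

lemma column_index: "a < D \<Longrightarrow> a < d * D"
  using site_index[of 0 a] dD by simp

lemma digit_index: "x < d ^ n \<Longrightarrow> k < n \<Longrightarrow> a < D \<Longrightarrow> digit d n x k * D + a < d * D"
  by (simp add: site_index digit_less)

lemma kdelta_site: "a < D \<Longrightarrow> a' < D \<Longrightarrow> kdelta (i * D + a) (i' * D + a') = kdelta i i' * kdelta a a'"
proof -
  assume a: "a < D" "a' < D"
  have "i * D + a = i' * D + a' \<longleftrightarrow> i = i' \<and> a = a'"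
  proof
    assume *: "i * D + a = i' * D + a'"
    have "(i * D + a) div D = i" "(i' * D + a') div D = i'" using a by simp_all
    then show "i = i' \<and> a = a'" using * by auto
  qed auto
  then show ?thesis by (simp add: kdelta_def)
qed

text \<open>A row of \<open>U\<close> is a physical label together with a bond index, so a pairing
  of rows is a pairing of physical labels times a pairing of bonds. The columns carry a bond index
  only, because the input of the first factor is fixed to the basis vector 0. The last factor
  collects the Weingarten coefficients.\<close>

lemma site_moment:
  assumes i: "i < d" "k < d" "i' < d" "k' < d" and a: "a < D" "b < D" "a' < D" "b' < D"
    and c: "j1 < D" "j2 < D" "l1 < D" "l2 < D"
  shows "moment (i * D + a, j1) (k * D + b, j2) (i' * D + a', l1) (k' * D + b', l2) =
    (\<Sum>s\<in>UNIV. pairing s i k i' k' * (pairing s a b a' b' *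
      ((pairing s j1 j2 l1 l2 - pairing (\<not> s) j1 j2 l1 l2 / of_nat (d * D)) / ((of_nat (d * D))\<^sup>2 - 1))))"
proof -
  have "moment (i * D + a, j1) (k * D + b, j2) (i' * D + a', l1) (k' * D + b', l2) =
      ((kdelta j1 l1 * kdelta j2 l2 - kdelta j1 l2 * kdelta j2 l1 / of_nat (d * D)) *
        (kdelta (i * D + a) (i' * D + a') * kdelta (k * D + b) (k' * D + b')) +
       (kdelta j1 l2 * kdelta j2 l1 - kdelta j1 l1 * kdelta j2 l2 / of_nat (d * D)) *
        (kdelta (i * D + a) (k' * D + b') * kdelta (k * D + b) (i' * D + a'))) / ((of_nat (d * D))\<^sup>2 - 1)"
    using assms by (intro second_moment dim site_index column_index)
  then show ?thesis
    by (simp only: kdelta_site a) (simp add: UNIV_bool pairing_def add_divide_distrib mult_ac)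
qed

abbreviation P where "P \<equiv> \<Pi>\<^sub>M k \<in> {..<n}. \<mu>"

lemma prob_space_P: "prob_space P"
  by (intro prob_space_PiM prob_space_axioms)

lemma product_sigma_finite_mu: "product_sigma_finite (\<lambda>_. \<mu>)"
  by (simp add: product_sigma_finite_def sigma_finite_measure_axioms)

text \<open>Along a fixed path the integrand is a product of functions of the independent matrices
  \<open>U k\<close>, hence the average acts on each site separately.\<close>

lemma integral_cyc:
  fixes F :: "nat \<Rightarrow> 'i \<Rightarrow> 'i \<Rightarrow> complex mat \<Rightarrow> complex"
  assumes I: "finite I" and F: "\<And>k u v. k < n \<Longrightarrow> u \<in> I \<Longrightarrow> v \<in> I \<Longrightarrow> integrable \<mu> (F k u v)"
  shows "integrable P (\<lambda>U. cyc n I (\<lambda>k u v. F k u v (U k)))"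
    "(LINT U|P. cyc n I (\<lambda>k u v. F k u v (U k))) = cyc n I (\<lambda>k u v. LINT V|\<mu>. F k u v V)"
proof -
  interpret product_sigma_finite "\<lambda>_. \<mu>" by (rule product_sigma_finite_mu)
  have int: "integrable \<mu> (F k (a k) (a (Suc k mod n)))" if a: "a \<in> {..<n} \<rightarrow>\<^sub>E I" and k: "k < n" for a k
  proof -
    have "Suc k mod n \<in> {..<n}" using k by simp
    then show ?thesis using F k PiE_mem[OF a] by blast
  qed
  have fin: "finite ({..<n} \<rightarrow>\<^sub>E I)" using I by (simp add: finite_PiE)
  show "integrable P (\<lambda>U. cyc n I (\<lambda>k u v. F k u v (U k)))"
    unfolding cyc_def using int by (intro Bochner_Integration.integrable_sum product_integrable_prod) auto
  have "(LINT U|P. cyc n I (\<lambda>k u v. F k u v (U k))) =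
      (\<Sum>a\<in>{..<n} \<rightarrow>\<^sub>E I. LINT U|P. (\<Prod>k<n. F k (a k) (a (Suc k mod n)) (U k)))"
    unfolding cyc_def using int by (intro Bochner_Integration.integral_sum product_integrable_prod) auto
  also have "\<dots> = cyc n I (\<lambda>k u v. LINT V|\<mu>. F k u v V)"
    unfolding cyc_def using int by (intro sum.cong refl product_integral_prod) auto
  finally show "(LINT U|P. cyc n I (\<lambda>k u v. F k u v (U k))) = cyc n I (\<lambda>k u v. LINT V|\<mu>. F k u v V)" .
qed

lemma rmps_entry:
  assumes "x < d ^ n"
  shows "rmps d n D U $ x = cyc n {..<D} (\<lambda>k a b. U k $$ (digit d n x k * D + a, b))"
proof -
  have "rmps d n D U $ x = cyc n {..<D} (\<lambda>k a b. site_mat D (U k) (digit d n x k) $$ (a, b))"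
    using assms n by (simp add: rmps_def mat_trace_foldr site_mat_def)
  also have "\<dots> = cyc n {..<D} (\<lambda>k a b. U k $$ (digit d n x k * D + a, b))"
    by (rule cyc_cong) (simp add: site_mat_def)
  finally show ?thesis .
qed

definition fourfold :: "nat \<Rightarrow> nat \<Rightarrow> nat \<Rightarrow> nat \<Rightarrow> (nat \<Rightarrow> complex mat) \<Rightarrow> complex" where
  "fourfold x y x' y' U = rmps d n D U $ x * (rmps d n D U $ y *
    (cnj (rmps d n D U $ x') * cnj (rmps d n D U $ y')))"

text \<open>Nested to the right because this is the shape that \<open>cyc_mult\<close> gives to the
  product in \<open>fourfold\<close>.\<close>

abbreviation bonds where "bonds \<equiv> {..<D} \<times> ({..<D} \<times> ({..<D} \<times> {..<D}))"

lemma sum_bonds: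
  "(\<Sum>u\<in>bonds. f (fst u) (fst (snd u)) (fst (snd (snd u))) (snd (snd (snd u)))) = (\<Sum>a<D. \<Sum>b<D. \<Sum>a'<D. \<Sum>b'<D. f a b a' b')"
  by (simp only: sum.cartesian_product case_prod_unfold)

text \<open>Averaging a site makes its kernel a sum over two labels of a function of the left bonds
  times a function of the right bonds. By \<open>cyc_factor\<close> all bond indices are then summed
  out, and a chain with two states per site remains.\<close>

lemma fourfold_moment:
  assumes x: "x < d ^ n" "y < d ^ n" "x' < d ^ n" "y' < d ^ n"
  shows "integrable P (fourfold x y x' y')"
    "(LINT U|P. fourfold x y x' y' U) = cyc n UNIV (\<lambda>k s s'.
      pairing s (digit d n x k) (digit d n y k) (digit d n x' k) (digit d n y' k) * of_real (bond_weight d D s s'))"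
proof -
  let ?x = "digit d n x" and ?y = "digit d n y" and ?x' = "digit d n x'" and ?y' = "digit d n y'"
  define F where "F k u v V = V $$ (?x k * D + fst u, fst v) * (V $$ (?y k * D + fst (snd u), fst (snd v)) *
    (cnj (V $$ (?x' k * D + fst (snd (snd u)), fst (snd (snd v)))) *
     cnj (V $$ (?y' k * D + snd (snd (snd u)), snd (snd (snd v))))))"
    for k and u v :: "nat \<times> nat \<times> nat \<times> nat" and V :: "complex mat"
  have eq: "fourfold x y x' y' U = cyc n bonds (\<lambda>k u v. F k u v (U k))" for U
    unfolding fourfold_def rmps_entry[OF x(1)] rmps_entry[OF x(2)] rmps_entry[OF x(3)] rmps_entry[OF x(4)]
      cnj_cyc cyc_mult F_def ..
  have int: "integrable \<mu> (F k u v)" if "k < n" "u \<in> bonds" "v \<in> bonds" for k u v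
    unfolding F_def using that x
    by (intro monomial_integrable) (auto simp: mem_Times_iff digit_index column_index)
  show "integrable P (fourfold x y x' y')"
    unfolding eq[abs_def] using int by (intro integral_cyc(1)) auto
  \<comment> \<open>\<open>f\<close> is the pairing of the rows, carried by the left bonds;
    \<open>g\<close> is the pairing of the columns with its Weingarten coefficients, carried by the
    right bonds.\<close>
  define f where "f s u = pairing s (fst u) (fst (snd u)) (fst (snd (snd u))) (snd (snd (snd u)))"
    for s and u :: "nat \<times> nat \<times> nat \<times> nat"
  define g where "g s v = (f s v - f (\<not> s) v / of_nat (d * D)) / ((of_nat (d * D))\<^sup>2 - 1)" for s v
  have gram: "(\<Sum>v\<in>bonds. f s v * f s' v) = (if s = s' then of_nat D ^ 2 else of_nat D)" for s s'
    unfolding f_def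
    using sum_bonds[of "\<lambda>a b a' b'. pairing s a b a' b' * pairing s' a b a' b'"] pairing_gram[of "{..<D}" s s']
    by simp
  \<comment> \<open>With the Gram numbers \<open>D\<^sup>2\<close> and \<open>D\<close>, the
    numerators are \<open>D\<^sup>2 - D / (d D)\<close> for equal labels and
    \<open>D - D\<^sup>2 / (d D)\<close> for different ones.\<close>
  have contr: "(\<Sum>v\<in>bonds. g s v * f s' v) = of_real (bond_weight d D s s')" for s s'
  proof -
    have "(\<Sum>v\<in>bonds. g s v * f s' v) =
        ((\<Sum>v\<in>bonds. f s v * f s' v) - (\<Sum>v\<in>bonds. f (\<not> s) v * f s' v) / of_nat (d * D)) / ((of_nat (d * D))\<^sup>2 - 1)"
      unfolding g_def by (simp only: sum_divide_distrib[symmetric] sum_subtractf left_diff_distrib times_divide_eq_left)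
    also have "\<dots> = of_real (bond_weight d D s s')"
      using dD by (cases "s = s'") (auto simp: gram bond_weight_def field_simps power2_eq_square)
    finally show ?thesis .
  qed
  have "(LINT U|P. fourfold x y x' y' U) = cyc n bonds (\<lambda>k u v. LINT V|\<mu>. F k u v V)"
    unfolding eq using int by (intro integral_cyc(2)) auto
  also have "\<dots> = cyc n bonds (\<lambda>k u v. \<Sum>s\<in>UNIV. pairing s (?x k) (?y k) (?x' k) (?y' k) * (f s u * g s v))"
  proof (rule cyc_cong)
    fix k u v assume kuv: "k < n" "u \<in> bonds" "v \<in> bonds"
    have "(LINT V|\<mu>. F k u v V) = moment (?x k * D + fst u, fst v) (?y k * D + fst (snd u), fst (snd v))
        (?x' k * D + fst (snd (snd u)), fst (snd (snd v))) (?y' k * D + snd (snd (snd u)), snd (snd (snd v)))"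
      by (simp add: moment_def F_def)
    also have "\<dots> = (\<Sum>s\<in>UNIV. pairing s (?x k) (?y k) (?x' k) (?y' k) * (f s u * g s v))"
      unfolding f_def g_def using kuv x by (intro site_moment digit_less) (auto simp: mem_Times_iff)
    finally show "(LINT V|\<mu>. F k u v V) = (\<Sum>s\<in>UNIV. pairing s (?x k) (?y k) (?x' k) (?y' k) * (f s u * g s v))" .
  qed
  also have "\<dots> = cyc n UNIV (\<lambda>k s s'. pairing s (?x k) (?y k) (?x' k) (?y' k) * (\<Sum>v\<in>bonds. g s v * f s' v))"
    by (rule cyc_factor) auto
  finally show "(LINT U|P. fourfold x y x' y' U) = cyc n UNIV (\<lambda>k s s'.
      pairing s (?x k) (?y k) (?x' k) (?y' k) * of_real (bond_weight d D s s'))"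
    by (simp only: contr)
qed

text \<open>With one conjugated entry there is a single pattern, so the chain has only the label
  \<open>()\<close>, and each site contributes \<open>D / (d D) = 1 / d\<close>.\<close>

lemma twofold_moment:
  assumes x: "x < d ^ n"
  shows "integrable P (\<lambda>U. rmps d n D U $ x * cnj (rmps d n D U $ x))"
    "(LINT U|P. rmps d n D U $ x * cnj (rmps d n D U $ x)) = 1 / of_nat d ^ n"
proof -
  define F where "F k u v V = V $$ (digit d n x k * D + fst u, fst v) * cnj (V $$ (digit d n x k * D + snd u, snd v))"
    for k and u v :: "nat \<times> nat" and V :: "complex mat"
  let ?I = "{..<D} \<times> {..<D}"
  have eq: "rmps d n D U $ x * cnj (rmps d n D U $ x) = cyc n ?I (\<lambda>k u v. F k u v (U k))" for U
    unfolding rmps_entry[OF x] cnj_cyc cyc_mult F_def ..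
  have int: "integrable \<mu> (F k u v)" if "k < n" "u \<in> ?I" "v \<in> ?I" for k u v
  proof (rule integrable_const_bound[where B = 1])
    have ix: "digit d n x k * D + fst u < d * D" "fst v < d * D" "digit d n x k * D + snd u < d * D" "snd v < d * D"
      using that x by (auto simp: mem_Times_iff digit_index column_index)
    then show "F k u v \<in> borel_measurable \<mu>"
      unfolding F_def using measurable_compose[OF entry_measurable cnj_measurable] by (intro borel_measurable_times entry_measurable) auto
    show "AE V in \<mu>. cmod (F k u v V) \<le> 1"
      using ix unitary_group_entry_bound by (intro AE_I2) (auto simp: F_def norm_mult space_haar intro!: mult_le_one)
  qed
  show "integrable P (\<lambda>U. rmps d n D U $ x * cnj (rmps d n D U $ x))"
    unfolding eq using int by (intro integral_cyc(1)) auto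
  have "(LINT U|P. rmps d n D U $ x * cnj (rmps d n D U $ x)) = cyc n ?I (\<lambda>k u v. LINT V|\<mu>. F k u v V)"
    unfolding eq using int by (intro integral_cyc(2)) auto
  also have "\<dots> = cyc n ?I (\<lambda>k u v. \<Sum>s\<in>{()}. 1 * (kdelta (fst u) (snd u) * (kdelta (fst v) (snd v) / of_nat (d * D))))"
  proof (rule cyc_cong)
    fix k u v assume kuv: "k < n" "u \<in> ?I" "v \<in> ?I"
    then have "(LINT V|\<mu>. F k u v V) =
        kdelta (digit d n x k * D + fst u) (digit d n x k * D + snd u) * kdelta (fst v) (snd v) / of_nat (d * D)"
      unfolding F_def using x by (intro first_moment dim site_index column_index digit_less) auto
    then show "(LINT V|\<mu>. F k u v V) = (\<Sum>s\<in>{()}. 1 * (kdelta (fst u) (snd u) * (kdelta (fst v) (snd v) / of_nat (d * D))))"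
      using kuv by (auto simp: kdelta_site)
  qed
  also have "\<dots> = cyc n {()} (\<lambda>k s s'. 1 * (\<Sum>v\<in>?I. kdelta (fst v) (snd v) / of_nat (d * D) * kdelta (fst v) (snd v)))"
    by (rule cyc_factor) auto
  also have "(\<Sum>v\<in>?I. kdelta (fst v) (snd v) / of_nat (d * D) * kdelta (fst v) (snd v)) = (\<Sum>a<D. \<Sum>b<D. kdelta a b / of_nat (d * D))"
    by (simp add: sum.cartesian_product case_prod_unfold)
  also have "\<dots> = 1 / of_nat d"
    using dD by (simp add: sum_divide_distrib[symmetric] sum_kdelta)
  also have "cyc n {()} (\<lambda>k s s'. 1 * (1 / of_nat d :: complex)) = 1 / of_nat d ^ n"
    by (simp add: cyc_def card_PiE power_one_over)
  finally show "(LINT U|P. rmps d n D U $ x * cnj (rmps d n D U $ x)) = 1 / of_nat d ^ n" .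
qed

section \<open>Transfer matrices of the two-state chain\<close>

lemma bond_weight_nonneg: "0 \<le> bond_weight d D s s'"
proof -
  have "real D / real d \<le> real D" "1 / real d \<le> 1" "1 \<le> (real D)\<^sup>2"
    using dD by (simp_all add: divide_le_eq)
  then show ?thesis using dim_sq by (auto simp: bond_weight_def intro!: divide_nonneg_pos)
qed

text \<open>This is the row sum of \<open>bond_weight\<close>, its eigenvalue at
  \<open>(1, 1)\<close> and, by nonnegativity, the one of largest modulus. A factor
  \<open>d D - 1\<close> cancels.\<close>

lemma bond_weight_sum:
  "bond_weight d D False False + bond_weight d D False True = (real D + 1) / (real d * (real d * real D + 1))"
proof -
  define x y where "x = real d" and "y = real D"
  have x: "x \<noteq> 0" using dD by (simp add: x_def)
  have X: "(x * y)\<^sup>2 - 1 = (x * y - 1) * (x * y + 1)" by (simp add: power2_eq_square algebra_simps)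
  then have nz: "x * y - 1 \<noteq> 0" using dim_sq by (auto simp: x_def y_def)
  have "bond_weight d D False False + bond_weight d D False True = (y\<^sup>2 - 1 / x + (y - y / x)) / ((x * y)\<^sup>2 - 1)"
    by (simp add: bond_weight_def add_divide_distrib x_def y_def)
  also have "y\<^sup>2 - 1 / x + (y - y / x) = (x * y - 1) * ((y + 1) / x)"
    using x by (simp add: field_simps power2_eq_square)
  finally show ?thesis unfolding X using nz by (simp add: x_def y_def)
qed

text \<open>The eigenvectors of the symmetric matrix \<open>bond_weight\<close> are \<open>(1, 1)\<close> and \<open>(1, -1)\<close>.\<close>

lemma cyc_bond_weight_le:
  "cyc n UNIV (\<lambda>k. bond_weight d D) \<le> 2 * ((real D + 1) / (real d * (real d * real D + 1))) ^ n"
proof -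
  define a b where "a = bond_weight d D False False" and "b = bond_weight d D False True"
  \<comment> \<open>\<open>e\<close> labels the eigenvectors \<open>f e\<close>, with eigenvalues
    \<open>l e\<close>. Their squared norm is 2, whence the factor \<open>l e / 2\<close> in the
    decomposition.\<close>
  define l where "l e = (if e then a - b else a + b)" for e
  define f where "f e s = (if e \<and> s then -1 else 1 :: real)" for e s
  have ab: "0 \<le> a" "0 \<le> b" by (simp_all add: a_def b_def bond_weight_nonneg)
  have bw: "bond_weight d D s s' = (if s = s' then a else b)" for s s'
    by (simp add: a_def b_def bond_weight_def)
  have "cyc n UNIV (\<lambda>k. bond_weight d D) = cyc n UNIV (\<lambda>k s s'. \<Sum>e\<in>UNIV. 1 * (f e s * (l e / 2 * f e s')))"
  proof (rule cyc_cong)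
    fix k s s' show "bond_weight d D s s' = (\<Sum>e\<in>UNIV. 1 * (f e s * (l e / 2 * f e s')))"
      by (cases s; cases s') (simp_all add: UNIV_bool f_def l_def bw field_simps)
  qed
  also have "\<dots> = cyc n UNIV (\<lambda>k e e'. 1 * (\<Sum>s\<in>UNIV. l e / 2 * f e s * f e' s))"
    by (rule cyc_factor) auto
  also have "\<dots> = cyc n UNIV (\<lambda>k e e'. if e = e' then l e else 0)"
    by (rule cyc_cong) (auto simp: UNIV_bool f_def)
  also have "\<dots> = (a + b) ^ n + (a - b) ^ n"
    using n by (simp add: cyc_diagonal UNIV_bool l_def)
  also have "(a - b) ^ n \<le> (a + b) ^ n"
  proof -
    have "(a - b) ^ n \<le> \<bar>a - b\<bar> ^ n" by (metis abs_ge_self power_abs)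
    also have "\<dots> \<le> (a + b) ^ n" using ab by (intro power_mono) auto
    finally show ?thesis .
  qed
  finally show ?thesis by (simp add: a_def b_def bond_weight_sum)
qed

text \<open>With \<open>q = d D\<close>, the weighted matrix has right eigenvectors \<open>(q, 1)\<close>, \<open>(1, - D)\<close> and left
  eigenvectors \<open>(D, 1)\<close>, \<open>(1, - q)\<close>.\<close>

lemma cyc_weighted_bond_weight:
  "cyc n UNIV (\<lambda>k s s'. (if s then real d else (real d)\<^sup>2) * bond_weight d D s s') =
    1 + (real d * ((real D)\<^sup>2 - 1) / ((real d * real D)\<^sup>2 - 1)) ^ n"
proof -
  \<comment> \<open>\<open>K\<close> is the product of a left eigenvector with its right partner,
    the same number for both pairs, so \<open>m\<close> is eigenvalue over normalisation. The
    eigenvalues are 1, which reflects the mean norm 1, and \<open>lam\<close>, whose power will be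
    the variance.\<close>
  define x y q X K where "x = real d" and "y = real D" and "q = x * y" and "X = q\<^sup>2 - 1" and "K = 1 + q * y"
  define lam where "lam = x * (y\<^sup>2 - 1) / X"
  define m where "m e = (if e then lam else 1) / K" for e
  define f where "f e s = (if e then (if s then - y else 1) else (if s then 1 else q))" for e s
  define g where "g e s = (if e then (if s then - q else 1) else (if s then 1 else y)) * m e" for e s
  define t where "t s s' = (if s then x else x\<^sup>2) * bond_weight d D s s'" for s s'
  have X: "X \<noteq> 0" and x: "x \<noteq> 0"
    using dim_sq dD by (auto simp: X_def q_def x_def y_def)
  have "0 \<le> q * y" by (simp add: q_def x_def y_def)
  then have K: "K \<noteq> 0" by (simp add: K_def)
  have tX: "t s s' * X = (if s then x else x\<^sup>2) * (if s = s' then y\<^sup>2 - 1 / x else y - y / x)" for s s'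
    using X by (simp add: t_def bond_weight_def X_def q_def x_def y_def)
  \<comment> \<open>Clearing the denominators \<open>X\<close> and \<open>K\<close> reduces the
    spectral decomposition to a polynomial identity, checked for each of the four pairs of
    labels.\<close>
  have lift: "u = a * (1 / K) + b * (lam / K)" if "u * X * K = a * X + b * (x * (y\<^sup>2 - 1))" for u a b
  proof -
    have "lam * X = x * (y\<^sup>2 - 1)" using X by (simp add: lam_def)
    then have "u * X * K = a * X + b * (lam * X)" using that by (simp only:)
    then have "(u * K) * X = (a + b * lam) * X" by (simp add: algebra_simps)
    then have "u * K = a + b * lam" using X by simp
    then have "u = (a + b * lam) / K" using K by (simp add: eq_divide_eq)
    then show ?thesis by (simp add: add_divide_distrib)
  qed
  have w: "t s s' = (\<Sum>e\<in>UNIV. 1 * (f e s * g e s'))" for s s'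
  proof -
    define a b where "a = (if s then 1 else q) * (if s' then 1 else y)"
      and "b = (if s then - y else 1) * (if s' then - q else 1)"
    have "t s s' * X * K = a * X + b * (x * (y\<^sup>2 - 1))"
      unfolding tX using x
      by (cases s; cases s') (simp_all add: a_def b_def X_def K_def q_def field_simps power2_eq_square)
    from lift[OF this] show ?thesis
      by (simp add: UNIV_bool f_def g_def m_def a_def b_def mult.assoc)
  qed
  have "cyc n UNIV (\<lambda>k s s'. t s s') = cyc n UNIV (\<lambda>k s s'. \<Sum>e\<in>UNIV. 1 * (f e s * g e s'))"
    by (simp only: w)
  also have "\<dots> = cyc n UNIV (\<lambda>k e e'. 1 * (\<Sum>s\<in>UNIV. g e s * f e' s))"
    by (rule cyc_factor) auto
  also have "\<dots> = cyc n UNIV (\<lambda>k e e'. if e = e' then (if e then lam else 1) else 0)"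
  proof (rule cyc_cong)
    fix k e e'
    show "1 * (\<Sum>s\<in>UNIV. g e s * f e' s) = (if e = e' then (if e then lam else 1) else 0)"
    proof (cases "e = e'")
      case True
      then have "(\<Sum>s\<in>UNIV. g e s * f e' s) = m e * K"
        by (cases e) (simp_all add: UNIV_bool f_def g_def K_def algebra_simps)
      then show ?thesis using True K by (simp add: m_def)
    qed (cases e, auto simp: UNIV_bool f_def g_def)
  qed
  also have "\<dots> = 1 + lam ^ n"
    using n by (simp add: cyc_diagonal UNIV_bool)
  finally show ?thesis unfolding t_def lam_def X_def q_def x_def y_def .
qed

end

section \<open>Fourth moment of an amplitude and variance of the norm\<close>

lemma prod_of_bool: "finite A \<Longrightarrow> (\<Prod>k\<in>A. of_bool (Q k)) = (of_bool (\<forall>k\<in>A. Q k) :: 'a::comm_semiring_1)"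
  by (induction A rule: finite_induct) auto

text \<open>A partial permutation matrix has norm at most 1. Concretely, the product of two moduli
  is at most half the sum of their squares, and each point has at most one partner on either side,
  so every half square is used at most twice.\<close>

lemma partial_bijection_form_bound:
  fixes f :: "'z \<Rightarrow> complex"
  assumes Z: "finite Z"
    and functional: "\<And>z z1 z2. z \<in> Z \<Longrightarrow> z1 \<in> Z \<Longrightarrow> z2 \<in> Z \<Longrightarrow> R z z1 \<Longrightarrow> R z z2 \<Longrightarrow> z1 = z2"
    and injective: "\<And>z z1 z2. z \<in> Z \<Longrightarrow> z1 \<in> Z \<Longrightarrow> z2 \<in> Z \<Longrightarrow> R z1 z \<Longrightarrow> R z2 z \<Longrightarrow> z1 = z2"
  shows "cmod (\<Sum>z\<in>Z. \<Sum>z'\<in>Z. cnj (f z) * f z' * of_bool (R z z')) \<le> (\<Sum>z\<in>Z. (cmod (f z))\<^sup>2)"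
proof -
  have one: "(\<Sum>z'\<in>Z. of_bool (Q z')) \<le> (1 :: real)" if "\<And>z1 z2. z1 \<in> Z \<Longrightarrow> z2 \<in> Z \<Longrightarrow> Q z1 \<Longrightarrow> Q z2 \<Longrightarrow> z1 = z2" for Q
  proof -
    have "card (Z \<inter> {z. Q z}) \<le> Suc 0" using that Z by (intro card_le_Suc0_iff_eq[THEN iffD2]) auto
    then have "real (card (Z \<inter> {z. Q z})) \<le> 1" by linarith
    then show ?thesis using Z by (simp add: sum_of_bool_eq)
  qed
  have "cmod (\<Sum>z\<in>Z. \<Sum>z'\<in>Z. cnj (f z) * f z' * of_bool (R z z')) \<le>
      (\<Sum>z\<in>Z. \<Sum>z'\<in>Z. cmod (f z) * cmod (f z') * of_bool (R z z'))"
    by (intro order.trans[OF norm_sum] sum_mono) (simp_all add: norm_mult)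
  also have "\<dots> \<le> (\<Sum>z\<in>Z. \<Sum>z'\<in>Z. (cmod (f z))\<^sup>2 / 2 * of_bool (R z z') + (cmod (f z'))\<^sup>2 / 2 * of_bool (R z z'))"
  proof (intro sum_mono)
    fix z z'
    have "cmod (f z) * cmod (f z') \<le> (cmod (f z))\<^sup>2 / 2 + (cmod (f z'))\<^sup>2 / 2"
      using sum_squares_bound[of "cmod (f z)" "cmod (f z')"] by simp
    then show "cmod (f z) * cmod (f z') * of_bool (R z z') \<le>
        (cmod (f z))\<^sup>2 / 2 * of_bool (R z z') + (cmod (f z'))\<^sup>2 / 2 * of_bool (R z z')"
      by (simp add: of_bool_def)
  qed
  also have "\<dots> = (\<Sum>z\<in>Z. (cmod (f z))\<^sup>2 / 2 * (\<Sum>z'\<in>Z. of_bool (R z z'))) +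
      (\<Sum>z'\<in>Z. (cmod (f z'))\<^sup>2 / 2 * (\<Sum>z\<in>Z. of_bool (R z z')))"
    by (simp only: sum.distrib sum_distrib_left) (subst (2) sum.swap, rule refl)
  also have "\<dots> \<le> (\<Sum>z\<in>Z. (cmod (f z))\<^sup>2 / 2 * 1) + (\<Sum>z'\<in>Z. (cmod (f z'))\<^sup>2 / 2 * 1)"
    using functional injective by (intro add_mono sum_mono mult_left_mono one) auto
  also have "\<dots> = (\<Sum>z\<in>Z. (cmod (f z))\<^sup>2)" by (simp add: sum.distrib[symmetric])
  finally show ?thesis .
qed

lemma pairing_of_bool:
  "pairing s a b a' b' = of_bool (if s then a = b' \<and> b = a' else a = a' \<and> b = b')"
  by (cases s) (auto simp: pairing_def kdelta_def)

context random_mps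
begin

abbreviation pairs where "pairs \<equiv> {..<d ^ n} \<times> {..<d ^ n}"

text \<open>For a fixed pattern, \<open>z\<close> is related to the pair obtained from it by
  exchanging the digits of the two components at the sites with \<open>s k\<close>. Digits determine
  their number, so the relation is functional in both directions; the form is then bounded by the
  squared norm of \<open>v \<otimes> v\<close>.\<close>

lemma pairing_digits_bound:
  assumes "(\<Sum>x<d ^ n. (cmod (v x))\<^sup>2) = 1"
  shows "cmod (\<Sum>z\<in>pairs. \<Sum>z'\<in>pairs. cnj (v (fst z) * v (snd z)) * (v (fst z') * v (snd z')) *
      (\<Prod>k<n. pairing (s k) (digit d n (fst z) k) (digit d n (snd z) k) (digit d n (fst z') k) (digit d n (snd z') k))) \<le> 1"
proof -
  define R where "R z z' \<longleftrightarrow> (\<forall>k\<in>{..<n}. if s k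
      then digit d n (fst z) k = digit d n (snd z') k \<and> digit d n (snd z) k = digit d n (fst z') k
      else digit d n (fst z) k = digit d n (fst z') k \<and> digit d n (snd z) k = digit d n (snd z') k)" for z z'
  have R: "(\<Prod>k<n. pairing (s k) (digit d n (fst z) k) (digit d n (snd z) k) (digit d n (fst z') k) (digit d n (snd z') k)) =
      of_bool (R z z')" for z z'
    unfolding R_def pairing_of_bool prod_of_bool[OF finite_lessThan] ..
  have "cmod (\<Sum>z\<in>pairs. \<Sum>z'\<in>pairs. cnj (v (fst z) * v (snd z)) * (v (fst z') * v (snd z')) * of_bool (R z z')) \<le>
      (\<Sum>z\<in>pairs. (cmod (v (fst z) * v (snd z)))\<^sup>2)"
  proof (rule partial_bijection_form_bound)
    fix z z1 z2 assume z: "z1 \<in> pairs" "z2 \<in> pairs" and R: "R z z1" "R z z2"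
    have "digit d n (fst z1) k = digit d n (fst z2) k \<and> digit d n (snd z1) k = digit d n (snd z2) k" if "k < n" for k
      using R that unfolding R_def by (metis lessThan_iff)
    then have "fst z1 = fst z2" "snd z1 = snd z2" using z by (auto intro: digit_inject[of _ d n])
    then show "z1 = z2" by (rule prod_eqI)
  next
    fix z z1 z2 assume z: "z1 \<in> pairs" "z2 \<in> pairs" and R: "R z1 z" "R z2 z"
    have "digit d n (fst z1) k = digit d n (fst z2) k \<and> digit d n (snd z1) k = digit d n (snd z2) k" if "k < n" for k
      using R that unfolding R_def by (metis lessThan_iff)
    then have "fst z1 = fst z2" "snd z1 = snd z2" using z by (auto intro: digit_inject[of _ d n])
    then show "z1 = z2" by (rule prod_eqI)
  qed simp
  also have "\<dots> = (\<Sum>x<d ^ n. (cmod (v x))\<^sup>2) * (\<Sum>y<d ^ n. (cmod (v y))\<^sup>2)"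
    by (simp add: sum_product sum.cartesian_product norm_mult power_mult_distrib case_prod_unfold)
  finally show ?thesis by (simp add: R assms)
qed

text \<open>The fourth power is a form in pairs of basis states. Its average is sorted by patterns
  before any modulus is taken: each pattern contributes at most its weight, and the weights add up
  to the partition function.\<close>

lemma fourth_moment_le:
  assumes v: "(\<Sum>x<d ^ n. (cmod (v x))\<^sup>2) = 1"
  shows "integrable P (\<lambda>U. cmod (\<Sum>x<d ^ n. rmps d n D U $ x * cnj (v x)) ^ 4)"
    "(LINT U|P. cmod (\<Sum>x<d ^ n. rmps d n D U $ x * cnj (v x)) ^ 4)
      \<le> 2 * ((real D + 1) / (real d * (real d * real D + 1))) ^ n"
proof -
  define c where "c U = (\<Sum>x<d ^ n. rmps d n D U $ x * cnj (v x))" for U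
  define h where "h z z' = cnj (v (fst z) * v (snd z)) * (v (fst z') * v (snd z'))" for z z'
  define G where "G z z' U = h z z' * fourfold (fst z) (snd z) (fst z') (snd z') U" for z z' U
  define W where "W s = (\<Prod>k<n. bond_weight d D (s k) (s (Suc k mod n)))" for s
  define S where "S = {..<n} \<rightarrow>\<^sub>E (UNIV :: bool set)"
  define p where "p s z z' = (\<Prod>k<n. pairing (s k) (digit d n (fst z) k) (digit d n (snd z) k)
      (digit d n (fst z') k) (digit d n (snd z') k))" for s z z'
  have W0: "0 \<le> W s" for s unfolding W_def by (intro prod_nonneg) (simp add: bond_weight_nonneg)
  have c4: "complex_of_real (cmod (c U) ^ 4) = (\<Sum>z\<in>pairs. \<Sum>z'\<in>pairs. G z z' U)" for U
  proof -
    have cc: "c U * c U = (\<Sum>z\<in>pairs. (rmps d n D U $ fst z * cnj (v (fst z))) * (rmps d n D U $ snd z * cnj (v (snd z))))"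
      unfolding c_def by (simp add: sum_product sum.cartesian_product case_prod_unfold)
    have "complex_of_real (cmod (c U) ^ 4) = complex_of_real ((cmod (c U))\<^sup>2) * complex_of_real ((cmod (c U))\<^sup>2)"
      by (simp flip: of_real_mult power_add)
    also have "\<dots> = (c U * c U) * cnj (c U * c U)"
      unfolding complex_norm_square by (simp add: mult_ac)
    also have "\<dots> = (\<Sum>z\<in>pairs. \<Sum>z'\<in>pairs. G z z' U)"
      unfolding cc cnj_sum sum_product G_def h_def fourfold_def by (intro sum.cong refl) (simp add: mult_ac)
    finally show ?thesis .
  qed
  have int: "integrable P (G z z')" if "z \<in> pairs" "z' \<in> pairs" for z z'
    unfolding G_def using that by (intro integrable_mult_right fourfold_moment) (auto simp: mem_Times_iff)
  have intc: "integrable P (\<lambda>U. complex_of_real (cmod (c U) ^ 4))"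
    unfolding c4 using int by (intro Bochner_Integration.integrable_sum)
  from integrable_Re[OF this] show "integrable P (\<lambda>U. cmod (\<Sum>x<d ^ n. rmps d n D U $ x * cnj (v x)) ^ 4)"
    by (simp add: c_def del: of_real_power)
  have "complex_of_real (LINT U|P. cmod (c U) ^ 4) = (LINT U|P. (\<Sum>z\<in>pairs. \<Sum>z'\<in>pairs. G z z' U))"
    unfolding c4[symmetric] by (rule integral_complex_of_real[symmetric])
  also have "\<dots> = (\<Sum>z\<in>pairs. \<Sum>z'\<in>pairs. LINT U|P. G z z' U)"
    using int by (rule integral_double_sum)
  also have "\<dots> = (\<Sum>z\<in>pairs. \<Sum>z'\<in>pairs. \<Sum>s\<in>S. of_real (W s) * (h z z' * p s z z'))"
  proof (intro sum.cong refl)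
    fix z z' assume z: "z \<in> pairs" "z' \<in> pairs"
    then have "(LINT U|P. G z z' U) = h z z' * (LINT U|P. fourfold (fst z) (snd z) (fst z') (snd z') U)"
      unfolding G_def by simp
    also have "\<dots> = h z z' * (\<Sum>s\<in>S. p s z z' * of_real (W s))"
      using z by (subst fourfold_moment(2)) (auto simp: mem_Times_iff cyc_def S_def p_def W_def prod.distrib)
    finally show "(LINT U|P. G z z' U) = (\<Sum>s\<in>S. of_real (W s) * (h z z' * p s z z'))"
      by (simp add: sum_distrib_left mult_ac)
  qed
  also have "\<dots> = (\<Sum>s\<in>S. of_real (W s) * (\<Sum>z\<in>pairs. \<Sum>z'\<in>pairs. h z z' * p s z z'))"
  proof -
    have "(\<Sum>z\<in>pairs. \<Sum>z'\<in>pairs. \<Sum>s\<in>S. of_real (W s) * (h z z' * p s z z')) =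
        (\<Sum>z\<in>pairs. \<Sum>s\<in>S. \<Sum>z'\<in>pairs. of_real (W s) * (h z z' * p s z z'))"
      by (intro sum.cong refl sum.swap)
    also have "\<dots> = (\<Sum>s\<in>S. \<Sum>z\<in>pairs. \<Sum>z'\<in>pairs. of_real (W s) * (h z z' * p s z z'))"
      by (rule sum.swap)
    finally show ?thesis by (simp only: sum_distrib_left)
  qed
  finally have "complex_of_real (LINT U|P. cmod (c U) ^ 4) =
    (\<Sum>s\<in>S. of_real (W s) * (\<Sum>z\<in>pairs. \<Sum>z'\<in>pairs. h z z' * p s z z'))" .
  from arg_cong[OF this, of Re]
  have "(LINT U|P. cmod (c U) ^ 4) \<le> cmod (\<Sum>s\<in>S. of_real (W s) * (\<Sum>z\<in>pairs. \<Sum>z'\<in>pairs. h z z' * p s z z'))"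
    by (simp only: Re_complex_of_real complex_Re_le_cmod)
  also have "\<dots> \<le> (\<Sum>s\<in>S. W s * cmod (\<Sum>z\<in>pairs. \<Sum>z'\<in>pairs. h z z' * p s z z'))"
    using W0 by (intro order.trans[OF norm_sum] sum_mono) (simp add: norm_mult)
  also have "\<dots> \<le> (\<Sum>s\<in>S. W s * 1)"
    using W0 unfolding h_def p_def by (intro sum_mono mult_left_mono pairing_digits_bound[OF v])
  also have "\<dots> = cyc n UNIV (\<lambda>k. bond_weight d D)"
    by (simp add: cyc_def S_def W_def)
  also have "\<dots> \<le> 2 * ((real D + 1) / (real d * (real d * real D + 1))) ^ n"
    by (rule cyc_bond_weight_le)
  finally show "(LINT U|P. cmod (\<Sum>x<d ^ n. rmps d n D U $ x * cnj (v x)) ^ 4)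
      \<le> 2 * ((real D + 1) / (real d * (real d * real D + 1))) ^ n"
    by (simp add: c_def)
qed

text \<open>The mean of the squared norm is 1, and its second moment is the chain of
  \<open>cyc_weighted_bond_weight\<close>; the eigenvalue 1 there cancels against the square of the
  mean.\<close>

lemma norm_variance:
  shows "integrable P (\<lambda>U. ((\<Sum>x<d ^ n. (cmod (rmps d n D U $ x))\<^sup>2) - 1)\<^sup>2)"
    "(LINT U|P. ((\<Sum>x<d ^ n. (cmod (rmps d n D U $ x))\<^sup>2) - 1)\<^sup>2) =
      (real d * ((real D)\<^sup>2 - 1) / ((real d * real D)\<^sup>2 - 1)) ^ n"
proof -
  interpret P: prob_space P by (rule prob_space_P)
  define N where "N U = (\<Sum>x<d ^ n. (cmod (rmps d n D U $ x))\<^sup>2)" for U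
  define F where "F U = (\<Sum>x<d ^ n. \<Sum>y<d ^ n. fourfold x y x y U)" for U
  define T where "T U = (\<Sum>x<d ^ n. rmps d n D U $ x * cnj (rmps d n D U $ x))" for U
  define w where "w s = (if s then real d else (real d)\<^sup>2)" for s
  have N: "complex_of_real (N U) = T U" for U
    by (simp add: N_def T_def complex_norm_square del: of_real_power)
  have T2: "T U * T U = F U" for U
    unfolding T_def F_def sum_product fourfold_def by (intro sum.cong refl) (simp add: mult_ac)
  have eq: "complex_of_real ((N U - 1)\<^sup>2) = F U - 2 * T U + 1" for U
    by (simp add: N T2[symmetric] power2_eq_square algebra_simps)
  have intF: "integrable P F"
    unfolding F_def by (intro Bochner_Integration.integrable_sum fourfold_moment) auto
  have intT: "integrable P T"
    unfolding T_def by (intro Bochner_Integration.integrable_sum twofold_moment) auto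
  have "integrable P (\<lambda>U. F U - 2 * T U + 1)"
    using intF intT by (intro Bochner_Integration.integrable_add Bochner_Integration.integrable_diff integrable_mult_right) auto
  then have "integrable P (\<lambda>U. complex_of_real ((N U - 1)\<^sup>2))" by (simp only: eq)
  from integrable_Re[OF this] show "integrable P (\<lambda>U. ((\<Sum>x<d ^ n. (cmod (rmps d n D U $ x))\<^sup>2) - 1)\<^sup>2)"
    by (simp add: N_def del: of_real_power)
  have ET: "(LINT U|P. T U) = 1"
  proof -
    have "(LINT U|P. T U) = (\<Sum>x<d ^ n. LINT U|P. rmps d n D U $ x * cnj (rmps d n D U $ x))"
      unfolding T_def by (intro Bochner_Integration.integral_sum twofold_moment) auto
    also have "\<dots> = 1" using dD by (simp add: twofold_moment)
    finally show ?thesis .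
  qed
  \<comment> \<open>Summing out the physical labels of a site gives the trace of the identity,
    \<open>d\<^sup>2\<close>, or of the swap, \<open>d\<close>.\<close>
  have trace: "(\<Sum>i<d. \<Sum>j<d. pairing s i j i j) = of_real (w s)" for s
    by (cases s) (simp_all add: pairing_def w_def sum_kdelta power2_eq_square)
  have EF: "(LINT U|P. F U) = of_real (1 + (real d * ((real D)\<^sup>2 - 1) / ((real d * real D)\<^sup>2 - 1)) ^ n)"
  proof -
    let ?W = "\<lambda>s. \<Prod>k<n. bond_weight d D (s k) (s (Suc k mod n))"
    let ?p = "\<lambda>s x y. \<Prod>k<n. pairing (s k) (digit d n x k) (digit d n y k) (digit d n x k) (digit d n y k)"
    let ?S = "{..<n} \<rightarrow>\<^sub>E (UNIV :: bool set)"
    have "(LINT U|P. F U) = (\<Sum>x<d ^ n. \<Sum>y<d ^ n. LINT U|P. fourfold x y x y U)"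
      unfolding F_def by (intro integral_double_sum fourfold_moment) auto
    also have "\<dots> = (\<Sum>x<d ^ n. \<Sum>y<d ^ n. \<Sum>s\<in>?S. of_real (?W s) * ?p s x y)"
      by (intro sum.cong refl) (simp add: fourfold_moment(2) cyc_def prod.distrib mult.commute)
    also have "\<dots> = (\<Sum>x<d ^ n. \<Sum>s\<in>?S. \<Sum>y<d ^ n. of_real (?W s) * ?p s x y)"
      by (intro sum.cong refl sum.swap)
    also have "\<dots> = (\<Sum>s\<in>?S. \<Sum>x<d ^ n. \<Sum>y<d ^ n. of_real (?W s) * ?p s x y)"
      by (rule sum.swap)
    also have "\<dots> = (\<Sum>s\<in>?S. of_real (?W s) * (\<Prod>k<n. \<Sum>i<d. \<Sum>j<d. pairing (s k) i j i j))"
      by (simp only: sum_distrib_left[symmetric] sum_digits_pair[of "\<lambda>k i j. pairing (_ k) i j i j"])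
    also have "\<dots> = of_real (cyc n UNIV (\<lambda>k s s'. w s * bond_weight d D s s'))"
      by (simp add: trace cyc_def prod.distrib mult.commute)
    also have "cyc n UNIV (\<lambda>k s s'. w s * bond_weight d D s s') =
        1 + (real d * ((real D)\<^sup>2 - 1) / ((real d * real D)\<^sup>2 - 1)) ^ n"
      unfolding w_def by (rule cyc_weighted_bond_weight)
    finally show ?thesis .
  qed
  have "complex_of_real (LINT U|P. (N U - 1)\<^sup>2) = (LINT U|P. F U - 2 * T U + 1)"
    unfolding eq[symmetric] by (rule integral_complex_of_real[symmetric])
  also have "\<dots> = (LINT U|P. F U) - 2 * (LINT U|P. T U) + 1"
    using intF intT by (simp add: P.prob_space)
  also have "\<dots> = of_real ((real d * ((real D)\<^sup>2 - 1) / ((real d * real D)\<^sup>2 - 1)) ^ n)"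
    by (simp add: ET EF)
  finally show "(LINT U|P. ((\<Sum>x<d ^ n. (cmod (rmps d n D U $ x))\<^sup>2) - 1)\<^sup>2) =
      (real d * ((real D)\<^sup>2 - 1) / ((real d * real D)\<^sup>2 - 1)) ^ n"
    unfolding N_def of_real_eq_iff .
qed

lemma rmps_entry_measurable:
  assumes x: "x < d ^ n"
  shows "(\<lambda>U. rmps d n D U $ x) \<in> borel_measurable P"
proof -
  have "integrable \<mu> (\<lambda>V. V $$ (digit d n x k * D + a, b))" if "k < n" "a < D" "b < D" for k a b
  proof (rule integrable_const_bound[where B = 1])
    have ix: "digit d n x k * D + a < d * D" "b < d * D"
      using that x by (simp_all add: digit_index column_index)
    then show "(\<lambda>V. V $$ (digit d n x k * D + a, b)) \<in> borel_measurable \<mu>" by (rule entry_measurable)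
    show "AE V in \<mu>. cmod (V $$ (digit d n x k * D + a, b)) \<le> 1"
      using ix unitary_group_entry_bound by (intro AE_I2) (simp add: space_haar)
  qed
  then have "integrable P (\<lambda>U. cyc n {..<D} (\<lambda>k a b. U k $$ (digit d n x k * D + a, b)))"
    by (intro integral_cyc(1)[where F = "\<lambda>k a b V. V $$ (digit d n x k * D + a, b)"]) auto
  then show ?thesis unfolding rmps_entry[OF x] by (rule borel_measurable_integrable)
qed

lemma rmps_measurable: "rmps d n D \<in> measurable P (vec_borel (d ^ n))"
  unfolding vec_borel_def
proof (rule measurable_vimage_algebra2)
  show "rmps d n D \<in> space P \<rightarrow> carrier_vec (d ^ n)" by (simp add: rmps_def)
  show "(\<lambda>U. \<lambda>i\<in>{..<d ^ n}. rmps d n D U $ i) \<in> measurable P (\<Pi>\<^sub>M i\<in>{..<d ^ n}. borel)"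
    by (intro measurable_restrict rmps_entry_measurable) simp
qed

end

section \<open>Concentration\<close>

lemma op_norm_nonneg:
  assumes A: "A \<in> carrier_mat N N" and N: "0 < N"
  shows "0 \<le> op_norm A"
proof -
  have "vec_nrm (unit_vec N 0 :: complex vec) = 1"
    using N by (simp add: vec_nrm_def)
  then have "vec_nrm (A *\<^sub>v unit_vec N 0) \<le> op_norm A"
    by (intro vec_nrm_op_norm[OF A]) simp_all
  moreover have "0 \<le> vec_nrm (A *\<^sub>v unit_vec N 0)"
    by (simp add: vec_nrm_def cscalar_prod_self sum_nonneg)
  ultimately show ?thesis by simp
qed

lemma space_vec_borel: "space (vec_borel N) = carrier_vec N"
  by (simp add: vec_borel_def)

lemma vec_component_measurable:
  assumes "i < N"
  shows "(\<lambda>v. v $ i) \<in> borel_measurable (vec_borel N)"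
proof -
  have "(\<lambda>v. \<lambda>i\<in>{..<N}. v $ i) \<in> measurable (vec_borel N) (\<Pi>\<^sub>M i\<in>{..<N}. (borel :: complex measure))"
    unfolding vec_borel_def by (rule measurable_vimage_algebra1) (auto simp: space_PiM)
  then have "(\<lambda>v. (\<lambda>i\<in>{..<N}. v $ i) i) \<in> borel_measurable (vec_borel N)"
    by (rule measurable_component_singleton'[OF _ _ ]) (use assms in auto)
  then show ?thesis using assms by simp
qed

lemma vec_nrm_measurable: "vec_nrm \<in> borel_measurable (vec_borel N)"
proof -
  have "(\<lambda>v. sqrt (\<Sum>i<N. (cmod (v $ i))\<^sup>2)) \<in> borel_measurable (vec_borel N)"
    by (intro measurable_compose[OF _ borel_measurable_sqrt] borel_measurable_sum borel_measurable_power
        measurable_compose[OF _ borel_measurable_norm] vec_component_measurable) simp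
  moreover have "vec_nrm v = sqrt (\<Sum>i<N. (cmod (v $ i))\<^sup>2)" if "v \<in> space (vec_borel N)" for v
    using that by (auto simp: vec_nrm_def cscalar_prod_self space_vec_borel)
  ultimately show ?thesis by (simp cong: measurable_cong)
qed

context onb
begin

lemma amplitude_measurable: "(\<lambda>v. amplitude v j) \<in> borel_measurable (vec_borel N)"
  unfolding amplitude_def
  by (intro borel_measurable_sum borel_measurable_times borel_measurable_const vec_component_measurable) simp

lemma amplitude_normalized:
  assumes "v \<in> carrier_vec N"
  shows "cmod (amplitude (normalized v) j) = cmod (amplitude v j) / vec_nrm v"
proof -
  have "amplitude (normalized v) j = of_real (1 / vec_nrm v) * amplitude v j"
    using assms unfolding amplitude_def normalized_def sum_distrib_left
    by (intro sum.cong) auto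
  moreover have "0 \<le> vec_nrm v" by (simp add: vec_nrm_def cscalar_prod_self sum_nonneg)
  ultimately show ?thesis by (simp add: norm_mult norm_divide)
qed

end

text \<open>Measurability is proved here because the fluctuation is defined by limits, and its
  explicit formula shows it to be a measurable function of the state. At the zero vector division by
  0 yields 0, and both sides of the bound vanish.\<close>

lemma fluctuation_normalized:
  assumes H: "hermitian_mat N H" and g: "nondegenerate_gaps H" and A: "hermitian_mat N A"
  obtains \<phi> where "onb N \<phi>"
    "(\<lambda>\<psi>. fluctuation H A (normalized \<psi>)) \<in> borel_measurable (vec_borel N)"
    "\<And>\<psi>. \<psi> \<in> carrier_vec N \<Longrightarrow> fluctuation H A (normalized \<psi>) \<le>
      (op_norm A)\<^sup>2 * (\<Sum>j<N. cmod (onb.amplitude N \<phi> \<psi> j) ^ 4) / (\<Sum>x<N. (cmod (\<psi> $ x))\<^sup>2)\<^sup>2"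
proof -
  obtain \<phi> E where sr: "spectral_resolution N \<phi> H E" and
    gap: "\<And>a b j k. a < N \<Longrightarrow> b < N \<Longrightarrow> j < N \<Longrightarrow> k < N \<Longrightarrow> a \<noteq> b \<Longrightarrow> E a - E b = E j - E k \<Longrightarrow> a = j \<and> b = k"
    using hermitian_spectral_resolution[OF H g] by blast
  interpret spectral_resolution N \<phi> H E by (rule sr)
  have Ac: "A \<in> carrier_mat N N" using A by (simp add: hermitian_mat_def)
  define p where "p \<psi> j = cmod (amplitude \<psi> j) / vec_nrm \<psi>" for \<psi> j
  have formula: "fluctuation H A (normalized \<psi>) = (\<Sum>j<N. \<Sum>k<N. of_bool (j \<noteq> k) *
      ((p \<psi> j)\<^sup>2 * (p \<psi> k)\<^sup>2 * (cmod (matrix_element A j k))\<^sup>2))" if "\<psi> \<in> carrier_vec N" for \<psi>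
    unfolding p_def using that amplitude_normalized[OF that]
    by (subst fluctuation_formula[OF gap Ac]) (simp_all add: normalized_def)
  have pm: "(\<lambda>\<psi>. p \<psi> j) \<in> borel_measurable (vec_borel N)" for j
    unfolding p_def by (intro borel_measurable_divide measurable_compose[OF _ borel_measurable_norm] amplitude_measurable vec_nrm_measurable)
  have "(\<lambda>\<psi>. \<Sum>j<N. \<Sum>k<N. of_bool (j \<noteq> k) *
      ((p \<psi> j)\<^sup>2 * (p \<psi> k)\<^sup>2 * (cmod (matrix_element A j k))\<^sup>2)) \<in> borel_measurable (vec_borel N)"
    by (intro borel_measurable_sum borel_measurable_times borel_measurable_power borel_measurable_const pm)
  then have m: "(\<lambda>\<psi>. fluctuation H A (normalized \<psi>)) \<in> borel_measurable (vec_borel N)"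
    by (rule iffD2[OF measurable_cong, rotated]) (use formula in \<open>simp only: space_vec_borel\<close>)
  have "fluctuation H A (normalized \<psi>) \<le>
      (op_norm A)\<^sup>2 * (\<Sum>j<N. cmod (amplitude \<psi> j) ^ 4) / (\<Sum>x<N. (cmod (\<psi> $ x))\<^sup>2)\<^sup>2"
    if \<psi>: "\<psi> \<in> carrier_vec N" for \<psi>
  proof -
    have "(vec_nrm \<psi>) ^ 4 = ((vec_nrm \<psi>)\<^sup>2)\<^sup>2" by (simp flip: power_mult)
    also have "\<dots> = (\<Sum>x<N. (cmod (\<psi> $ x))\<^sup>2)\<^sup>2" using \<psi> by (simp add: vec_nrm_square)
    finally have nrm: "(vec_nrm \<psi>) ^ 4 = (\<Sum>x<N. (cmod (\<psi> $ x))\<^sup>2)\<^sup>2" .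
    have "fluctuation H A (normalized \<psi>) \<le> (op_norm A)\<^sup>2 * (\<Sum>k<N. (p \<psi> k) ^ 4)"
      unfolding formula[OF \<psi>] by (rule weighted_matrix_elements_bound[OF A])
    also have "(\<Sum>k<N. (p \<psi> k) ^ 4) = (\<Sum>j<N. cmod (amplitude \<psi> j) ^ 4) / (vec_nrm \<psi>) ^ 4"
      by (simp add: p_def power_divide sum_divide_distrib)
    finally show ?thesis by (simp add: nrm)
  qed
  then show thesis using that[OF onb_axioms m] by blast
qed

context random_mps
begin

text \<open>\<open>e\<close> is the cutoff for the unnormalised sum of fourth powers. Outside two
  bad events the squared norm is at least 1/2 and this sum is below \<open>e\<close>; the square of
  1/2 in the denominator explains the factor 4 in \<open>b\<close>. The other 4 comes from Chebyshev
  at distance 1/2.\<close>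

lemma fluctuation_tail:
  assumes H: "hermitian_mat (d ^ n) H" and g: "nondegenerate_gaps H" and A: "hermitian_mat (d ^ n) A"
    and e: "0 < e" and b: "4 * (op_norm A)\<^sup>2 * e \<le> b"
  shows "1 - (4 * (real d * ((real D)\<^sup>2 - 1) / ((real d * real D)\<^sup>2 - 1)) ^ n +
      2 * ((real D + 1) / (real d * real D + 1)) ^ n / e)
    \<le> measure (rmps_distr \<mu> d n D) {\<psi> \<in> space (rmps_distr \<mu> d n D). fluctuation H A (normalized \<psi>) \<le> b}"
proof -
  interpret P: prob_space P by (rule prob_space_P)
  let ?M = "d ^ n"
  obtain \<phi> where onb: "onb ?M \<phi>"
    and m: "(\<lambda>\<psi>. fluctuation H A (normalized \<psi>)) \<in> borel_measurable (vec_borel ?M)"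
    and bound: "\<And>\<psi>. \<psi> \<in> carrier_vec ?M \<Longrightarrow> fluctuation H A (normalized \<psi>) \<le>
      (op_norm A)\<^sup>2 * (\<Sum>j<?M. cmod (onb.amplitude ?M \<phi> \<psi> j) ^ 4) / (\<Sum>x<?M. (cmod (\<psi> $ x))\<^sup>2)\<^sup>2"
    using fluctuation_normalized[OF H g A] by blast
  interpret onb ?M \<phi> by (rule onb)
  define N where "N U = (\<Sum>x<?M. (cmod (rmps d n D U $ x))\<^sup>2)" for U
  define Q where "Q U = (\<Sum>j<?M. cmod (amplitude (rmps d n D U) j) ^ 4)" for U
  let ?r = "(real D + 1) / (real d * (real d * real D + 1))"
  have unit: "(\<Sum>x<?M. (cmod (\<phi> j x))\<^sup>2) = 1" if "j < ?M" for j
  proof -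
    have "complex_of_real (\<Sum>x<?M. (cmod (\<phi> j x))\<^sup>2) = 1"
      using orth[OF that that] by (simp add: complex_norm_square del: of_real_power)
    then show ?thesis using of_real_eq_1_iff by blast
  qed
  have Qint: "integrable P Q"
    unfolding Q_def amplitude_def using fourth_moment_le(1)[OF unit]
    by (intro Bochner_Integration.integrable_sum) auto
  have "(LINT U|P. Q U) = (\<Sum>j<?M. LINT U|P. cmod (amplitude (rmps d n D U) j) ^ 4)"
    unfolding Q_def amplitude_def using fourth_moment_le(1)[OF unit]
    by (intro Bochner_Integration.integral_sum) auto
  also have "\<dots> \<le> (\<Sum>j<?M. 2 * ?r ^ n)"
    unfolding amplitude_def using fourth_moment_le(2)[OF unit] by (intro sum_mono) auto
  \<comment> \<open>The number \<open>d ^ n\<close> of eigenvectors absorbs one factor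
    \<open>d\<close> of each site.\<close>
  also have "\<dots> = 2 * (real d * ?r) ^ n" 
    by (simp only: sum_constant card_lessThan of_nat_power power_mult_distrib mult_ac)
  also have "real d * ?r = (real D + 1) / (real d * real D + 1)" using dD by simp
  finally have EQ: "(LINT U|P. Q U) \<le> 2 * ((real D + 1) / (real d * real D + 1)) ^ n" .
  let ?B1 = "{U \<in> space P. 1 / 4 \<le> (N U - 1)\<^sup>2}" and ?B2 = "{U \<in> space P. e \<le> Q U}"
  have Nint: "integrable P (\<lambda>U. (N U - 1)\<^sup>2)" unfolding N_def by (rule norm_variance)
  have "measure P ?B1 \<le> (LINT U|P. (N U - 1)\<^sup>2) / (1 / 4)"
    by (rule integral_Markov_inequality_measure[where A = "{}"]) (use Nint in auto)
  then have B1: "measure P ?B1 \<le> 4 * (real d * ((real D)\<^sup>2 - 1) / ((real d * real D)\<^sup>2 - 1)) ^ n"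
    unfolding N_def norm_variance(2) by simp
  have Q0: "0 \<le> Q U" for U unfolding Q_def by (intro sum_nonneg) simp
  have "measure P ?B2 \<le> (LINT U|P. Q U) / e"
    by (rule integral_Markov_inequality_measure[where A = "{}"]) (use Qint Q0 e in auto)
  also have "\<dots> \<le> 2 * ((real D + 1) / (real d * real D + 1)) ^ n / e"
    using EQ e by (simp add: divide_right_mono)
  finally have B2: "measure P ?B2 \<le> 2 * ((real D + 1) / (real d * real D + 1)) ^ n / e" .
  have sets: "?B1 \<in> sets P" "?B2 \<in> sets P"
    using borel_measurable_integrable[OF Nint] borel_measurable_integrable[OF Qint] by measurable
  let ?S = "{\<psi> \<in> space (vec_borel ?M). fluctuation H A (normalized \<psi>) \<le> b}"
  have S: "?S \<in> sets (vec_borel ?M)" using m by measurable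
  have "space P - (?B1 \<union> ?B2) \<subseteq> rmps d n D -` ?S \<inter> space P"
  proof
    fix U assume U: "U \<in> space P - (?B1 \<union> ?B2)"
    then have "(N U - 1)\<^sup>2 < (1 / 2)\<^sup>2" and QU: "Q U < e" by (auto simp: power2_eq_square)
    then have "\<bar>N U - 1\<bar>\<^sup>2 < (1 / 2)\<^sup>2" by (simp only: power2_abs)
    then have "\<bar>N U - 1\<bar> < 1 / 2" by (rule power_less_imp_less_base) simp
    then have "1 / 2 \<le> N U" by linarith
    then have "(1 / 2)\<^sup>2 \<le> (N U)\<^sup>2" by (intro power_mono) auto
    then have N2: "1 / 4 \<le> (N U)\<^sup>2" by (simp add: power2_eq_square)
    have \<psi>: "rmps d n D U \<in> carrier_vec ?M" by (simp add: rmps_def)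
    have "fluctuation H A (normalized (rmps d n D U)) \<le> (op_norm A)\<^sup>2 * Q U / (N U)\<^sup>2"
      using bound[OF \<psi>] by (simp add: Q_def N_def)
    also have "\<dots> \<le> (op_norm A)\<^sup>2 * e / (1 / 4)"
      using N2 QU Q0[of U] by (intro frac_le mult_left_mono mult_nonneg_nonneg) auto
    also have "\<dots> \<le> b" using b by simp
    finally show "U \<in> rmps d n D -` ?S \<inter> space P" using U \<psi> by (simp add: space_vec_borel)
  qed
  then have "P.prob (space P - (?B1 \<union> ?B2)) \<le> P.prob (rmps d n D -` ?S \<inter> space P)"
    using measurable_sets[OF rmps_measurable S] by (intro P.finite_measure_mono)
  also have "\<dots> = measure (rmps_distr \<mu> d n D) ?S"
    unfolding rmps_distr_def by (rule measure_distr[OF rmps_measurable S, symmetric])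
  also have "?S = {\<psi> \<in> space (rmps_distr \<mu> d n D). fluctuation H A (normalized \<psi>) \<le> b}"
    by (simp add: rmps_distr_def)
  finally have "P.prob (space P - (?B1 \<union> ?B2)) \<le>
    measure (rmps_distr \<mu> d n D) {\<psi> \<in> space (rmps_distr \<mu> d n D). fluctuation H A (normalized \<psi>) \<le> b}" .
  moreover have "P.prob (space P - (?B1 \<union> ?B2)) = 1 - P.prob (?B1 \<union> ?B2)"
    using sets by (intro P.prob_compl) auto
  moreover have "P.prob (?B1 \<union> ?B2) \<le> P.prob ?B1 + P.prob ?B2"
    using sets by (rule measure_Un_le)
  ultimately show ?thesis using B1 B2 by linarith
qed

end

section \<open>The rate and the choice of constants\<close>

lemma rmps_rate_eq:
  assumes "1 \<le> d" "1 \<le> D"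
  shows "rmps_rate d D = ln ((real d * real D - 1) / (real D + 1))"
proof -
  define x y where "x = real d" and "y = real D"
  have xy: "0 < x" "0 < y" using assms by (auto simp: x_def y_def)
  then have "0 < 1 / (x * y)" by simp
  then have nz: "1 + 1 / (x * y) \<noteq> 0" by linarith
  \<comment> \<open>A difference of squares, \<open>(x y)\<^sup>2 - 1\<close> over
    \<open>x y\<^sup>2\<close>, whose factor \<open>x y + 1\<close> cancels against the denominator
    of the rate.\<close>
  have "x - 1 / (x * y\<^sup>2) = (x * y - 1) / y * (1 + 1 / (x * y))"
    using xy by (simp add: field_simps power2_eq_square)
  moreover have "1 + 1 / y = (y + 1) / y" using xy by (simp add: field_simps)
  ultimately have "(x - 1 / (x * y\<^sup>2)) / ((1 + 1 / y) * (1 + 1 / (x * y))) = (x * y - 1) / (y + 1)"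
    using xy nz by simp
  then show ?thesis by (simp add: rmps_rate_def x_def y_def)
qed

text \<open>A positive rate is bounded away from zero, with the minimum at \<open>d = 2\<close>, \<open>D = 3\<close>; this
  absorbs all constant factors into the exponentials uniformly in \<open>d\<close> and \<open>D\<close>.\<close>

lemma rmps_rate_pos:
  assumes dD: "1 \<le> d" "1 \<le> D" and pos: "0 < rmps_rate d D"
  shows "2 \<le> d * D" "5 / 4 \<le> (real d * real D - 1) / (real D + 1)"
proof -
  have lt: "D + 2 < d * D"
  proof (rule ccontr)
    assume "\<not> D + 2 < d * D"
    then have "real d * real D - 1 \<le> real D + 1"
      by (metis (no_types, opaque_lifting) not_less of_nat_le_iff of_nat_mult of_nat_add of_nat_numeral
          diff_le_eq add.assoc one_add_one)
    moreover have "0 \<le> real d * real D - 1"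
      using mult_mono[of 1 "real d" 1 "real D"] dD by simp
    ultimately have "(real d * real D - 1) / (real D + 1) \<le> 1" "0 \<le> (real d * real D - 1) / (real D + 1)"
      by (simp_all add: divide_le_eq)
    then have "ln ((real d * real D - 1) / (real D + 1)) \<le> 0"
      by (cases "(real d * real D - 1) / (real D + 1) = 0") (simp_all add: ln_le_zero_iff del: divide_eq_0_iff)
    then show False using pos rmps_rate_eq[OF dD] by simp
  qed
  then show "2 \<le> d * D" by simp
  \<comment> \<open>The claimed ratio bound, cross-multiplied. \<open>lt\<close> excludes
    \<open>d = 1\<close>, forces \<open>D \<ge> 3\<close> for \<open>d = 2\<close> with equality at
    \<open>D = 3\<close>, and \<open>D \<ge> 2\<close> for \<open>d = 3\<close>; from
    \<open>d = 4\<close> on, \<open>D \<ge> 1\<close> is enough.\<close>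
  have "5 * (D + 1) + 4 \<le> 4 * (d * D)"
  proof -
    consider "d = 1" | "d = 2" | "d = 3" | "4 \<le> d" using dD by linarith
    then show ?thesis
    proof cases
      case 4
      then have "4 * D \<le> d * D" by simp
      moreover have "5 * (D + 1) + 4 \<le> 4 * p" if "4 * D \<le> p" for p using that dD(2) by simp
      ultimately show ?thesis by blast
    qed (use lt in auto)
  qed
  then have "real (5 * (D + 1) + 4) \<le> real (4 * (d * D))" by (rule of_nat_mono)
  then show "5 / 4 \<le> (real d * real D - 1) / (real D + 1)" by (simp add: le_divide_eq)
qed

theorem theorem1:
  shows "\<exists>c\<^sub>1 > 0. \<exists>c\<^sub>2 > 0. \<forall>\<Lambda>. subexponential \<Lambda> \<longrightarrow>
    (\<exists>n\<^sub>0. \<forall>n \<ge> n\<^sub>0. \<forall>d \<ge> 1. \<forall>D \<ge> 1. \<forall>\<mu> H A.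
      is_haar (d * D) \<mu> \<longrightarrow>
      hermitian_mat (d ^ n) H \<longrightarrow> nondegenerate_spectrum H \<longrightarrow> nondegenerate_gaps H \<longrightarrow>
      hermitian_mat (d ^ n) A \<longrightarrow> op_norm A \<le> \<Lambda> n \<longrightarrow>
      measure (rmps_distr \<mu> d n D)
          {\<psi> \<in> space (rmps_distr \<mu> d n D).
             fluctuation H A (normalized \<psi>) \<le> exp (- c\<^sub>1 * rmps_rate d D * real n)}
        \<ge> 1 - exp (- c\<^sub>2 * rmps_rate d D * real n))"
proof (intro exI[of _ "1 / 4 :: real"] conjI allI impI)
  show "0 < (1 / 4 :: real)" "0 < (1 / 4 :: real)" by simp_all
  fix \<Lambda> assume sub: "subexponential \<Lambda>"
  \<comment> \<open>\<open>\<kappa>\<close> bounds every positive rate from below. The observable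
    enters squared, so the exponent \<open>\<kappa> / 16\<close> below costs a factor
    \<open>exp (\<kappa> n / 8)\<close>.\<close>
  define \<kappa> where "\<kappa> = ln (5 / 4 :: real)"
  have \<kappa>: "0 < \<kappa>" by (simp add: \<kappa>_def)
  then have "\<forall>\<^sub>F n in sequentially. \<Lambda> n \<le> exp (\<kappa> / 16 * real n)"
    using sub unfolding subexponential_def by (metis divide_pos_pos zero_less_numeral)
  \<comment> \<open>This makes \<open>exp (\<kappa> n / 8)\<close> at least 6, enough for the factor
    4 in front of the norm and for the sum 4 + 2 of the two tail constants.\<close>
  moreover have "\<forall>\<^sub>F n in sequentially. 8 * ln 6 / \<kappa> \<le> real n"
    using filterlim_real_sequentially unfolding filterlim_at_top by blast
  moreover have "\<forall>\<^sub>F n in sequentially. 0 < n" by (rule eventually_gt_at_top)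
  ultimately have "\<forall>\<^sub>F n in sequentially. \<Lambda> n \<le> exp (\<kappa> / 16 * real n) \<and> 8 * ln 6 / \<kappa> \<le> real n \<and> 0 < n"
    by (intro eventually_conj)
  then obtain n0 where n0: "\<And>n. n \<ge> n0 \<Longrightarrow> \<Lambda> n \<le> exp (\<kappa> / 16 * real n) \<and> 8 * ln 6 / \<kappa> \<le> real n \<and> 0 < n"
    unfolding eventually_sequentially by blast
  show "\<exists>n\<^sub>0. \<forall>n \<ge> n\<^sub>0. \<forall>d \<ge> 1. \<forall>D \<ge> 1. \<forall>\<mu> H A.
      is_haar (d * D) \<mu> \<longrightarrow>
      hermitian_mat (d ^ n) H \<longrightarrow> nondegenerate_spectrum H \<longrightarrow> nondegenerate_gaps H \<longrightarrow>
      hermitian_mat (d ^ n) A \<longrightarrow> op_norm A \<le> \<Lambda> n \<longrightarrow>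
      measure (rmps_distr \<mu> d n D)
          {\<psi> \<in> space (rmps_distr \<mu> d n D).
             fluctuation H A (normalized \<psi>) \<le> exp (- (1 / 4) * rmps_rate d D * real n)}
        \<ge> 1 - exp (- (1 / 4) * rmps_rate d D * real n)"
  proof (intro exI allI impI)
    fix n d D :: nat and \<mu> H A
    assume large: "n0 \<le> n" and dD: "1 \<le> d" "1 \<le> D" and haar: "is_haar (d * D) \<mu>"
      and H: "hermitian_mat (d ^ n) H" and g: "nondegenerate_gaps H"
      and A: "hermitian_mat (d ^ n) A" and op: "op_norm A \<le> \<Lambda> n"
    define \<alpha> where "\<alpha> = rmps_rate d D"
    show "1 - exp (- (1 / 4) * rmps_rate d D * real n) \<le> measure (rmps_distr \<mu> d n D)
        {\<psi> \<in> space (rmps_distr \<mu> d n D). fluctuation H A (normalized \<psi>) \<le> exp (- (1 / 4) * rmps_rate d D * real n)}"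
    proof (cases "0 < \<alpha>")
      \<comment> \<open>The lower bound for the probability is at most 0 here. This covers
        \<open>d = D = 1\<close>, where the logarithm is taken at 0 and
        \<open>ln 0 = 0\<close>.\<close>
      case False
      then have "1 \<le> exp (- (1 / 4) * rmps_rate d D * real n)"
        by (simp add: \<alpha>_def mult_nonpos_nonneg)
      then show ?thesis by (intro order.trans[OF _ measure_nonneg]) simp
    next
      case True
      note rate = rmps_rate_pos[OF dD True[unfolded \<alpha>_def]]
      define r where "r = (real D + 1) / (real d * real D - 1)"
      have q: "2 \<le> real d * real D" using rate(1) by (metis of_nat_le_iff of_nat_mult of_nat_numeral)
      have \<alpha>: "\<kappa> \<le> \<alpha>"
        unfolding \<alpha>_def \<kappa>_def rmps_rate_eq[OF dD] using rate(2) by (intro ln_mono) auto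
      have r: "r = exp (- \<alpha>)"
      proof -
        have "0 < (real d * real D - 1) / (real D + 1)" using rate(2) by linarith
        then have "exp \<alpha> = (real d * real D - 1) / (real D + 1)" by (simp add: \<alpha>_def rmps_rate_eq[OF dD])
        then show ?thesis by (simp add: exp_minus r_def)
      qed
      have rn: "r ^ n = exp (- \<alpha> * real n)" unfolding r by (simp add: exp_of_nat_mult[symmetric] mult.commute)
      interpret random_mps d D \<mu> n
        by unfold_locales (use haar rate(1) n0[OF large] in auto)
      \<comment> \<open>The cutoff is the square root of \<open>r ^ n\<close>, so that Markov's
        quotient \<open>r ^ n / e\<close> equals \<open>e\<close>.\<close>
      define e where "e = exp (- (1 / 2) * \<alpha> * real n)"
      have big: "6 \<le> exp (\<kappa> * real n / 8)"
      proof -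
        have "ln 6 \<le> \<kappa> * real n / 8" using n0[OF large] \<kappa> by (simp add: field_simps)
        then have "exp (ln 6) \<le> exp (\<kappa> * real n / 8)" by (simp only: exp_le_cancel_iff)
        then show ?thesis by simp
      qed
      have \<kappa>\<alpha>: "\<kappa> * real n \<le> \<alpha> * real n" using \<alpha> by (rule mult_right_mono) simp
      have M: "0 < d ^ n" using dD by simp
      have "(op_norm A)\<^sup>2 \<le> (exp (\<kappa> / 16 * real n))\<^sup>2"
        using op n0[OF large] op_norm_nonneg[OF _ M, of A] A by (intro power_mono) (auto simp: hermitian_mat_def)
      also have "\<dots> = exp (\<kappa> * real n / 8)" by (simp flip: exp_double)
      finally have "4 * (op_norm A)\<^sup>2 * e \<le> exp (\<kappa> * real n / 8) * exp (\<kappa> * real n / 8) * e"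
        using big by (intro mult_right_mono mult_mono) (auto simp: e_def)
      also have "\<dots> = exp (\<kappa> * real n / 4 - \<alpha> * real n / 2)" by (simp add: e_def flip: exp_add)
      also have "\<dots> \<le> exp (- (1 / 4) * \<alpha> * real n)" using \<kappa>\<alpha> by simp
      finally have b: "4 * (op_norm A)\<^sup>2 * e \<le> exp (- (1 / 4) * \<alpha> * real n)" .
      \<comment> \<open>After factoring both differences of squares, the base is \<open>r\<close>
        times \<open>d (D - 1) / (d D + 1)\<close>, and this quotient is at most 1.\<close>
      have l1: "(real d * ((real D)\<^sup>2 - 1) / ((real d * real D)\<^sup>2 - 1)) ^ n \<le> r ^ n"
      proof (rule power_mono)
        have sq: "(real d * real D)\<^sup>2 - 1 = (real d * real D - 1) * (real d * real D + 1)"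
          "real d * ((real D)\<^sup>2 - 1) = (real D + 1) * (real d * (real D - 1))"
          by (simp_all add: power2_eq_square algebra_simps)
        have "real d * (real D - 1) / (real d * real D + 1) \<le> 1"
          using dD q by (simp add: divide_le_eq algebra_simps)
        then have "r * (real d * (real D - 1) / (real d * real D + 1)) \<le> r * 1"
          using q by (intro mult_left_mono) (auto simp: r_def)
        then show "real d * ((real D)\<^sup>2 - 1) / ((real d * real D)\<^sup>2 - 1) \<le> r" by (simp add: sq r_def)
        show "0 \<le> real d * ((real D)\<^sup>2 - 1) / ((real d * real D)\<^sup>2 - 1)"
          unfolding sq using dD q by simp
      qed
      have l2: "((real D + 1) / (real d * real D + 1)) ^ n \<le> r ^ n"
        unfolding r_def using q by (intro power_mono divide_left_mono) auto
      have "4 * (real d * ((real D)\<^sup>2 - 1) / ((real d * real D)\<^sup>2 - 1)) ^ n +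
          2 * ((real D + 1) / (real d * real D + 1)) ^ n / e \<le> 4 * r ^ n + 2 * r ^ n / e"
        using l1 l2 by (intro add_mono mult_left_mono divide_right_mono) (auto simp: e_def)
      also have "2 * r ^ n / e = 2 * e"
      proof -
        have "r ^ n = e * e" unfolding rn e_def by (simp flip: exp_add)
        then show ?thesis by (simp add: e_def)
      qed
      also have "4 * r ^ n \<le> 4 * e"
        unfolding rn e_def using True by simp
      also have "4 * e + 2 * e = 6 * e" by simp
      also have "\<dots> \<le> exp (\<kappa> * real n / 8) * e" using big by (intro mult_right_mono) (auto simp: e_def)
      also have "\<dots> = exp (\<kappa> * real n / 8 - \<alpha> * real n / 2)" by (simp add: e_def flip: exp_add)
      also have "\<dots> \<le> exp (- (1 / 4) * \<alpha> * real n)"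
      proof -
        have "0 \<le> \<alpha> * real n" using True by simp
        then show ?thesis using \<kappa>\<alpha> by simp
      qed
      finally have "1 - exp (- (1 / 4) * \<alpha> * real n) \<le> 1 - (4 * (real d * ((real D)\<^sup>2 - 1) / ((real d * real D)\<^sup>2 - 1)) ^ n +
          2 * ((real D + 1) / (real d * real D + 1)) ^ n / e)" by simp
      also have "\<dots> \<le> measure (rmps_distr \<mu> d n D)
          {\<psi> \<in> space (rmps_distr \<mu> d n D). fluctuation H A (normalized \<psi>) \<le> exp (- (1 / 4) * \<alpha> * real n)}"
        by (rule fluctuation_tail[OF H g A _ b]) (simp add: e_def)
      finally show ?thesis by (simp add: \<alpha>_def)
    qed
  qed
qed

end
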